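(* Let $R$ be a discrete valuation ring with fixed uniformizer $t$, let $(X,c)$ be a cyclic poset and let $\phi$ be an admissible automorphism of $(X,c)$. Then $\mathcal{MF}_\phi(X)$ is a Frobenius category whose projective-injective objects are given by $G_\phi V$ for all $V$ in $\mathcal P(X)$ (up to isomorphism).
   Context: $\mathbb N=\{0,1,2,\dots\}$. A poset is a set with a reflexive transitive relation $\le$ (not necessarily antisymmetric); $x\approx y$ means $x\le y$ and $y\le x$; $x<y$ means $x\le y$ and $x\not\approx y$. Covering posets: a covering poset of a set $X$ is a poset $\tilde X$ with a surjection $\pi:\tilde X\to X$ such that (1) each $\pi^{-1}(x)$ is isomorphic as a poset to $\mathbb Z$ with its usual order; (2) there is a poset automorphism $\sigma$ of $\tilde X$ such that $\sigma\tilde x$ is the smallest element of $\pi^{-1}(\pi(\tilde x))$ greater than $\tilde x$, for all $\tilde x$; (3) for all $\tilde x,\tilde y\in\tilde X$ there is an integer $m\ge0$ with $\tilde x\le\sigma^m\tilde y\le\sigma^{2m}\tilde x$. Given a section $\lambda$ of $\pi$, let $b_\lambda(xy)$ be the smallest integer $m$ with $\lambda(x)\le\sigma^m\lambda(y)$; the structure cocycle is $c(xyz)=b_\lambda(yz)-b_\lambda(xz)+b_\lambda(xy)$ (independent of $\lambda$). A cyclic poset is a pair $(X,c)$ where $c:X^3\to\mathbb N$ is a reduced cocycle: $c(xyz)-c(wyz)+c(wxz)-c(wxy)=0$ and $c(xxy)=c(xyy)=0$ for all $w,x,y,z\in X$. Every such $c$ is the structure cocycle of a covering poset $\tilde X\to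 X$, unique up to $\sigma$-equivariant poset isomorphism over $X$; it is called the covering poset of $(X,c)$. Linearization: $RX$ is the $R$-category with objects $P_x$, $x\in X$, with $RX(P_x,P_y)$ the free $R$-module on one generator $f_{xy}$ (the basic morphism), and composition $(rf_{yz})\circ(sf_{xy})=rst^{c(xyz)}f_{xz}$. $\mathcal P(X)=\mathrm{add}\,RX$ is the additive $R$-category generated by $RX$ (finite direct sums of the $P_x$). Admissible automorphism: an automorphism $\phi$ of $(X,c)$ (a bijection preserving $c$) covered by a $\sigma$-equivariant order preserving bijection $\tilde\phi:\tilde X\to\tilde X$ with $x\le\tilde\phi x\le\tilde\phi^2x<\sigma x$ for all $x\in\tilde X$. It induces an additive $R$-linear automorphism $\phi$ of $\mathcal P(X)$ with $\phi P_x=P_{\phi x}$, $\phi f_{xy}=f_{\phi x,\phi y}$. There are natural transformations $\eta_P:P\to\phi P$ and $\xi_P:\phi P\to P$ where $\eta_{P_x}=f_{x,\phi x}$ and $\xi_P$ is the unique morphism with $\xi_P\eta_P=t$; also $\eta_P\xi_P=t$. $\mathcal{MF}(X)$ is the category of pairs $(P,d)$ with $P\in\mathcal P(X)$, $d:P\to P$, $d^2=$ multiplication by $t$; morphisms $(P,d)\to(Q,d)$ are morphisms $f:P\to Q$ with $df=fd$. $\mathcal{MF}_\phi(X)$ is the full subcategory of those $(P,d)$ such that $d$ factors through $\eta_P:P\to\phi P$. A sequence $(A,d)\to(B,d)\to(C,d)$ in $\mathcal{MF}_\phi(X)$ is defined to be exact if $A\to B\to C$ is split exact in $\mathcal P(X)$.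 For $P\in\mathcal P(X)$, $G_\phi P=\left(P\oplus\phi P,\begin{bmatrix}0&\xi_P\\ \eta_P&0\end{bmatrix}\right)$. A Frobenius category is an exact category with enough projectives and enough injectives in which projectives and injectives coincide. *)

theory Defs
  imports Complex_Main "HOL-Library.Function_Algebras"
begin

section \<open>Discrete valuation rings\<close>

definition ring_ideal :: "'r::comm_ring_1 set \<Rightarrow> bool" where
  "ring_ideal I \<longleftrightarrow> 0 \<in> I \<and> (\<forall>a\<in>I. \<forall>b\<in>I. a + b \<in> I) \<and> (\<forall>r. \<forall>a\<in>I. r * a \<in> I)"

definition prime_ring_ideal :: "'r::comm_ring_1 set \<Rightarrow> bool" where
  "prime_ring_ideal P \<longleftrightarrow>
     ring_ideal P \<and> P \<noteq> UNIV \<and> (\<forall>a b. a * b \<in> P \<longrightarrow> a \<in> P \<or> b \<in> P)"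

text \<open>A discrete valuation ring is a principal ideal domain with exactly one nonzero prime
  ideal; a uniformizer is a generator of that ideal.\<close>

definition discrete_valuation_ring :: "'r::idom itself \<Rightarrow> bool" where
  "discrete_valuation_ring (_ :: 'r itself) \<longleftrightarrow>
     (\<forall>I::'r set. ring_ideal I \<longrightarrow> (\<exists>a. I = range ((*) a))) \<and>
     (\<exists>!P::'r set. prime_ring_ideal P \<and> P \<noteq> {0})"

definition uniformizer :: "'r::idom \<Rightarrow> bool" where
  "uniformizer t \<longleftrightarrow> t \<noteq> 0 \<and> prime_ring_ideal (range ((*) t))"


section \<open>Additive, exact and Frobenius categories\<close>

text \<open>Hom-sets are subgroups of one ambient abelian group. They need not be disjoint, so
  composition takes the three objects as arguments: \<open>cmp C A B D g f\<close> is the composite of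
  \<open>f : A \<rightarrow> B\<close> and \<open>g : B \<rightarrow> D\<close>.\<close>

record ('o, 'm) cat =
  ob :: "'o set"
  hm :: "'o \<Rightarrow> 'o \<Rightarrow> 'm set"
  cmp :: "'o \<Rightarrow> 'o \<Rightarrow> 'o \<Rightarrow> 'm \<Rightarrow> 'm \<Rightarrow> 'm"
  idn :: "'o \<Rightarrow> 'm"

record ('r, 'o, 'm) rcat = "('o, 'm) cat" +
  smul :: "'r \<Rightarrow> 'm \<Rightarrow> 'm"

locale category =
  fixes C :: "('o, 'm, 'z) cat_scheme"
  assumes idn_in: "A \<in> ob C \<Longrightarrow> idn C A \<in> hm C A A"
    and cmp_in: "\<lbrakk>A \<in> ob C; B \<in> ob C; D \<in> ob C; f \<in> hm C A B; g \<in> hm C B D\<rbrakk>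
      \<Longrightarrow> cmp C A B D g f \<in> hm C A D"
    and cmp_idn: "\<lbrakk>A \<in> ob C; B \<in> ob C; f \<in> hm C A B\<rbrakk> \<Longrightarrow> cmp C A A B f (idn C A) = f"
    and idn_cmp: "\<lbrakk>A \<in> ob C; B \<in> ob C; f \<in> hm C A B\<rbrakk> \<Longrightarrow> cmp C A B B (idn C B) f = f"
    and cmp_assoc: "\<lbrakk>A \<in> ob C; B \<in> ob C; D \<in> ob C; E \<in> ob C;
        f \<in> hm C A B; g \<in> hm C B D; h \<in> hm C D E\<rbrakk>
      \<Longrightarrow> cmp C A D E h (cmp C A B D g f) = cmp C A B E (cmp C B D E h g) f"

locale preadditive_category = category C
  for C :: "('o, 'm::ab_group_add, 'z) cat_scheme" +
  assumes zero_in: "\<lbrakk>A \<in> ob C; B \<in> ob C\<rbrakk> \<Longrightarrow> 0 \<in> hm C A B"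
    and add_in: "\<lbrakk>A \<in> ob C; B \<in> ob C; f \<in> hm C A B; g \<in> hm C A B\<rbrakk> \<Longrightarrow> f + g \<in> hm C A B"
    and uminus_in: "\<lbrakk>A \<in> ob C; B \<in> ob C; f \<in> hm C A B\<rbrakk> \<Longrightarrow> - f \<in> hm C A B"
    and cmp_add_left: "\<lbrakk>A \<in> ob C; B \<in> ob C; D \<in> ob C;
        f \<in> hm C A B; g \<in> hm C B D; h \<in> hm C B D\<rbrakk>
      \<Longrightarrow> cmp C A B D (g + h) f = cmp C A B D g f + cmp C A B D h f"
    and cmp_add_right: "\<lbrakk>A \<in> ob C; B \<in> ob C; D \<in> ob C;
        f \<in> hm C A B; g \<in> hm C A B; h \<in> hm C B D\<rbrakk>
      \<Longrightarrow> cmp C A B D h (f + g) = cmp C A B D h f + cmp C A B D h g"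

definition zero_object :: "('o, 'm, 'z) cat_scheme \<Rightarrow> 'o \<Rightarrow> bool" where
  "zero_object C Z \<longleftrightarrow> Z \<in> ob C \<and>
     (\<forall>A\<in>ob C. (\<exists>!f. f \<in> hm C A Z) \<and> (\<exists>!f. f \<in> hm C Z A))"

definition biproduct ::
  "('o, 'm::ab_group_add, 'z) cat_scheme \<Rightarrow> 'o \<Rightarrow> 'o \<Rightarrow> 'o \<Rightarrow> 'm \<Rightarrow> 'm \<Rightarrow> 'm \<Rightarrow> 'm \<Rightarrow> bool" where
  "biproduct C A B S i j p q \<longleftrightarrow> A \<in> ob C \<and> B \<in> ob C \<and> S \<in> ob C \<and>
     i \<in> hm C A S \<and> j \<in> hm C B S \<and> p \<in> hm C S A \<and> q \<in> hm C S B \<and>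
     cmp C A S A p i = idn C A \<and> cmp C B S B q j = idn C B \<and>
     cmp C B S A p j = 0 \<and> cmp C A S B q i = 0 \<and>
     cmp C S A S i p + cmp C S B S j q = idn C S"

locale additive_category = preadditive_category C
  for C :: "('o, 'm::ab_group_add, 'z) cat_scheme" +
  assumes ex_zero_object: "\<exists>Z. zero_object C Z"
    and ex_biproduct: "\<lbrakk>A \<in> ob C; B \<in> ob C\<rbrakk> \<Longrightarrow> \<exists>S i j p q. biproduct C A B S i j p q"

definition iso_in :: "('o, 'm, 'z) cat_scheme \<Rightarrow> 'o \<Rightarrow> 'o \<Rightarrow> 'm \<Rightarrow> bool" where
  "iso_in C A B f \<longleftrightarrow> A \<in> ob C \<and> B \<in> ob C \<and> f \<in> hm C A B \<and>
     (\<exists>g\<in>hm C B A. cmp C A B A g f = idn C A \<and> cmp C B A B f g = idn C B)"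

definition isomorphic_in :: "('o, 'm, 'z) cat_scheme \<Rightarrow> 'o \<Rightarrow> 'o \<Rightarrow> bool" where
  "isomorphic_in C A B \<longleftrightarrow> (\<exists>f. iso_in C A B f)"

definition is_kernel ::
  "('o, 'm::ab_group_add, 'z) cat_scheme \<Rightarrow> 'o \<Rightarrow> 'm \<Rightarrow> 'o \<Rightarrow> 'm \<Rightarrow> 'o \<Rightarrow> bool" where
  "is_kernel C A f B g D \<longleftrightarrow> A \<in> ob C \<and> B \<in> ob C \<and> D \<in> ob C \<and>
     f \<in> hm C A B \<and> g \<in> hm C B D \<and> cmp C A B D g f = 0 \<and>
     (\<forall>Z\<in>ob C. \<forall>h\<in>hm C Z B. cmp C Z B D g h = 0 \<longrightarrow>
        (\<exists>!k. k \<in> hm C Z A \<and> cmp C Z A B f k = h))"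

definition is_cokernel ::
  "('o, 'm::ab_group_add, 'z) cat_scheme \<Rightarrow> 'o \<Rightarrow> 'm \<Rightarrow> 'o \<Rightarrow> 'm \<Rightarrow> 'o \<Rightarrow> bool" where
  "is_cokernel C A f B g D \<longleftrightarrow> A \<in> ob C \<and> B \<in> ob C \<and> D \<in> ob C \<and>
     f \<in> hm C A B \<and> g \<in> hm C B D \<and> cmp C A B D g f = 0 \<and>
     (\<forall>Z\<in>ob C. \<forall>h\<in>hm C B Z. cmp C A B Z h f = 0 \<longrightarrow>
        (\<exists>!k. k \<in> hm C D Z \<and> cmp C B D Z k g = h))"

text \<open>\<open>is_pushout C A f B a A' f' B' b\<close> is the square \<open>b f = f' a\<close> with
  \<open>f : A \<rightarrow> B\<close>, \<open>a : A \<rightarrow> A'\<close>, \<open>f' : A' \<rightarrow> B'\<close>, \<open>b : B \<rightarrow> B'\<close>; dually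
  \<open>is_pullback C B g D B' g' D' b d\<close> is the square \<open>g b = d g'\<close> with
  \<open>g : B \<rightarrow> D\<close>, \<open>g' : B' \<rightarrow> D'\<close>, \<open>b : B' \<rightarrow> B\<close>, \<open>d : D' \<rightarrow> D\<close>.\<close>

definition is_pushout ::
  "('o, 'm, 'z) cat_scheme \<Rightarrow> 'o \<Rightarrow> 'm \<Rightarrow> 'o \<Rightarrow> 'm \<Rightarrow> 'o \<Rightarrow> 'm \<Rightarrow> 'o \<Rightarrow> 'm \<Rightarrow> bool" where
  "is_pushout C A f B a A' f' B' b \<longleftrightarrow>
     A \<in> ob C \<and> B \<in> ob C \<and> A' \<in> ob C \<and> B' \<in> ob C \<and>
     f \<in> hm C A B \<and> a \<in> hm C A A' \<and> f' \<in> hm C A' B' \<and> b \<in> hm C B B' \<and>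
     cmp C A B B' b f = cmp C A A' B' f' a \<and>
     (\<forall>Z\<in>ob C. \<forall>u\<in>hm C B Z. \<forall>v\<in>hm C A' Z. cmp C A B Z u f = cmp C A A' Z v a \<longrightarrow>
        (\<exists>!k. k \<in> hm C B' Z \<and> cmp C B B' Z k b = u \<and> cmp C A' B' Z k f' = v))"

definition is_pullback ::
  "('o, 'm, 'z) cat_scheme \<Rightarrow> 'o \<Rightarrow> 'm \<Rightarrow> 'o \<Rightarrow> 'o \<Rightarrow> 'm \<Rightarrow> 'o \<Rightarrow> 'm \<Rightarrow> 'm \<Rightarrow> bool" where
  "is_pullback C B g D B' g' D' b d \<longleftrightarrow>
     B \<in> ob C \<and> D \<in> ob C \<and> B' \<in> ob C \<and> D' \<in> ob C \<and>
     g \<in> hm C B D \<and> g' \<in> hm C B' D' \<and> b \<in> hm C B' B \<and> d \<in> hm C D' D \<and>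
     cmp C B' B D g b = cmp C B' D' D d g' \<and>
     (\<forall>Z\<in>ob C. \<forall>u\<in>hm C Z B. \<forall>v\<in>hm C Z D'. cmp C Z B D g u = cmp C Z D' D d v \<longrightarrow>
        (\<exists>!k. k \<in> hm C Z B' \<and> cmp C Z B' B b k = u \<and> cmp C Z B' D' g' k = v))"

text \<open>An exact structure is given by its class of conflations: \<open>E A f B g D\<close> means that
  \<open>A \<rightarrow> B \<rightarrow> D\<close> (via \<open>f\<close> and \<open>g\<close>) is an exact sequence of the structure.\<close>

type_synonym ('o, 'm) conflations = "'o \<Rightarrow> 'm \<Rightarrow> 'o \<Rightarrow> 'm \<Rightarrow> 'o \<Rightarrow> bool"

definition inflation :: "('o, 'm) conflations \<Rightarrow> 'o \<Rightarrow> 'o \<Rightarrow> 'm \<Rightarrow> bool" where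
  "inflation E A B f \<longleftrightarrow> (\<exists>g D. E A f B g D)"

definition deflation :: "('o, 'm) conflations \<Rightarrow> 'o \<Rightarrow> 'o \<Rightarrow> 'm \<Rightarrow> bool" where
  "deflation E B D g \<longleftrightarrow> (\<exists>A f. E A f B g D)"

text \<open>Quillen's axioms.\<close>

locale exact_category = additive_category C
  for C :: "('o, 'm::ab_group_add, 'z) cat_scheme" +
  fixes E :: "('o, 'm) conflations"
  assumes conflation_kernel: "E A f B g D \<Longrightarrow> is_kernel C A f B g D"
    and conflation_cokernel: "E A f B g D \<Longrightarrow> is_cokernel C A f B g D"
    and conflation_iso: "\<lbrakk>E A f B g D; iso_in C A A' a; iso_in C B B' b; iso_in C D D' d;
        f' \<in> hm C A' B'; g' \<in> hm C B' D';
        cmp C A B B' b f = cmp C A A' B' f' a; cmp C B D D' d g = cmp C B B' D' g' b\<rbrakk>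
      \<Longrightarrow> E A' f' B' g' D'"
    and inflation_idn: "A \<in> ob C \<Longrightarrow> inflation E A A (idn C A)"
    and deflation_idn: "A \<in> ob C \<Longrightarrow> deflation E A A (idn C A)"
    and inflation_cmp: "\<lbrakk>inflation E A B f; inflation E B D g\<rbrakk>
      \<Longrightarrow> inflation E A D (cmp C A B D g f)"
    and deflation_cmp: "\<lbrakk>deflation E A B f; deflation E B D g\<rbrakk>
      \<Longrightarrow> deflation E A D (cmp C A B D g f)"
    and inflation_pushout: "\<lbrakk>inflation E A B f; A' \<in> ob C; a \<in> hm C A A'\<rbrakk>
      \<Longrightarrow> \<exists>B' f' b. is_pushout C A f B a A' f' B' b \<and> inflation E A' B' f'"
    and deflation_pullback: "\<lbrakk>deflation E B D g; D' \<in> ob C; d \<in> hm C D' D\<rbrakk>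
      \<Longrightarrow> \<exists>B' g' b. is_pullback C B g D B' g' D' b d \<and> deflation E B' D' g'"

definition projective_object ::
  "('o, 'm, 'z) cat_scheme \<Rightarrow> ('o, 'm) conflations \<Rightarrow> 'o \<Rightarrow> bool" where
  "projective_object C E P \<longleftrightarrow> P \<in> ob C \<and>
     (\<forall>B D g h. deflation E B D g \<longrightarrow> h \<in> hm C P D \<longrightarrow> (\<exists>k\<in>hm C P B. cmp C P B D g k = h))"

definition injective_object ::
  "('o, 'm, 'z) cat_scheme \<Rightarrow> ('o, 'm) conflations \<Rightarrow> 'o \<Rightarrow> bool" where
  "injective_object C E I \<longleftrightarrow> I \<in> ob C \<and>
     (\<forall>A B f h. inflation E A B f \<longrightarrow> h \<in> hm C A I \<longrightarrow> (\<exists>k\<in>hm C B I. cmp C A B I k f = h))"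

locale frobenius_category = exact_category C E
  for C :: "('o, 'm::ab_group_add, 'z) cat_scheme" and E +
  assumes enough_projectives:
      "D \<in> ob C \<Longrightarrow> \<exists>P g. projective_object C E P \<and> deflation E P D g"
    and enough_injectives:
      "A \<in> ob C \<Longrightarrow> \<exists>I f. injective_object C E I \<and> inflation E A I f"
    and projective_iff_injective: "projective_object C E P \<longleftrightarrow> injective_object C E P"

definition split_exact :: "('o, 'm::ab_group_add, 'z) cat_scheme \<Rightarrow> ('o, 'm) conflations" where
  "split_exact C A f B g D \<longleftrightarrow> A \<in> ob C \<and> B \<in> ob C \<and> D \<in> ob C \<and>
     f \<in> hm C A B \<and> g \<in> hm C B D \<and> cmp C A B D g f = 0 \<and>
     (\<exists>r\<in>hm C B A. \<exists>s\<in>hm C D B. cmp C A B A r f = idn C A \<and> cmp C D B D g s = idn C D \<and>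
        cmp C B A B f r + cmp C B D B s g = idn C B)"


section \<open>Cyclic posets, covering posets and admissible automorphisms\<close>

definition cyclic_poset :: "'x set \<Rightarrow> ('x \<Rightarrow> 'x \<Rightarrow> 'x \<Rightarrow> nat) \<Rightarrow> bool" where
  "cyclic_poset X c \<longleftrightarrow>
     (\<forall>w\<in>X. \<forall>x\<in>X. \<forall>y\<in>X. \<forall>z\<in>X.
        int (c x y z) - int (c w y z) + int (c w x z) - int (c w x y) = 0) \<and>
     (\<forall>x\<in>X. \<forall>y\<in>X. c x x y = 0 \<and> c x y y = 0)"

text \<open>The posets here are preorders, so the strict part excludes equivalent elements.\<close>

definition strict :: "('y \<Rightarrow> 'y \<Rightarrow> bool) \<Rightarrow> 'y \<Rightarrow> 'y \<Rightarrow> bool" where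
  "strict le x y \<longleftrightarrow> le x y \<and> \<not> le y x"

definition fibre :: "'y set \<Rightarrow> ('y \<Rightarrow> 'x) \<Rightarrow> 'x \<Rightarrow> 'y set" where
  "fibre Y \<pi> x = {y \<in> Y. \<pi> y = x}"

definition covering_poset ::
  "'x set \<Rightarrow> 'y set \<Rightarrow> ('y \<Rightarrow> 'y \<Rightarrow> bool) \<Rightarrow> ('y \<Rightarrow> 'x) \<Rightarrow> ('y \<Rightarrow> 'y) \<Rightarrow> bool" where
  "covering_poset X Y le \<pi> \<sigma> \<longleftrightarrow>
     (\<forall>x\<in>Y. le x x) \<and> (\<forall>x\<in>Y. \<forall>y\<in>Y. \<forall>z\<in>Y. le x y \<longrightarrow> le y z \<longrightarrow> le x z) \<and>
     \<pi> ` Y = X \<and>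
     (\<forall>x\<in>X. \<exists>h::int \<Rightarrow> 'y. bij_betw h UNIV (fibre Y \<pi> x) \<and> (\<forall>m n. le (h m) (h n) \<longleftrightarrow> m \<le> n)) \<and>
     bij_betw \<sigma> Y Y \<and> (\<forall>x\<in>Y. \<forall>y\<in>Y. le (\<sigma> x) (\<sigma> y) \<longleftrightarrow> le x y) \<and>
     (\<forall>x\<in>Y. \<sigma> x \<in> fibre Y \<pi> (\<pi> x) \<and> strict le x (\<sigma> x) \<and>
        (\<forall>y\<in>fibre Y \<pi> (\<pi> x). strict le x y \<longrightarrow> le (\<sigma> x) y)) \<and>
     (\<forall>x\<in>Y. \<forall>y\<in>Y. \<exists>m::nat. le x ((\<sigma> ^^ m) y) \<and> le ((\<sigma> ^^ m) y) ((\<sigma> ^^ (2 * m)) x))"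

definition int_iterate :: "'y set \<Rightarrow> ('y \<Rightarrow> 'y) \<Rightarrow> int \<Rightarrow> 'y \<Rightarrow> 'y" where
  "int_iterate Y \<sigma> m =
     (if m \<ge> 0 then \<sigma> ^^ nat m else inv_into Y \<sigma> ^^ nat (- m))"

definition section_cochain ::
  "'y set \<Rightarrow> ('y \<Rightarrow> 'y \<Rightarrow> bool) \<Rightarrow> ('y \<Rightarrow> 'y) \<Rightarrow> ('x \<Rightarrow> 'y) \<Rightarrow> 'x \<Rightarrow> 'x \<Rightarrow> int" where
  "section_cochain Y le \<sigma> l x y = (LEAST m::int. le (l x) (int_iterate Y \<sigma> m (l y)))"

definition structure_cocycle ::
  "'y set \<Rightarrow> ('y \<Rightarrow> 'y \<Rightarrow> bool) \<Rightarrow> ('y \<Rightarrow> 'y) \<Rightarrow> ('x \<Rightarrow> 'y) \<Rightarrow> 'x \<Rightarrow> 'x \<Rightarrow> 'x \<Rightarrow> int" where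
  "structure_cocycle Y le \<sigma> l x y z =
     section_cochain Y le \<sigma> l y z - section_cochain Y le \<sigma> l x z + section_cochain Y le \<sigma> l x y"

text \<open>The structure cocycle does not depend on the section \<open>l\<close>, so asking for equality with
  \<open>c\<close> for one section is the same as asking for it for all sections.\<close>

definition covering_poset_of :: "'x set \<Rightarrow> ('x \<Rightarrow> 'x \<Rightarrow> 'x \<Rightarrow> nat) \<Rightarrow>
    'y set \<Rightarrow> ('y \<Rightarrow> 'y \<Rightarrow> bool) \<Rightarrow> ('y \<Rightarrow> 'x) \<Rightarrow> ('y \<Rightarrow> 'y) \<Rightarrow> bool" where
  "covering_poset_of X c Y le \<pi> \<sigma> \<longleftrightarrow> covering_poset X Y le \<pi> \<sigma> \<and>
     (\<exists>l. (\<forall>x\<in>X. l x \<in> fibre Y \<pi> x) \<and>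
        (\<forall>x\<in>X. \<forall>y\<in>X. \<forall>z\<in>X. int (c x y z) = structure_cocycle Y le \<sigma> l x y z))"

definition cyclic_poset_automorphism ::
  "'x set \<Rightarrow> ('x \<Rightarrow> 'x \<Rightarrow> 'x \<Rightarrow> nat) \<Rightarrow> ('x \<Rightarrow> 'x) \<Rightarrow> bool" where
  "cyclic_poset_automorphism X c \<phi> \<longleftrightarrow> bij_betw \<phi> X X \<and>
     (\<forall>x\<in>X. \<forall>y\<in>X. \<forall>z\<in>X. c (\<phi> x) (\<phi> y) (\<phi> z) = c x y z)"

definition admissible_automorphism :: "'x set \<Rightarrow> ('x \<Rightarrow> 'x \<Rightarrow> 'x \<Rightarrow> nat) \<Rightarrow>
    'y set \<Rightarrow> ('y \<Rightarrow> 'y \<Rightarrow> bool) \<Rightarrow> ('y \<Rightarrow> 'x) \<Rightarrow> ('y \<Rightarrow> 'y) \<Rightarrow> ('x \<Rightarrow> 'x) \<Rightarrow> bool" where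
  "admissible_automorphism X c Y le \<pi> \<sigma> \<phi> \<longleftrightarrow> cyclic_poset_automorphism X c \<phi> \<and>
     (\<exists>\<phi>'. bij_betw \<phi>' Y Y \<and> (\<forall>x\<in>Y. \<forall>y\<in>Y. le x y \<longrightarrow> le (\<phi>' x) (\<phi>' y)) \<and>
        (\<forall>x\<in>Y. \<pi> (\<phi>' x) = \<phi> (\<pi> x)) \<and> (\<forall>x\<in>Y. \<phi>' (\<sigma> x) = \<sigma> (\<phi>' x)) \<and>
        (\<forall>x\<in>Y. le x (\<phi>' x) \<and> le (\<phi>' x) (\<phi>' (\<phi>' x)) \<and> strict le (\<phi>' (\<phi>' x)) (\<sigma> x)))"


section \<open>Linearization and its additive closure\<close>

text \<open>The object \<open>x\<close> stands for \<open>P\<^sub>x\<close>, and a scalar \<open>r\<close> in \<open>hm (linearization t X c) x y\<close>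
  stands for \<open>r f\<^sub>x\<^sub>y\<close>; in particular the basic morphism \<open>f\<^sub>x\<^sub>y\<close> is \<open>1\<close>.\<close>

definition linearization ::
  "'r::idom \<Rightarrow> 'x set \<Rightarrow> ('x \<Rightarrow> 'x \<Rightarrow> 'x \<Rightarrow> nat) \<Rightarrow> ('r, 'x, 'r) rcat" where
  "linearization t X c = \<lparr>ob = X, hm = (\<lambda>x y. UNIV),
     cmp = (\<lambda>x y z r s. r * s * t ^ c x y z), idn = (\<lambda>x. 1), smul = (*)\<rparr>"

text \<open>Objects are finite formal direct sums, written as lists. A morphism \<open>xs \<rightarrow> ys\<close> is a matrix
  \<open>M\<close> whose entry \<open>M i j\<close> is a morphism from the \<open>j\<close>-th summand of \<open>xs\<close> to the \<open>i\<close>-th summand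
  of \<open>ys\<close>, padded with zeros outside its range.\<close>

definition additive_closure ::
  "('r, 'o, 'm::ab_group_add) rcat \<Rightarrow> ('r, 'o list, nat \<Rightarrow> nat \<Rightarrow> 'm) rcat" where
  "additive_closure C = \<lparr>
     ob = {xs. set xs \<subseteq> ob C},
     hm = (\<lambda>xs ys. {M. \<forall>i j. if i < length ys \<and> j < length xs
        then M i j \<in> hm C (xs ! j) (ys ! i) else M i j = 0}),
     cmp = (\<lambda>xs ys zs N M i k. if i < length zs \<and> k < length xs
        then (\<Sum>j<length ys. cmp C (xs ! k) (ys ! j) (zs ! i) (N i j) (M j k)) else 0),
     idn = (\<lambda>xs i j. if i < length xs \<and> i = j then idn C (xs ! i) else 0),
     smul = (\<lambda>r M i j. smul C r (M i j))\<rparr>"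

type_synonym 'r morph = "nat \<Rightarrow> nat \<Rightarrow> 'r"

definition PX ::
  "'r::idom \<Rightarrow> 'x set \<Rightarrow> ('x \<Rightarrow> 'x \<Rightarrow> 'x \<Rightarrow> nat) \<Rightarrow> ('r, 'x list, 'r morph) rcat" where
  "PX t X c = additive_closure (linearization t X c)"

text \<open>On objects, the automorphism of \<open>PX t X c\<close> induced by \<open>\<phi>\<close> is \<open>map \<phi>\<close>. The diagonal
  entries of \<open>\<eta>\<close> are the basic morphisms from \<open>P\<^sub>x\<close> to \<open>P\<^sub>y\<close>, where \<open>y = \<phi> x\<close>.\<close>

definition eta :: "'x list \<Rightarrow> 'r::idom morph" where
  "eta xs = (\<lambda>i j. if i < length xs \<and> i = j then 1 else 0)"

definition xi ::
  "'r::idom \<Rightarrow> 'x set \<Rightarrow> ('x \<Rightarrow> 'x \<Rightarrow> 'x \<Rightarrow> nat) \<Rightarrow> ('x \<Rightarrow> 'x) \<Rightarrow> 'x list \<Rightarrow> 'r morph" where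
  "xi t X c \<phi> xs = (THE k. k \<in> hm (PX t X c) (map \<phi> xs) xs \<and>
     cmp (PX t X c) xs (map \<phi> xs) xs k (eta xs) = smul (PX t X c) t (idn (PX t X c) xs))"


section \<open>Matrix factorizations\<close>

definition MF :: "'r::idom \<Rightarrow> 'x set \<Rightarrow> ('x \<Rightarrow> 'x \<Rightarrow> 'x \<Rightarrow> nat) \<Rightarrow>
    ('r, 'x list \<times> 'r morph, 'r morph) rcat" where
  "MF t X c = \<lparr>
     ob = {(P, d). P \<in> ob (PX t X c) \<and> d \<in> hm (PX t X c) P P \<and>
        cmp (PX t X c) P P P d d = smul (PX t X c) t (idn (PX t X c) P)},
     hm = (\<lambda>(P, d) (Q, e). {f \<in> hm (PX t X c) P Q.
        cmp (PX t X c) P Q Q e f = cmp (PX t X c) P P Q f d}),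
     cmp = (\<lambda>(P, _) (Q, _) (S, _). cmp (PX t X c) P Q S),
     idn = (\<lambda>(P, _). idn (PX t X c) P),
     smul = smul (PX t X c)\<rparr>"

definition MF_phi :: "'r::idom \<Rightarrow> 'x set \<Rightarrow> ('x \<Rightarrow> 'x \<Rightarrow> 'x \<Rightarrow> nat) \<Rightarrow> ('x \<Rightarrow> 'x) \<Rightarrow>
    ('r, 'x list \<times> 'r morph, 'r morph) rcat" where
  "MF_phi t X c \<phi> = (MF t X c)\<lparr>ob := {(P, d) \<in> ob (MF t X c).
     \<exists>g\<in>hm (PX t X c) (map \<phi> P) P. d = cmp (PX t X c) P (map \<phi> P) P g (eta P)}\<rparr>"

definition MF_phi_exact :: "'r::idom \<Rightarrow> 'x set \<Rightarrow> ('x \<Rightarrow> 'x \<Rightarrow> 'x \<Rightarrow> nat) \<Rightarrow> ('x \<Rightarrow> 'x) \<Rightarrow>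
    ('x list \<times> 'r morph, 'r morph) conflations" where
  "MF_phi_exact t X c \<phi> A f B g D \<longleftrightarrow>
     A \<in> ob (MF_phi t X c \<phi>) \<and> B \<in> ob (MF_phi t X c \<phi>) \<and> D \<in> ob (MF_phi t X c \<phi>) \<and>
     f \<in> hm (MF_phi t X c \<phi>) A B \<and> g \<in> hm (MF_phi t X c \<phi>) B D \<and>
     split_exact (PX t X c) (fst A) f (fst B) g (fst D)"

text \<open>\<open>block_matrix m n K L M N\<close> has top row \<open>K\<close>, \<open>L\<close> and bottom row \<open>M\<close>, \<open>N\<close>, where \<open>K\<close> is
  \<open>m\<close> by \<open>n\<close>.\<close>

definition block_matrix ::
  "nat \<Rightarrow> nat \<Rightarrow> 'r morph \<Rightarrow> 'r morph \<Rightarrow> 'r morph \<Rightarrow> 'r morph \<Rightarrow> 'r morph" where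
  "block_matrix m n K L M N = (\<lambda>i j.
     if i < m then (if j < n then K i j else L i (j - n))
     else (if j < n then M (i - m) j else N (i - m) (j - n)))"

definition G_phi :: "'r::idom \<Rightarrow> 'x set \<Rightarrow> ('x \<Rightarrow> 'x \<Rightarrow> 'x \<Rightarrow> nat) \<Rightarrow> ('x \<Rightarrow> 'x) \<Rightarrow>
    'x list \<Rightarrow> 'x list \<times> 'r morph" where
  "G_phi t X c \<phi> P =
     (P @ map \<phi> P, block_matrix (length P) (length P) 0 (xi t X c \<phi> P) (eta P) 0)"

end

theory Submission
  imports Defs
begin

text \<open>A morphism \<open>G\<^sub>\<phi> V \<rightarrow> (Q, d)\<close> is determined by an arbitrary morphism \<open>V \<rightarrow> Q\<close> of \<open>\<P>(X)\<close>, and a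
  morphism \<open>(Q, d) \<rightarrow> G\<^sub>\<phi> V\<close> by an arbitrary morphism \<open>Q \<rightarrow> \<phi> V\<close>. Since exact sequences split in
  \<open>\<P>(X)\<close>, this makes every \<open>G\<^sub>\<phi> V\<close> projective and injective, and the morphisms \<open>G\<^sub>\<phi> Q \<rightarrow> (Q, d)\<close>
  and \<open>(Q, d) \<rightarrow> G\<^sub>\<phi> (\<phi>\<^sup>-\<^sup>1 Q)\<close> that correspond to identities show that there are enough of them.
  If \<open>(Q, d)\<close> is projective and \<open>d = g \<eta>\<close>, the splitting of \<open>G\<^sub>\<phi> Q \<rightarrow> (Q, d)\<close> provides \<open>h\<close> with
  \<open>g h + \<phi>\<^sup>-\<^sup>1(h g) = 1\<close>. As \<open>R\<close> is local, some entry \<open>\<phi> P\<^sub>x \<rightarrow> P\<^sub>y\<close> of \<open>g\<close> is an isomorphism, and it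
  splits off a summand \<open>G\<^sub>\<phi> P\<^sub>x\<close> of \<open>(Q, d)\<close>; the complement has smaller rank.\<close>

text \<open>Composition in \<P>(X) carries a factor \<open>t ^ c x y z\<close> that depends on three
  objects. For fixed \<open>w\<close> the cochain \<open>c w\<close> has coboundary \<open>c\<close>
  and values in the naturals, so multiplying coefficients by \<open>t ^ c w x y\<close> turns
  composition into multiplication of matrices over R itself, without negative powers of t. Matrices
  of all sizes sit in one ring of operators, where the diagram chases become equational rewriting,
  and the result is carried back along bijections of hom-sets. The bound on the square of \<phi>
  makes \<open>\<xi>\<close> factor through \<open>\<eta>\<close>, which puts \<open>G V\<close>
  into the category. Splitting off \<open>G V\<close> needs a complement that is again a formal sum
  of generators, not just an idempotent. Locality makes one coordinate of a split mono from a rank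
  one object invertible; deleting it leaves the complement as a shorter list. The two morphisms
  found at an invertible entry compose to 1 + r d rather than 1, because the coordinate that is
  included may also be the one that is read off.\<close>

section \<open>Matrix factorizations over a ring of morphisms\<close>

text \<open>Words are normalized with products associated to the right, which hides the redex
  \<open>a * b\<close> inside \<open>a * (b * x)\<close>. The second conjunct rewrites that form, so
  a list of equations passed through this lemma simplifies words in the morphisms.\<close>

lemma mult_eq_assoc:
  fixes a :: "'a::semigroup_mult"
  assumes "a * b = c" shows "a * b = c \<and> (\<forall>x. a * (b * x) = c * x)"
  using assms by (auto simp: mult.assoc[symmetric])

text \<open>All hom-sets lie in one ring and composition is its product, so composites need no
  object arguments. By \<open>H_ob\<close>, membership in \<open>H A B\<close> also certifies that
  the ends are objects.\<close>

locale hom_ring =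
  fixes Ob :: "'o set" and H :: "'o \<Rightarrow> 'o \<Rightarrow> 'a::ring_1 set" and e :: "'o \<Rightarrow> 'a"
  assumes H_ob: "f \<in> H A B \<Longrightarrow> A \<in> Ob \<and> B \<in> Ob"
    and e_in: "A \<in> Ob \<Longrightarrow> e A \<in> H A A"
    and e_left: "f \<in> H A B \<Longrightarrow> e B * f = f"
    and e_right: "f \<in> H A B \<Longrightarrow> f * e A = f"
    and zero_in: "\<lbrakk>A \<in> Ob; B \<in> Ob\<rbrakk> \<Longrightarrow> 0 \<in> H A B"
    and add_in: "\<lbrakk>f \<in> H A B; g \<in> H A B\<rbrakk> \<Longrightarrow> f + g \<in> H A B"
    and uminus_in: "f \<in> H A B \<Longrightarrow> - f \<in> H A B"
    and mult_in: "\<lbrakk>g \<in> H B D; f \<in> H A B\<rbrakk> \<Longrightarrow> g * f \<in> H A D"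
begin

lemma diff_in: "\<lbrakk>f \<in> H A B; g \<in> H A B\<rbrakk> \<Longrightarrow> f - g \<in> H A B"
  using add_in[of f A B "- g"] uminus_in[of g A B] by simp

lemma unit_simps:
  assumes "f \<in> H A B"
  shows "e B * f = f \<and> f * e A = f \<and> (\<forall>x. e B * (f * x) = f * x) \<and> (\<forall>x. f * (e A * x) = f * x)"
  using e_left[OF assms] e_right[OF assms] by (auto simp: mult.assoc[symmetric])

text \<open>\<open>bp A B S i j p q\<close> presents \<open>S\<close> as a biproduct; equally, \<open>A \<rightarrow> S \<rightarrow> B\<close> via \<open>i\<close> and \<open>q\<close> is split
  exact with splitting \<open>p\<close>, \<open>j\<close>.\<close>

definition bp :: "'o \<Rightarrow> 'o \<Rightarrow> 'o \<Rightarrow> 'a \<Rightarrow> 'a \<Rightarrow> 'a \<Rightarrow> 'a \<Rightarrow> bool" where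
  "bp A B S i j p q \<longleftrightarrow> i \<in> H A S \<and> j \<in> H B S \<and> p \<in> H S A \<and> q \<in> H S B \<and>
     p * i = e A \<and> q * j = e B \<and> p * j = 0 \<and> q * i = 0 \<and> i * p + j * q = e S"

lemma bp_in:
  assumes "bp A B S i j p q"
  shows "i \<in> H A S" "j \<in> H B S" "p \<in> H S A" "q \<in> H S B"
  using assms by (auto simp: bp_def)

lemma bp_ob:
  assumes "bp A B S i j p q" shows "A \<in> Ob" "B \<in> Ob" "S \<in> Ob"
  using bp_in[OF assms] H_ob by blast+

lemma bp_eq:
  assumes "bp A B S i j p q"
  shows "p * i = e A" "q * j = e B" "p * j = 0" "q * i = 0" "j * q = e S - i * p"
  using assms by (auto simp: bp_def algebra_simps)

text \<open>\<open>p * j = 0\<close> comes for free: inserting \<open>e S = i * p + j * q\<close>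
  between the factors gives \<open>p * j = p * j + p * j\<close>.\<close>

lemma bpI:
  assumes "i \<in> H A S" "j \<in> H B S" "p \<in> H S A" "q \<in> H S B"
    and "p * i = e A" "q * j = e B" "q * i = 0" "i * p + j * q = e S"
  shows "bp A B S i j p q"
proof -
  have "p * j = p * (e S * j)" using assms by (simp add: e_left)
  also have "\<dots> = p * j + p * j"
    unfolding assms(8)[symmetric]
    by (simp add: algebra_simps assms(1-4)[THEN unit_simps] assms(5-6)[THEN mult_eq_assoc])
  finally show ?thesis using assms by (simp add: bp_def)
qed

text \<open>Complements add up: a complement of \<open>f' * f\<close> is \<open>K\<close>, carried
  into \<open>D\<close> by \<open>f' * s\<close>, together with \<open>L\<close>. This closes
  inflations under composition.\<close>

lemma bp_comp_mono:
  assumes 1: "bp A K B f s r g" and 2: "bp B L D f' s' r' g'" and 3: "bp K L C i j p q"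
  shows "bp A C D (f' * f) (f' * s * p + s' * q) (r * r') (i * g * r' + j * g')"
proof -
  note m = bp_in[OF 1] bp_in[OF 2] bp_in[OF 3]
  note E = bp_eq[OF 1, THEN mult_eq_assoc] bp_eq[OF 2, THEN mult_eq_assoc] bp_eq[OF 3, THEN mult_eq_assoc]
  show ?thesis
    by (rule bpI) (auto intro!: add_in mult_in intro: m simp: algebra_simps E m[THEN unit_simps])
qed

text \<open>Dually, the kernel of \<open>g' * g\<close> is the kernel of \<open>g\<close> together
  with the kernel of \<open>g'\<close> lifted along the section \<open>s\<close>.\<close>

lemma bp_comp_epi:
  assumes 1: "bp K B A f s r g" and 2: "bp L D B f' s' r' g'" and 3: "bp K L C i j p q"
  shows "bp C D A (f * p + s * f' * q) (s * s') (i * r + j * r' * g) (g' * g)"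
proof -
  note m = bp_in[OF 1] bp_in[OF 2] bp_in[OF 3]
  note E = bp_eq[OF 1, THEN mult_eq_assoc] bp_eq[OF 2, THEN mult_eq_assoc] bp_eq[OF 3, THEN mult_eq_assoc]
  show ?thesis
    by (rule bpI) (auto intro!: add_in mult_in intro: m simp: algebra_simps E m[THEN unit_simps])
qed

end

text \<open>The functor \<open>\<Phi>\<close> is given on objects only: on morphisms it is determined by \<open>f' \<eta> = \<eta> f\<close>, as
  \<open>\<eta>\<close> can be cancelled.\<close>

locale mf_ring = hom_ring Ob H e
  for Ob :: "'o set" and H :: "'o \<Rightarrow> 'o \<Rightarrow> 'a::ring_1 set" and e :: "'o \<Rightarrow> 'a" +
  fixes \<tau> :: 'a and \<Phi> :: "'o \<Rightarrow> 'o" and \<eta> \<xi> :: "'o \<Rightarrow> 'a"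
    and MO :: "'m set" and U :: "'m \<Rightarrow> 'o" and D :: "'m \<Rightarrow> 'a" and G :: "'o \<Rightarrow> 'm"
    and gi gj gp gq :: "'o \<Rightarrow> 'a"
  assumes tau_comm: "\<tau> * x = x * \<tau>"
    and tau_in: "f \<in> H A B \<Longrightarrow> \<tau> * f \<in> H A B"
    and tau_cancel: "\<tau> * x = 0 \<Longrightarrow> x = 0"
    and Phi_in: "A \<in> Ob \<Longrightarrow> \<Phi> A \<in> Ob"
    and Phi_surj: "A \<in> Ob \<Longrightarrow> \<exists>B\<in>Ob. \<Phi> B = A"
    and eta_in: "A \<in> Ob \<Longrightarrow> \<eta> A \<in> H A (\<Phi> A)"
    and xi_in: "A \<in> Ob \<Longrightarrow> \<xi> A \<in> H (\<Phi> A) A"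
    and xi_eta: "A \<in> Ob \<Longrightarrow> \<xi> A * \<eta> A = \<tau> * e A"
    and eta_xi: "A \<in> Ob \<Longrightarrow> \<eta> A * \<xi> A = \<tau> * e (\<Phi> A)"
    and Phi_up: "f \<in> H A B \<Longrightarrow> \<exists>f'\<in>H (\<Phi> A) (\<Phi> B). f' * \<eta> A = \<eta> B * f"
    and Phi_down: "\<lbrakk>A \<in> Ob; B \<in> Ob; f' \<in> H (\<Phi> A) (\<Phi> B)\<rbrakk> \<Longrightarrow> \<exists>f\<in>H A B. f' * \<eta> A = \<eta> B * f"
    and ex_zero: "\<exists>Z\<in>Ob. e Z = 0"
    and ex_bp: "\<lbrakk>A \<in> Ob; B \<in> Ob\<rbrakk> \<Longrightarrow> \<exists>S i j p q. bp A B S i j p q"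
    and D_in: "M \<in> MO \<Longrightarrow> D M \<in> H (U M) (U M)"
    and D_D: "M \<in> MO \<Longrightarrow> D M * D M = \<tau> * e (U M)"
    and D_fac: "M \<in> MO \<Longrightarrow> \<exists>g\<in>H (\<Phi> (U M)) (U M). D M = g * \<eta> (U M)"
    and ex_MO: "\<lbrakk>d \<in> H A A; d * d = \<tau> * e A; \<exists>g\<in>H (\<Phi> A) A. d = g * \<eta> A\<rbrakk>
      \<Longrightarrow> \<exists>M\<in>MO. U M = A \<and> D M = d"
    and G_MO: "V \<in> Ob \<Longrightarrow> G V \<in> MO"
    and G_bp: "V \<in> Ob \<Longrightarrow> bp V (\<Phi> V) (U (G V)) (gi V) (gj V) (gp V) (gq V)"
    and G_D: "V \<in> Ob \<Longrightarrow> D (G V) = gi V * \<xi> V * gq V + gj V * \<eta> V * gp V"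
begin

lemma tau_cancel2: "\<tau> * x = \<tau> * y \<Longrightarrow> x = y"
  using tau_cancel[of "x - y"] by (simp add: algebra_simps)

lemma tau_left: "x * (\<tau> * y) = \<tau> * (x * y)"
  by (metis mult.assoc tau_comm)

lemma U_in: "M \<in> MO \<Longrightarrow> U M \<in> Ob"
  using D_in H_ob by blast

text \<open>Composition with \<open>\<xi>\<close> turns \<open>\<eta>\<close> into
  \<open>\<tau>\<close>, which is central and can be cancelled.\<close>

lemma eta_right_cancel:
  assumes "f \<in> H (\<Phi> A) B" "g \<in> H (\<Phi> A) B" "A \<in> Ob" "f * \<eta> A = g * \<eta> A" shows "f = g"
proof (rule tau_cancel2)
  have "f * (\<eta> A * \<xi> A) = g * (\<eta> A * \<xi> A)" using assms(4) by (simp add: mult.assoc[symmetric])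
  thus "\<tau> * f = \<tau> * g" using assms by (simp add: eta_xi tau_left e_right)
qed

lemma eta_left_cancel:
  assumes "f \<in> H A B" "g \<in> H A B" "\<eta> B * f = \<eta> B * g" shows "f = g"
proof (rule tau_cancel2)
  have "(\<xi> B * \<eta> B) * f = (\<xi> B * \<eta> B) * g" using assms(3) by (simp add: mult.assoc)
  thus "\<tau> * f = \<tau> * g" using assms H_ob[OF assms(1)] by (simp add: xi_eta mult.assoc e_left)
qed

text \<open>Naturality of \<open>\<xi>\<close> is forced by that of \<open>\<eta>\<close>: after
  composing with \<open>\<eta> B\<close> both sides become \<open>\<tau> * f'\<close>, and
  \<open>\<eta>\<close> cancels.\<close>

lemma xi_natural:
  assumes "f \<in> H A B" "f' \<in> H (\<Phi> A) (\<Phi> B)" "f' * \<eta> A = \<eta> B * f"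
  shows "\<xi> B * f' = f * \<xi> A"
proof (rule eta_left_cancel)
  have o: "A \<in> Ob" "B \<in> Ob" using H_ob assms(1) by auto
  show "\<xi> B * f' \<in> H (\<Phi> A) B" "f * \<xi> A \<in> H (\<Phi> A) B"
    using o assms by (auto intro: mult_in xi_in)
  have "\<eta> B * (\<xi> B * f') = \<tau> * f'" using o assms by (simp add: mult.assoc[symmetric] eta_xi) (simp add: mult.assoc e_left)
  also have "\<dots> = f' * (\<eta> A * \<xi> A)" using o assms by (simp add: eta_xi tau_left e_right)
  also have "\<dots> = \<eta> B * (f * \<xi> A)" using assms(3) by (simp add: mult.assoc[symmetric])
  finally show "\<eta> B * (\<xi> B * f') = \<eta> B * (f * \<xi> A)" .
qed

section \<open>Morphisms that factor through \<eta>\<close>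

definition fac :: "'o \<Rightarrow> 'o \<Rightarrow> 'a \<Rightarrow> bool" where
  "fac A B d \<longleftrightarrow> A \<in> Ob \<and> (\<exists>g\<in>H (\<Phi> A) B. d = g * \<eta> A)"

lemma fac_in: "fac A B d \<Longrightarrow> d \<in> H A B"
  by (auto simp: fac_def intro: mult_in eta_in)

lemma fac_D: "M \<in> MO \<Longrightarrow> fac (U M) (U M) (D M)"
  using D_fac U_in by (auto simp: fac_def)

lemma fac_add: "fac A B d \<Longrightarrow> fac A B d' \<Longrightarrow> fac A B (d + d')"
  unfolding fac_def by (metis add_in distrib_right)

lemma fac_left: "fac A B d \<Longrightarrow> x \<in> H B B' \<Longrightarrow> fac A B' (x * d)"
  unfolding fac_def by (metis mult_in mult.assoc)

text \<open>Here \<open>x\<close> stands on the wrong side of \<open>\<eta>\<close>; its image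
  \<open>x'\<close> under \<Phi> moves it across. With \<open>fac_left\<close> this makes factoring
  through \<open>\<eta>\<close> an ideal condition, inherited by every differential built by
  composition and sums.\<close>

lemma fac_right: assumes "fac A B d" "x \<in> H A' A" shows "fac A' B (d * x)"
proof -
  obtain g where g: "A \<in> Ob" "g \<in> H (\<Phi> A) B" "d = g * \<eta> A" using assms by (auto simp: fac_def)
  obtain x' where x': "x' \<in> H (\<Phi> A') (\<Phi> A)" "x' * \<eta> A' = \<eta> A * x" using Phi_up[OF assms(2)] by auto
  show ?thesis unfolding fac_def
    using H_ob[OF assms(2)] mult_in[OF g(2) x'(1)] g(3) x'(2) by (metis mult.assoc)
qed

lemma fac_zero: "A \<in> Ob \<Longrightarrow> B \<in> Ob \<Longrightarrow> fac A B 0"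
  by (auto simp: fac_def intro!: bexI[of _ 0] zero_in Phi_in)

lemma fac_both: "fac A B d \<Longrightarrow> x \<in> H B B' \<Longrightarrow> y \<in> H A' A \<Longrightarrow> fac A' B' (x * d * y)"
  by (intro fac_left fac_right)

lemma ex_MO_fac: "fac A A d \<Longrightarrow> d * d = \<tau> * e A \<Longrightarrow> \<exists>M\<in>MO. U M = A \<and> D M = d"
  using fac_in[of A A d] by (intro ex_MO) (auto simp: fac_def)

text \<open>Empty off \<open>MO\<close>, so that these hom-sets form a \<open>hom_ring\<close> again
  and the biproduct lemmas apply inside the category of factorizations as well.\<close>

definition mh :: "'m \<Rightarrow> 'm \<Rightarrow> 'a set" where
  "mh M N = (if M \<in> MO \<and> N \<in> MO then {f \<in> H (U M) (U N). f * D M = D N * f} else {})"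

lemma mh_iff: "f \<in> mh M N \<longleftrightarrow> M \<in> MO \<and> N \<in> MO \<and> f \<in> H (U M) (U N) \<and> f * D M = D N * f"
  by (auto simp: mh_def)

lemma mhI: "\<lbrakk>M \<in> MO; N \<in> MO; f \<in> H (U M) (U N); f * D M = D N * f\<rbrakk> \<Longrightarrow> f \<in> mh M N"
  by (simp add: mh_iff)

lemma mh_in: "f \<in> mh M N \<Longrightarrow> f \<in> H (U M) (U N)"
  and mh_ob: "f \<in> mh M N \<Longrightarrow> M \<in> MO \<and> N \<in> MO"
  and mh_D: "f \<in> mh M N \<Longrightarrow> f * D M = D N * f"
  by (auto simp: mh_iff)

lemma mh_hom_ring: "hom_ring MO mh (\<lambda>M. e (U M))"
proof
  fix g B D' f A assume *: "g \<in> mh B D'" "f \<in> mh A B"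
  have "g * f * D A = D D' * (g * f)" using * by (metis mh_D mult.assoc)
  then show "g * f \<in> mh A D'" using * by (auto simp: mh_iff intro: mult_in)
qed (auto simp: mh_iff algebra_simps intro: zero_in add_in uminus_in U_in e_in e_left e_right mult_in D_in
   dest!: U_in simp: e_left[OF D_in] e_right[OF D_in])

sublocale M: hom_ring MO mh "\<lambda>M. e (U M)"
  by (rule mh_hom_ring)

section \<open>The category of matrix factorizations and its exact structure\<close>

definition mfc :: "('m, 'a) cat" where
  "mfc = \<lparr>ob = MO, hm = mh, cmp = (\<lambda>_ _ _ g f. g * f), idn = (\<lambda>M. e (U M))\<rparr>"

lemma mfc_simps [simp]: "ob mfc = MO" "hm mfc = mh" "cmp mfc A B L g f = g * f" "idn mfc M = e (U M)"
  by (simp_all add: mfc_def)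

definition mfe :: "('m, 'a) conflations" where
  "mfe M f N g L \<longleftrightarrow> f \<in> mh M N \<and> g \<in> mh N L \<and> (\<exists>s r. bp (U M) (U L) (U N) f s r g)"

text \<open>Since \<open>f\<close> commutes with the differentials, \<open>g * D N\<close> kills
  \<open>f\<close>, hence \<open>g * D N * s * g = g * D N\<close>. This one identity yields both
  that the induced differential squares to \<open>\<tau>\<close> and that \<open>g\<close> is a
  morphism.\<close>

lemma cokernel_object:
  assumes f: "f \<in> mh M N" and b: "bp (U M) B (U N) f s r g"
  shows "\<exists>L\<in>MO. U L = B \<and> D L = g * D N * s \<and> mfe M f N g L"
proof -
  note m = bp_in[OF b] and E = bp_eq[OF b, THEN mult_eq_assoc]
  have o: "M \<in> MO" "N \<in> MO" using mh_ob f by auto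
  note mD = D_in[OF o(1)] D_in[OF o(2)]
  note E2 = mh_D[OF f, symmetric, THEN mult_eq_assoc] D_D[OF o(2), THEN mult_eq_assoc]
  have sg: "s * g = e (U N) - f * r" using bp_eq(5)[OF b] .
  have 1: "g * D N * s * g = g * D N"
    by (simp add: mult.assoc sg) (simp add: algebra_simps E E2 m[THEN unit_simps] mD[THEN unit_simps])
  have "g * D N * s * (g * D N * s) = (g * D N * s * g) * D N * s" by (simp add: mult.assoc)
  also have "\<dots> = \<tau> * e B" unfolding 1 by (simp add: mult.assoc E2 m[THEN unit_simps] tau_left E)
  finally have "g * D N * s * (g * D N * s) = \<tau> * e B" .
  moreover have "fac B B (g * D N * s)"
    by (rule fac_right[OF fac_left[OF fac_D[OF o(2)] m(4)] m(2)])
  ultimately obtain L where L: "L \<in> MO" "U L = B" "D L = g * D N * s" using ex_MO_fac by blast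
  have "g \<in> mh N L" using L o m 1 by (auto simp: mh_iff)
  then show ?thesis using L f b by (auto simp: mfe_def)
qed

text \<open>Dually, \<open>g\<close> kills \<open>D N * f\<close>, so this morphism equals
  \<open>f * (r * D N * f)\<close>.\<close>

lemma kernel_object:
  assumes g: "g \<in> mh N L" and b: "bp A (U L) (U N) f s r g"
  shows "\<exists>M\<in>MO. U M = A \<and> D M = r * D N * f \<and> mfe M f N g L"
proof -
  note m = bp_in[OF b] and E = bp_eq[OF b, THEN mult_eq_assoc]
  have o: "L \<in> MO" "N \<in> MO" using mh_ob g by auto
  note mD = D_in[OF o(1)] D_in[OF o(2)]
  note E2 = mh_D[OF g, THEN mult_eq_assoc] D_D[OF o(2), THEN mult_eq_assoc]
  have "f * r = e (U N) - s * g" using bp_eq(5)[OF b] by (simp add: algebra_simps)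
  then have 1: "f * (r * D N * f) = D N * f"
    by (simp add: mult.assoc[symmetric])
      (simp add: algebra_simps E(1-4) E2 m[THEN unit_simps] mD[THEN unit_simps])
  have "r * D N * f * (r * D N * f) = r * D N * (f * (r * D N * f))" by (simp add: mult.assoc)
  also have "\<dots> = \<tau> * e A" unfolding 1 by (simp add: mult.assoc E2 m[THEN unit_simps] tau_left E)
  finally have "r * D N * f * (r * D N * f) = \<tau> * e A" .
  moreover have "fac A A (r * D N * f)"
    by (rule fac_right[OF fac_left[OF fac_D[OF o(2)] m(3)] m(1)])
  ultimately obtain M where M: "M \<in> MO" "U M = A" "D M = r * D N * f" using ex_MO_fac by blast
  have "f \<in> mh M N" using M o m 1 by (auto simp: mh_iff)
  then show ?thesis using M g b by (auto simp: mfe_def)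
qed

text \<open>A splitting of the underlying morphism suffices, because the quotient differential then
  exists by \<open>cokernel_object\<close>.\<close>

lemma inflation_iff:
  "inflation mfe M N f \<longleftrightarrow> f \<in> mh M N \<and> (\<exists>B s r g. bp (U M) B (U N) f s r g)"
proof
  assume "inflation mfe M N f"
  then show "f \<in> mh M N \<and> (\<exists>B s r g. bp (U M) B (U N) f s r g)"
    unfolding inflation_def mfe_def by blast
next
  assume "f \<in> mh M N \<and> (\<exists>B s r g. bp (U M) B (U N) f s r g)"
  then show "inflation mfe M N f" unfolding inflation_def using cokernel_object by blast
qed

lemma deflation_iff:
  "deflation mfe N L g \<longleftrightarrow> g \<in> mh N L \<and> (\<exists>A f s r. bp A (U L) (U N) f s r g)"
proof
  assume "deflation mfe N L g"
  then show "g \<in> mh N L \<and> (\<exists>A f s r. bp A (U L) (U N) f s r g)"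
    unfolding deflation_def mfe_def by blast
next
  assume "g \<in> mh N L \<and> (\<exists>A f s r. bp A (U L) (U N) f s r g)"
  then show "deflation mfe N L g" unfolding deflation_def using kernel_object by blast
qed

lemma ex_mf_bp:
  assumes o: "M \<in> MO" "N \<in> MO"
  shows "\<exists>S i j p q. M.bp M N S i j p q"
proof -
  obtain S i j p q where b: "bp (U M) (U N) S i j p q" using ex_bp o U_in by blast
  note m = bp_in[OF b] and E = bp_eq[OF b, THEN mult_eq_assoc] and mD = o[THEN D_in]
  note ED = o[THEN D_D, THEN mult_eq_assoc]
  let ?d = "i * D M * p + j * D N * q"
  have "fac S S ?d" by (rule fac_add fac_both fac_D o m)+
  moreover have "?d * ?d = \<tau> * (i * p + j * q)"
    by (simp add: algebra_simps E(1-4) ED m[THEN unit_simps] mD[THEN unit_simps] tau_left)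
  ultimately obtain L where L: "L \<in> MO" "U L = S" "D L = ?d"
    using ex_MO_fac[of S ?d] b by (auto simp: bp_def)
  have "M.bp M N L i j p q"
    using b unfolding bp_def M.bp_def mh_iff L(2,3)
    by (simp add: L o algebra_simps E(1-4) m[THEN unit_simps] mD[THEN unit_simps])
  then show ?thesis by blast
qed

lemma mfc_additive: "additive_category mfc"
proof -
  interpret preadditive_category mfc
    by unfold_locales (auto simp: algebra_simps intro: M.zero_in M.add_in M.uminus_in M.mult_in M.e_in
       dest: M.e_left M.e_right)
  show ?thesis
  proof
    obtain Z where Z: "Z \<in> Ob" "e Z = 0" using ex_zero by blast
    have "fac Z Z 0" using Z by (simp add: fac_zero)
    then obtain M where M: "M \<in> MO" "U M = Z" "D M = 0" using ex_MO_fac[of Z 0] Z by auto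
    have "f = 0" if "f \<in> mh A M" for f A using M.e_left[OF that] M Z by simp
    moreover have "f = 0" if "f \<in> mh M A" for f A using M.e_right[OF that] M Z by simp
    ultimately have "zero_object mfc M" unfolding zero_object_def using M M.zero_in by auto blast+
    then show "\<exists>Z. zero_object mfc Z" by blast
  next
    fix A B assume "A \<in> ob mfc" "B \<in> ob mfc"
    then show "\<exists>S i j p q. biproduct mfc A B S i j p q"
      using ex_mf_bp[of A B] unfolding biproduct_def M.bp_def mfc_simps by (meson M.H_ob)
  qed
qed

text \<open>The factorization is \<open>r * h\<close> as in the underlying category. The retraction
  \<open>r\<close> need not respect the differentials; compatibility of \<open>r * h\<close> comes
  from applying \<open>r\<close> to the relation for \<open>f * (r * h) = h\<close>, where
  \<open>f\<close> does respect them.\<close>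

lemma mfe_kernel: assumes "mfe M f N g L" shows "is_kernel mfc M f N g L"
proof -
  obtain s r where b: "bp (U M) (U L) (U N) f s r g" and fg: "f \<in> mh M N" "g \<in> mh N L"
    using assms by (auto simp: mfe_def)
  have o: "M \<in> MO" "N \<in> MO" "L \<in> MO" using fg mh_ob by auto
  note m = bp_in[OF b] and E = bp_eq[OF b, THEN mult_eq_assoc] and mD = o[THEN D_in]
  have sg: "f * r = e (U N) - s * g" using bp_eq(5)[OF b] by (simp add: algebra_simps)
  have "\<exists>!k. k \<in> mh Z M \<and> f * k = h" if h: "h \<in> mh Z N" "g * h = 0" for Z h
  proof (rule ex1I[of _ "r * h"], intro conjI)
    note mh = mh_in[OF h(1)]
    show 1: "f * (r * h) = h"
      by (simp add: mult.assoc[symmetric] sg) (simp add: algebra_simps h(2) mh[THEN unit_simps])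
    show "r * h \<in> mh Z M"
    proof (rule mhI)
      show "Z \<in> MO" "M \<in> MO" "r * h \<in> H (U Z) (U M)" using o h m mh mh_ob by (auto intro: mult_in)
      have "r * (f * (r * h)) * D Z = r * (D N * (f * (r * h)))"
        unfolding 1 using mh_D[OF h(1)] by (simp add: mult.assoc)
      also have "\<dots> = r * (f * (D M * (r * h)))"
        using mh_D[OF fg(1), symmetric, THEN mult_eq_assoc] by (simp add: mult.assoc)
      finally show "r * h * D Z = D M * (r * h)"
        by (simp add: mult.assoc E m[THEN unit_simps] mD[THEN unit_simps])
    qed
    fix k assume k: "k \<in> mh Z M \<and> f * k = h"
    then have "r * h = (r * f) * k" by (auto simp: mult.assoc)
    also have "\<dots> = k" using k mh_in[of k Z M] by (auto simp: E e_left)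
    finally show "k = r * h" by simp
  qed
  then show ?thesis using fg o bp_eq[OF b] unfolding is_kernel_def by auto
qed

lemma mfe_cokernel: assumes "mfe M f N g L" shows "is_cokernel mfc M f N g L"
proof -
  obtain s r where b: "bp (U M) (U L) (U N) f s r g" and fg: "f \<in> mh M N" "g \<in> mh N L"
    using assms by (auto simp: mfe_def)
  have o: "M \<in> MO" "N \<in> MO" "L \<in> MO" using fg mh_ob by auto
  note m = bp_in[OF b] and E = bp_eq[OF b, THEN mult_eq_assoc] and mD = o[THEN D_in]
  have "\<exists>!k. k \<in> mh L Z \<and> k * g = h" if h: "h \<in> mh N Z" "h * f = 0" for Z h
  proof (rule ex1I[of _ "h * s"], intro conjI)
    note mh = mh_in[OF h(1)]
    note hf = h(2)[THEN mult_eq_assoc]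
    show 1: "h * s * g = h"
      by (simp add: mult.assoc bp_eq(5)[OF b]) (simp add: algebra_simps hf mh[THEN unit_simps])
    show "h * s \<in> mh L Z"
    proof (rule mhI)
      show "Z \<in> MO" "L \<in> MO" "h * s \<in> H (U L) (U Z)" using o h m mh mh_ob by (auto intro: mult_in)
      have "D Z * (h * s * g) * s = (h * s * g) * D N * s"
        unfolding 1 using mh_D[OF h(1)] by (simp add: mult.assoc)
      also have "\<dots> = h * s * (D L * (g * s))"
        using mh_D[OF fg(2), THEN mult_eq_assoc] by (simp add: mult.assoc)
      finally show "h * s * D L = D Z * (h * s)"
        by (simp add: mult.assoc E(1-4) m[THEN unit_simps] mD[THEN unit_simps])
    qed
    fix k assume k: "k \<in> mh L Z \<and> k * g = h"
    then have "h * s = k * (g * s)" by (auto simp: mult.assoc[symmetric])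
    also have "\<dots> = k" using k mh_in[of k L Z] by (auto simp: E e_right)
    finally show "k = h * s" by simp
  qed
  then show ?thesis using fg o bp_eq[OF b] unfolding is_cokernel_def by auto
qed

text \<open>In the splitting of \<open>N\<close> by \<open>M\<close> and \<open>L\<close> the
  differential is upper triangular with corner \<open>r * D N * s\<close>. The pushout replaces
  \<open>M\<close> by \<open>M'\<close>, so on the sum of \<open>M'\<close> and \<open>L\<close> the
  corner becomes \<open>a * r * D N * s\<close>.\<close>

lemma mfe_pushout:
  assumes f: "inflation mfe M N f" and a: "a \<in> mh M M'"
  shows "\<exists>N' f' b. is_pushout mfc M f N a M' f' N' b \<and> inflation mfe M' N' f'"
proof -
  obtain L s r g where fM: "f \<in> mh M N" and "mfe M f N g L" and b: "bp (U M) (U L) (U N) f s r g"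
    using f unfolding inflation_iff by (metis cokernel_object)
  then have gM: "g \<in> mh N L" by (simp add: mfe_def)
  have o: "M \<in> MO" "N \<in> MO" "L \<in> MO" "M' \<in> MO" using fM gM a mh_ob by auto
  obtain S i j p q where b': "bp (U M') (U L) S i j p q" using ex_bp o U_in by blast
  note m = bp_in[OF b] bp_in[OF b'] mh_in[OF a] and mD = o[THEN D_in]
  note E = bp_eq[OF b, THEN mult_eq_assoc] bp_eq[OF b', THEN mult_eq_assoc]
  note ED = o[THEN D_D, THEN mult_eq_assoc] mh_D[OF fM, symmetric, THEN mult_eq_assoc]
    mh_D[OF gM, THEN mult_eq_assoc] mh_D[OF a, symmetric, THEN mult_eq_assoc]
  let ?d = "i * D M' * p + i * (a * r * D N * s) * q + j * D L * q"
  have "fac S S ?d" by (rule fac_add fac_both fac_D o m mult_in)+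
  moreover have "?d * ?d = \<tau> * (i * p + j * q)"
  proof -
    \<comment> \<open>The corner of \<open>?d * ?d\<close> vanishes because that of
      \<open>D N * D N\<close> does: \<open>r * D N * s\<close> anticommutes with the diagonal
      blocks.\<close>
    have "r * (D N * (s * (D L * q))) = r * (D N * ((s * g) * (D N * (s * q))))"
      by (simp add: mult.assoc ED E(1-4,6-9) m[THEN unit_simps] mD[THEN unit_simps])
    also have "\<dots> = - (D M * (r * (D N * (s * q))))"
      unfolding bp_eq(5)[OF b]
      by (simp add: algebra_simps ED E m[THEN unit_simps] mD[THEN unit_simps] tau_left)
    finally have 1: "r * (D N * (s * (D L * q))) = - (D M * (r * (D N * (s * q))))" .
    show ?thesis
      by (simp add: algebra_simps E(1-4,6-9) ED m[THEN unit_simps] mD[THEN unit_simps] tau_left 1)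
  qed
  ultimately obtain N' where N': "N' \<in> MO" "U N' = S" "D N' = ?d"
    using ex_MO_fac[of S ?d] b' by (auto simp: bp_def)
  let ?b = "i * a * r + j * g"
  have iM: "i \<in> mh M' N'"
    by (rule mhI) (simp_all add: N' o m algebra_simps E(1-4,6-9) m[THEN unit_simps] mD[THEN unit_simps])
  \<comment> \<open>The failure of \<open>r\<close> to commute with the differentials is exactly the
    corner, and the corner of \<open>?d\<close> absorbs it in \<open>?b\<close>.\<close>
  have rD: "r * D N = D M * r + r * D N * s * g"
    using arg_cong[OF bp_eq(5)[OF b], of "\<lambda>x. r * D N * x"]
    by (simp add: algebra_simps E ED m[THEN unit_simps] mD[THEN unit_simps])
  have bM: "?b \<in> mh N N'"
  proof (rule mhI)
    show "?b \<in> H (U N) (U N')" unfolding N' by (rule m add_in mult_in)+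
    have "?b * D N = i * a * (r * D N) + j * D L * g" by (simp add: algebra_simps ED)
    also have "\<dots> = i * a * (D M * r + r * D N * s * g) + j * D L * g" by (subst rD) (rule refl)
    also have "\<dots> = D N' * ?b" unfolding N'
      by (simp add: algebra_simps E(1-4,6-9) ED m[THEN unit_simps] mD[THEN unit_simps])
    finally show "?b * D N = D N' * ?b" .
  qed (use o N' in auto)
  have "\<exists>!k. k \<in> mh N' Z \<and> k * ?b = u \<and> k * i = v"
    if u: "u \<in> mh N Z" and v: "v \<in> mh M' Z" and uv: "u * f = v * a" for Z u v
  proof (rule ex1I[of _ "v * p + u * s * q"], intro conjI)
    note mz = mh_in[OF u] mh_in[OF v]
    note EZ = mh_D[OF u, symmetric, THEN mult_eq_assoc] mh_D[OF v, symmetric, THEN mult_eq_assoc]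
      uv[symmetric, THEN mult_eq_assoc]
    show "(v * p + u * s * q) * ?b = u"
      by (simp add: algebra_simps E EZ m[THEN unit_simps] mz[THEN unit_simps])
    show "(v * p + u * s * q) * i = v"
      by (simp add: algebra_simps E EZ m[THEN unit_simps] mz[THEN unit_simps])
    show "v * p + u * s * q \<in> mh N' Z"
    proof (rule mhI)
      show "v * p + u * s * q \<in> H (U N') (U Z)" unfolding N' by (rule m mz add_in mult_in)+
      have "u * (D N * (s * q)) = u * ((f * r + s * g) * (D N * (s * q)))"
        using b by (simp add: bp_def mult.assoc m[THEN unit_simps] mD[THEN unit_simps])
      also have "\<dots> = v * (a * (r * (D N * (s * q)))) + u * (s * (D L * q))"
        using uv[THEN mult_eq_assoc]
        by (simp add: distrib_left distrib_right mult.assoc E(2) ED(5-7) m[THEN unit_simps] mD[THEN unit_simps])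
      finally show "(v * p + u * s * q) * D N' = D Z * (v * p + u * s * q)"
        unfolding N'
        by (simp add: algebra_simps E(1-4,6-9) EZ(1,2) m[THEN unit_simps] mz[THEN unit_simps] mD[THEN unit_simps])
    qed (use N' u mh_ob in auto)
    fix k assume k: "k \<in> mh N' Z \<and> k * ?b = u \<and> k * i = v"
    then have mk: "k \<in> H S (U Z)" using mh_in N' by blast
    have "v * p + u * s * q = (k * i) * p + (k * ?b) * s * q" using k by simp
    also have "\<dots> = k * (i * p + ?b * s * q)" by (simp add: algebra_simps)
    also have "\<dots> = k" by (simp add: algebra_simps E m[THEN unit_simps] mk[THEN unit_simps])
    finally show "k = v * p + u * s * q" by simp
  qed
  moreover have "?b * f = i * a" by (simp add: algebra_simps E m[THEN unit_simps])
  ultimately have "is_pushout mfc M f N a M' i N' ?b"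
    unfolding is_pushout_def using o N' fM a iM bM by auto
  moreover have "inflation mfe M' N' i" unfolding inflation_iff using iM b' N' by blast
  ultimately show ?thesis by blast
qed

text \<open>Dual to the pushout: \<open>L\<close> is replaced by \<open>L'\<close> and the corner
  becomes \<open>r * D N * s * d\<close>.\<close>

lemma mfe_pullback:
  assumes g: "deflation mfe N L g" and d: "d \<in> mh L' L"
  shows "\<exists>N' g' b. is_pullback mfc N g L N' g' L' b d \<and> deflation mfe N' L' g'"
proof -
  obtain M f s r where gM: "g \<in> mh N L" and "mfe M f N g L" and b: "bp (U M) (U L) (U N) f s r g"
    using g unfolding deflation_iff by (metis kernel_object)
  then have fM: "f \<in> mh M N" by (simp add: mfe_def)
  have o: "M \<in> MO" "N \<in> MO" "L \<in> MO" "L' \<in> MO" using fM gM d mh_ob by auto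
  obtain S i j p q where b': "bp (U M) (U L') S i j p q" using ex_bp o U_in by blast
  note m = bp_in[OF b] bp_in[OF b'] mh_in[OF d] and mD = o[THEN D_in]
  note E = bp_eq[OF b, THEN mult_eq_assoc] bp_eq[OF b', THEN mult_eq_assoc]
  note ED = o[THEN D_D, THEN mult_eq_assoc] mh_D[OF fM, symmetric, THEN mult_eq_assoc]
    mh_D[OF gM, THEN mult_eq_assoc] mh_D[OF d, THEN mult_eq_assoc]
  let ?d = "i * D M * p + i * (r * D N * (s * d)) * q + j * D L' * q"
  have "fac S S ?d" by (rule fac_add fac_both fac_D o m mult_in)+
  moreover have "?d * ?d = \<tau> * (i * p + j * q)"
  proof -
    have "r * (D N * (s * (D L * (d * q)))) = r * (D N * ((s * g) * (D N * (s * (d * q)))))"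
      by (simp add: mult.assoc ED E(1-4,6-9) m[THEN unit_simps] mD[THEN unit_simps])
    also have "\<dots> = - (D M * (r * (D N * (s * (d * q)))))"
      unfolding bp_eq(5)[OF b]
      by (simp add: algebra_simps ED E m[THEN unit_simps] mD[THEN unit_simps] tau_left)
    finally have 1: "r * (D N * (s * (D L * (d * q)))) = - (D M * (r * (D N * (s * (d * q)))))" .
    show ?thesis
      by (simp add: algebra_simps E(1-4,6-9) ED m[THEN unit_simps] mD[THEN unit_simps] tau_left 1)
  qed
  ultimately obtain N' where N': "N' \<in> MO" "U N' = S" "D N' = ?d"
    using ex_MO_fac[of S ?d] b' by (auto simp: bp_def)
  let ?b = "f * p + s * d * q"
  have qM: "q \<in> mh N' L'"
    by (rule mhI) (simp_all add: N' o m algebra_simps E(1-4,6-9) m[THEN unit_simps] mD[THEN unit_simps])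
  have Ds: "D N * s = f * r * D N * s + s * D L"
    using arg_cong[OF bp_eq(5)[OF b], of "\<lambda>x. x * D N * s"]
    by (simp add: algebra_simps E(1-4,6-9) ED m[THEN unit_simps] mD[THEN unit_simps])
  have bM: "?b \<in> mh N' N"
  proof (rule mhI)
    show "?b \<in> H (U N') (U N)" unfolding N' by (rule m add_in mult_in)+
    have "D N * ?b = f * D M * p + (D N * s) * d * q" by (simp add: algebra_simps ED)
    also have "\<dots> = f * D M * p + (f * r * D N * s + s * D L) * d * q" by (subst Ds) (rule refl)
    also have "\<dots> = ?b * D N'" unfolding N'
      by (simp add: algebra_simps E(1-4,6-9) ED m[THEN unit_simps] mD[THEN unit_simps])
    finally show "?b * D N' = D N * ?b" by simp
  qed (use o N' in auto)
  have "\<exists>!k. k \<in> mh Z N' \<and> ?b * k = u \<and> q * k = v"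
    if u: "u \<in> mh Z N" and v: "v \<in> mh Z L'" and uv: "g * u = d * v" for Z u v
  proof (rule ex1I[of _ "i * r * u + j * v"], intro conjI)
    note mz = mh_in[OF u] mh_in[OF v]
    note EZ = mh_D[OF u, THEN mult_eq_assoc] mh_D[OF v, THEN mult_eq_assoc]
      uv[symmetric, THEN mult_eq_assoc]
    show "?b * (i * r * u + j * v) = u"
    proof -
      have "?b * (i * r * u + j * v) = (f * r + s * g) * u"
        by (simp add: distrib_left distrib_right mult.assoc E(1-4,6-9) EZ(3) m[THEN unit_simps] mz[THEN unit_simps])
      also have "\<dots> = u" using b mz by (simp add: bp_def e_left)
      finally show ?thesis .
    qed
    show "q * (i * r * u + j * v) = v"
      by (simp add: algebra_simps E EZ m[THEN unit_simps] mz[THEN unit_simps])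
    show "i * r * u + j * v \<in> mh Z N'"
    proof (rule mhI)
      show "i * r * u + j * v \<in> H (U Z) (U N')" unfolding N' by (rule m mz add_in mult_in)+
      have "i * (r * (D N * u)) = i * (r * (D N * ((f * r + s * g) * u)))"
        using b mz by (simp add: bp_def e_left)
      also have "\<dots> = i * (D M * (r * u)) + i * (r * (D N * (s * (d * v))))"
        using uv[THEN mult_eq_assoc]
        by (simp add: distrib_left distrib_right mult.assoc E(1) ED(5-7) m[THEN unit_simps] mD[THEN unit_simps])
      finally show "(i * r * u + j * v) * D Z = D N' * (i * r * u + j * v)"
        unfolding N'
        by (simp add: algebra_simps E(1-4,6-9) EZ(1,2) m[THEN unit_simps] mz[THEN unit_simps] mD[THEN unit_simps])
    qed (use N' u mh_ob in auto)
    fix k assume k: "k \<in> mh Z N' \<and> ?b * k = u \<and> q * k = v"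
    then have mk: "k \<in> H (U Z) S" using mh_in N' by blast
    have "i * r * u + j * v = i * r * (?b * k) + j * (q * k)" using k by simp
    also have "\<dots> = (i * r * ?b + j * q) * k" by (simp add: algebra_simps)
    also have "\<dots> = k" by (simp add: algebra_simps E m[THEN unit_simps] mk[THEN unit_simps])
    finally show "k = i * r * u + j * v" by simp
  qed
  moreover have "g * ?b = d * q" by (simp add: algebra_simps E m[THEN unit_simps])
  ultimately have "is_pullback mfc N g L N' q L' ?b d"
    unfolding is_pullback_def using o N' gM d qM bM by auto
  moreover have "deflation mfe N' L' q" unfolding deflation_iff using qM b' N' by blast
  ultimately show ?thesis by blast
qed

lemma mfe_iso:
  assumes E: "mfe M f N g L" and i: "iso_in mfc M M' a" "iso_in mfc N N' b" "iso_in mfc L L' d"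
    and f': "f' \<in> mh M' N'" and g': "g' \<in> mh N' L'" and fb: "b * f = f' * a" and gd: "d * g = g' * b"
  shows "mfe M' f' N' g' L'"
proof -
  obtain s r where bp: "bp (U M) (U L) (U N) f s r g" using E by (auto simp: mfe_def)
  obtain a' b' d' where *: "a \<in> mh M M'" "b \<in> mh N N'" "d \<in> mh L L'" "a' \<in> mh M' M" "b' \<in> mh N' N" "d' \<in> mh L' L"
    and eqs: "a' * a = e (U M)" "a * a' = e (U M')" "b' * b = e (U N)" "b * b' = e (U N')"
      "d' * d = e (U L)" "d * d' = e (U L')"
    using i unfolding iso_in_def mfc_simps by blast
  note m = bp_in[OF bp] *[THEN mh_in] mh_in[OF f'] mh_in[OF g']
  note EE = bp_eq[OF bp, THEN mult_eq_assoc] eqs[THEN mult_eq_assoc]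
  have 1: "f' = b * f * a'" unfolding fb by (simp add: mult.assoc EE m[THEN unit_simps])
  have 2: "g' = d * g * b'" unfolding gd by (simp add: mult.assoc EE m[THEN unit_simps])
  have "bp (U M') (U L') (U N') f' (b * s * d') (a * r * b') g'"
    unfolding 1 2
    by (rule bpI) (auto intro!: mult_in intro: m simp: algebra_simps EE m[THEN unit_simps])
  then show ?thesis using f' g' unfolding mfe_def by blast
qed

lemma bp_e: "A \<in> Ob \<Longrightarrow> \<exists>Z. bp A Z A (e A) 0 (e A) 0 \<and> bp Z A A 0 (e A) 0 (e A)"
proof -
  assume A: "A \<in> Ob"
  obtain Z where "Z \<in> Ob" "e Z = 0" using ex_zero by blast
  then have "bp A Z A (e A) 0 (e A) 0 \<and> bp Z A A 0 (e A) 0 (e A)"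
    using A by (simp add: bp_def zero_in e_in e_left[OF e_in])
  then show ?thesis by blast
qed

lemma mfe_exact: "exact_category mfc mfe"
proof -
  interpret additive_category mfc by (rule mfc_additive)
  show ?thesis
  proof
    fix A assume "A \<in> ob mfc"
    then have A: "A \<in> MO" "U A \<in> Ob" using U_in by auto
    show "inflation mfe A A (idn mfc A)" "deflation mfe A A (idn mfc A)"
      unfolding inflation_iff deflation_iff using A M.e_in bp_e[OF A(2)] by auto
  next
    fix A B f L g assume *: "inflation mfe A B f" "inflation mfe B L g"
    then obtain K s r h K' s' r' h' where
      1: "bp (U A) K (U B) f s r h" and 2: "bp (U B) K' (U L) g s' r' h'" and m: "f \<in> mh A B" "g \<in> mh B L"
      unfolding inflation_iff by blast
    obtain C i j p q where 3: "bp K K' C i j p q" using ex_bp bp_ob 1 2 by meson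
    show "inflation mfe A L (cmp mfc A B L g f)"
      unfolding inflation_iff using m M.mult_in bp_comp_mono[OF 1 2 3] by auto
  next
    fix A B f L g assume *: "deflation mfe A B f" "deflation mfe B L g"
    then obtain K s r h K' s' r' h' where
      1: "bp K (U B) (U A) h s r f" and 2: "bp K' (U L) (U B) h' s' r' g" and m: "f \<in> mh A B" "g \<in> mh B L"
      unfolding deflation_iff by blast
    obtain C i j p q where 3: "bp K K' C i j p q" using ex_bp bp_ob 1 2 by meson
    show "deflation mfe A L (cmp mfc A B L g f)"
      unfolding deflation_iff using m M.mult_in bp_comp_epi[OF 1 2 3] by auto
  qed (use mfe_kernel mfe_cokernel mfe_iso mfe_pushout mfe_pullback in auto)
qed

section \<open>Morphisms to and from the objects \<open>G V\<close>\<close>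

lemma G_eqs:
  assumes V: "V \<in> Ob"
  shows "D (G V) * gi V = gj V * \<eta> V" "D (G V) * gj V = gi V * \<xi> V"
    "gp V * D (G V) = \<xi> V * gq V" "gq V * D (G V) = \<eta> V * gp V"
  by (simp_all add: G_D[OF V] algebra_simps bp_eq(1-4)[OF G_bp[OF V], THEN mult_eq_assoc]
      bp_in[OF G_bp[OF V], THEN unit_simps] eta_in[OF V, THEN unit_simps] xi_in[OF V, THEN unit_simps])

text \<open>As \<open>D (G V) * gi V = gj V * \<eta> V\<close>, the restriction to the first summand
  fixes \<open>m * gj V * \<eta> V\<close>, and \<open>\<eta>\<close> cancels.\<close>

lemma G_out_determined:
  assumes V: "V \<in> Ob" and m: "m \<in> mh (G V) N" "m' \<in> mh (G V) N" and eq: "m * gi V = m' * gi V"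
  shows "m = m'"
proof -
  note b = bp_in[OF G_bp[OF V]]
  have *: "x * gj V * \<eta> V = D N * (x * gi V)" if "x \<in> mh (G V) N" for x
    using mh_D[OF that] by (metis G_eqs(1)[OF V] mult.assoc)
  have "m * gj V = m' * gj V"
    by (rule eta_right_cancel[OF _ _ V]) (auto simp: *[OF m(1)] *[OF m(2)] eq intro: mult_in b mh_in[OF m(1)] mh_in[OF m(2)])
  then have "m * (gi V * gp V + gj V * gq V) = m' * (gi V * gp V + gj V * gq V)"
    using eq by (simp add: distrib_left mult.assoc[symmetric])
  then show ?thesis using G_bp[OF V] mh_in[OF m(1)] mh_in[OF m(2)] by (simp add: bp_def e_right)
qed

text \<open>On the second summand the morphism has to be \<open>g * f'\<close>, with
  \<open>D N = g * \<eta>\<close> and \<open>f'\<close> the image of \<open>f\<close> under \<Phi>.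
  This is where the factorization of the differential through \<open>\<eta>\<close> is used.\<close>

lemma G_out_ex:
  assumes V: "V \<in> Ob" and N: "N \<in> MO" and f: "f \<in> H V (U N)"
  shows "\<exists>m\<in>mh (G V) N. m * gi V = f"
proof -
  obtain g where g: "g \<in> H (\<Phi> (U N)) (U N)" "D N = g * \<eta> (U N)" using D_fac[OF N] by blast
  obtain f' where f': "f' \<in> H (\<Phi> V) (\<Phi> (U N))" "f' * \<eta> V = \<eta> (U N) * f" using Phi_up[OF f] by blast
  note m = bp_in[OF G_bp[OF V]] f g(1) f'(1) D_in[OF N] eta_in[OF V] xi_in[OF V]
  note E = bp_eq[OF G_bp[OF V], THEN mult_eq_assoc]
  \<comment> \<open>Composed with \<open>\<eta>\<close> both sides are \<open>\<tau>\<close>, the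
    left one as \<open>D N * D N\<close>.\<close>
  have "D N * g = \<xi> (U N)"
    by (rule eta_right_cancel)
      (auto simp: mult.assoc g(2)[symmetric] D_D[OF N] xi_eta[OF U_in[OF N]] intro: mult_in m xi_in U_in N)
  then have Dg: "D N * (g * x) = \<xi> (U N) * x" for x by (metis mult.assoc)
  note E2 = xi_natural[OF f f', THEN mult_eq_assoc] f'(2)[THEN mult_eq_assoc] G_eqs[OF V, THEN mult_eq_assoc]
   g(2)[symmetric, THEN mult_eq_assoc]
  let ?m = "f * gp V + g * f' * gq V"
  have "?m \<in> mh (G V) N"
  proof (rule mhI)
    show "?m \<in> H (U (G V)) (U N)" by (rule m add_in mult_in)+
  qed (auto simp: distrib_left distrib_right mult.assoc E2 Dg G_MO V N)
  moreover have "?m * gi V = f" by (simp add: algebra_simps E m[THEN unit_simps])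
  ultimately show ?thesis by blast
qed

lemma G_in_determined:
  assumes V: "V \<in> Ob" and m: "m \<in> mh M (G V)" "m' \<in> mh M (G V)" and eq: "gq V * m = gq V * m'"
  shows "m = m'"
proof -
  note b = bp_in[OF G_bp[OF V]]
  have *: "\<eta> V * (gp V * x) = gq V * x * D M" if "x \<in> mh M (G V)" for x
    using mh_D[OF that] by (metis G_eqs(4)[OF V] mult.assoc)
  have "gp V * m = gp V * m'"
    by (rule eta_left_cancel) (auto simp: *[OF m(1)] *[OF m(2)] eq intro: mult_in b mh_in[OF m(1)] mh_in[OF m(2)])
  then have "(gi V * gp V + gj V * gq V) * m = (gi V * gp V + gj V * gq V) * m'"
    using eq by (simp add: distrib_right mult.assoc)
  then show ?thesis using G_bp[OF V] mh_in[OF m(1)] mh_in[OF m(2)] by (simp add: bp_def e_left)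
qed

text \<open>The first component \<open>a\<close> must satisfy
  \<open>\<eta> V * a = b * D M = b * g * \<eta>\<close>. Both ends of \<open>b * g\<close> are in
  the image of \<Phi>, so \<open>Phi_down\<close> supplies \<open>a\<close>.\<close>

lemma G_in_ex:
  assumes V: "V \<in> Ob" and M: "M \<in> MO" and b: "b \<in> H (U M) (\<Phi> V)"
  shows "\<exists>m\<in>mh M (G V). gq V * m = b"
proof -
  obtain g where g: "g \<in> H (\<Phi> (U M)) (U M)" "D M = g * \<eta> (U M)" using D_fac[OF M] by blast
  obtain a where a: "a \<in> H (U M) V" "b * g * \<eta> (U M) = \<eta> V * a"
    using Phi_down[OF U_in[OF M] V mult_in[OF b g(1)]] by blast
  have bD: "b * D M = \<eta> V * a" using a(2) g(2) by (simp add: mult.assoc)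
  note m = bp_in[OF G_bp[OF V]] a(1) b D_in[OF M] eta_in[OF V] xi_in[OF V]
  note E = bp_eq[OF G_bp[OF V], THEN mult_eq_assoc]
  have aD: "a * D M = \<xi> V * b"
  proof (rule eta_left_cancel)
    have "\<eta> V * (a * D M) = b * (D M * D M)" by (simp add: mult.assoc[symmetric] bD)
    also have "\<dots> = (\<eta> V * \<xi> V) * b" by (simp add: D_D[OF M] eta_xi[OF V] tau_left mult.assoc m[THEN unit_simps])
    finally show "\<eta> V * (a * D M) = \<eta> V * (\<xi> V * b)" by (simp add: mult.assoc)
  qed (auto intro: mult_in m)
  note E2 = aD[THEN mult_eq_assoc] bD[THEN mult_eq_assoc] G_eqs[OF V, THEN mult_eq_assoc]
  let ?m = "gi V * a + gj V * b"
  have "?m \<in> mh M (G V)"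
  proof (rule mhI)
    show "?m \<in> H (U M) (U (G V))" by (rule m add_in mult_in)+
  qed (auto simp: distrib_left distrib_right mult.assoc E2 G_MO V M)
  moreover have "gq V * ?m = b" by (simp add: algebra_simps E m[THEN unit_simps])
  ultimately show ?thesis by blast
qed

lemma G_projective: assumes V: "V \<in> Ob" shows "projective_object mfc mfe (G V)"
proof -
  have "\<exists>k\<in>mh (G V) N. g * k = h" if g: "deflation mfe N L g" and h: "h \<in> mh (G V) L" for N L g h
  proof -
    obtain A f s r where gM: "g \<in> mh N L" and b: "bp A (U L) (U N) f s r g"
      using g unfolding deflation_iff by blast
    note m = bp_in[OF b] and E = bp_eq[OF b]
    have "s * h * gi V \<in> H V (U N)"
      using m mh_in[OF h] bp_in[OF G_bp[OF V]] by (auto intro: mult_in)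
    then obtain k where k: "k \<in> mh (G V) N" "k * gi V = s * h * gi V"
      using G_out_ex[OF V] mh_ob[OF gM] by blast
    have "g * k * gi V = (g * s) * h * gi V" using k(2) by (simp add: mult.assoc)
    then have "g * k * gi V = h * gi V" using E mh_in[OF h] by (simp add: e_left)
    then have "g * k = h" by (rule G_out_determined[OF V M.mult_in[OF gM k(1)] h])
    then show ?thesis using k by blast
  qed
  then show ?thesis using G_MO[OF V] by (auto simp: projective_object_def)
qed

lemma G_injective: assumes V: "V \<in> Ob" shows "injective_object mfc mfe (G V)"
proof -
  have "\<exists>k\<in>mh N (G V). k * f = h" if f: "inflation mfe M N f" and h: "h \<in> mh M (G V)" for M N f h
  proof -
    obtain C s r g where fM: "f \<in> mh M N" and b: "bp (U M) C (U N) f s r g"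
      using f unfolding inflation_iff by blast
    note m = bp_in[OF b] and E = bp_eq[OF b]
    have "gq V * h * r \<in> H (U N) (\<Phi> V)"
      using m mh_in[OF h] bp_in[OF G_bp[OF V]] by (auto intro: mult_in)
    then obtain k where k: "k \<in> mh N (G V)" "gq V * k = gq V * h * r"
      using G_in_ex[OF V] mh_ob[OF fM] by blast
    have "gq V * (k * f) = gq V * h * r * f" using k(2) by (simp add: mult.assoc[symmetric])
    then have "gq V * (k * f) = gq V * h" using E mh_in[OF h] by (simp add: e_right mult.assoc)
    then have "k * f = h" by (rule G_in_determined[OF V M.mult_in[OF k(1) fM] h])
    then show ?thesis using k by blast
  qed
  then show ?thesis using G_MO[OF V] by (auto simp: injective_object_def)
qed

text \<open>The inclusion \<open>gi (U M)\<close> is a section of \<open>m\<close> in the underlying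
  category. The kernel is the second summand, sheared by \<open>gi (U M) * m\<close> so that
  \<open>m\<close> kills it.\<close>

lemma G_deflation:
  assumes M: "M \<in> MO"
  shows "\<exists>m. m * gi (U M) = e (U M) \<and> deflation mfe (G (U M)) M m"
proof -
  let ?V = "U M"
  have V: "?V \<in> Ob" using U_in M by blast
  obtain m where mM: "m \<in> mh (G ?V) M" and mi: "m * gi ?V = e ?V"
    using G_out_ex[OF V M e_in[OF V]] by blast
  note b = G_bp[OF V]
  note mm = bp_in[OF b] mh_in[OF mM]
  have "m * (gi ?V * gp ?V + gj ?V * gq ?V) = m" using b mm by (simp add: bp_def e_right)
  then have "m = gp ?V + m * gj ?V * gq ?V"
    by (simp add: distrib_left mult.assoc[symmetric] mi) (simp add: mm[THEN unit_simps])
  then have 1: "gi ?V * m = gi ?V * gp ?V + gi ?V * (m * (gj ?V * gq ?V))" by (metis distrib_left mult.assoc)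
  note E = bp_eq[OF b, THEN mult_eq_assoc] mi[THEN mult_eq_assoc]
  have "bp (\<Phi> ?V) ?V (U (G ?V)) (gj ?V - gi ?V * (m * gj ?V)) (gi ?V) (gq ?V) m"
  proof (rule bpI)
    show "gj ?V - gi ?V * (m * gj ?V) \<in> H (\<Phi> ?V) (U (G ?V))" by (rule mm diff_in mult_in)+
    show "(gj ?V - gi ?V * (m * gj ?V)) * gq ?V + gi ?V * m = e (U (G ?V))"
      by (subst 1) (simp add: algebra_simps bp_eq(5)[OF b])
  qed (auto intro: mm simp: algebra_simps E mm[THEN unit_simps])
  then show ?thesis using mi mM unfolding deflation_iff by blast
qed

lemma G_inflation:
  assumes M: "M \<in> MO" shows "\<exists>V\<in>Ob. \<exists>m. inflation mfe M (G V) m"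
proof -
  obtain V where V: "V \<in> Ob" "\<Phi> V = U M" using Phi_surj U_in M by blast
  obtain m where mM: "m \<in> mh M (G V)" and mi: "gq V * m = e (U M)"
    using G_in_ex[OF V(1) M] V e_in U_in M by metis
  note b = G_bp[OF V(1), unfolded V(2)]
  note mm = bp_in[OF b] mh_in[OF mM]
  have "(gi V * gp V + gj V * gq V) * m = m" using b mm by (simp add: bp_def e_left)
  then have "m = gi V * gp V * m + gj V"
    by (simp add: distrib_right mult.assoc mi) (simp add: mm[THEN unit_simps])
  then have 1: "m * gq V = gi V * (gp V * (m * gq V)) + gj V * gq V" by (metis distrib_right mult.assoc)
  note E = bp_eq[OF b, THEN mult_eq_assoc] mi[THEN mult_eq_assoc]
  have "bp (U M) V (U (G V)) m (gi V) (gq V) (gp V - gp V * (m * gq V))"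
  proof (rule bpI)
    show "m * gq V + gi V * (gp V - gp V * (m * gq V)) = e (U (G V))"
      by (subst 1) (simp add: algebra_simps bp_eq(5)[OF b])
    show "gp V - gp V * (m * gq V) \<in> H (U (G V)) V" by (rule mm diff_in mult_in)+
  qed (auto intro: mm simp: algebra_simps E mm[THEN unit_simps])
  then show ?thesis using mM V(1) unfolding inflation_iff by blast
qed

section \<open>Retracts; projective objects coincide with injective ones\<close>

lemma projective_lift:
  "\<lbrakk>projective_object mfc mfe P; deflation mfe B L g; h \<in> mh P L\<rbrakk> \<Longrightarrow> \<exists>k\<in>mh P B. g * k = h"
  unfolding projective_object_def mfc_simps by blast

lemma injective_extend:
  "\<lbrakk>injective_object mfc mfe P; inflation mfe A B f; h \<in> mh A P\<rbrakk> \<Longrightarrow> \<exists>k\<in>mh B P. k * f = h"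
  unfolding injective_object_def mfc_simps by blast

lemma retract_projective:
  assumes P: "projective_object mfc mfe P" and u: "u \<in> mh N P" and v: "v \<in> mh P N" and vu: "v * u = e (U N)"
  shows "projective_object mfc mfe N"
proof -
  have "\<exists>k\<in>mh N B. g * k = h" if g: "deflation mfe B L g" and h: "h \<in> mh N L" for B L g h
  proof -
    obtain k where k: "k \<in> mh P B" "g * k = h * v"
      using projective_lift[OF P g M.mult_in[OF h v]] by blast
    have "g * (k * u) = h * (v * u)" using k(2) by (simp add: mult.assoc[symmetric])
    also have "\<dots> = h" using vu mh_in[OF h] by (simp add: e_right)
    finally show ?thesis using M.mult_in[OF k(1) u] by blast
  qed
  then show ?thesis using mh_ob[OF u] by (auto simp: projective_object_def)
qed

lemma retract_injective:
  assumes P: "injective_object mfc mfe P" and u: "u \<in> mh N P" and v: "v \<in> mh P N" and vu: "v * u = e (U N)"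
  shows "injective_object mfc mfe N"
proof -
  have "\<exists>k\<in>mh B N. k * f = h" if f: "inflation mfe A B f" and h: "h \<in> mh A N" for A B f h
  proof -
    obtain k where k: "k \<in> mh B P" "k * f = u * h"
      using injective_extend[OF P f M.mult_in[OF u h]] by blast
    have "(v * k) * f = (v * u) * h" using k(2) by (simp add: mult.assoc)
    also have "\<dots> = h" using vu mh_in[OF h] by (simp add: e_left)
    finally show ?thesis using M.mult_in[OF v k(1)] by blast
  qed
  then show ?thesis using mh_ob[OF u] by (auto simp: injective_object_def)
qed

lemma projective_split:
  assumes P: "projective_object mfc mfe M"
  shows "\<exists>m k. m \<in> mh (G (U M)) M \<and> k \<in> mh M (G (U M)) \<and> m * gi (U M) = e (U M) \<and> m * k = e (U M)"
proof -
  have M: "M \<in> MO" using P by (simp add: projective_object_def)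
  obtain m where m: "m * gi (U M) = e (U M)" "deflation mfe (G (U M)) M m" using G_deflation[OF M] by blast
  then show ?thesis using projective_lift[OF P m(2) M.e_in[OF M]] unfolding deflation_iff by blast
qed

lemma projective_imp_injective:
  "projective_object mfc mfe M \<Longrightarrow> injective_object mfc mfe M"
  using projective_split[of M] retract_injective[OF G_injective]
  by (metis U_in mfc_simps(1) projective_object_def)

lemma injective_imp_projective:
  assumes P: "injective_object mfc mfe M" shows "projective_object mfc mfe M"
proof -
  have M: "M \<in> MO" using P by (simp add: injective_object_def)
  obtain V m where m: "V \<in> Ob" "inflation mfe M (G V) m" using G_inflation[OF M] by blast
  then obtain k where "k \<in> mh (G V) M" "k * m = e (U M)"
    using injective_extend[OF P _ M.e_in[OF M]] by blast
  then show ?thesis using retract_projective[OF G_projective[OF m(1)]] m unfolding inflation_iff by blast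
qed

theorem mfc_frobenius: "frobenius_category mfc mfe"
proof -
  interpret exact_category mfc mfe by (rule mfe_exact)
  show ?thesis
  proof
    fix M assume "M \<in> ob mfc"
    then have M: "M \<in> MO" by simp
    show "\<exists>P g. projective_object mfc mfe P \<and> deflation mfe P M g"
      using G_projective[OF U_in[OF M]] G_deflation[OF M] by blast
    show "\<exists>I f. injective_object mfc mfe I \<and> inflation mfe M I f"
      using G_injective G_inflation[OF M] by blast
  qed (use projective_imp_injective injective_imp_projective in blast)
qed

end

text \<open>In \<open>ex_pivot\<close>, the morphisms \<open>\<alpha>\<close> and \<open>\<beta>\<close> correspond to \<open>G V \<rightarrow> (Q, d)\<close> and \<open>(Q, d) \<rightarrow> G V\<close> with
  composite \<open>1 + r d\<close>, whose inverse is \<open>w (1 - r d)\<close> because \<open>d\<^sup>2 = \<tau>\<close>.\<close>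

locale mf_pivot = mf_ring Ob H e \<tau> \<Phi> \<eta> \<xi> MO U D G gi gj gp gq
  for Ob :: "'o set" and H :: "'o \<Rightarrow> 'o \<Rightarrow> 'a::ring_1 set" and e \<tau> \<Phi> \<eta> \<xi>
    and MO :: "'m set" and U D G gi gj gp gq +
  fixes rank :: "'o \<Rightarrow> nat" and Sc :: "'a set"
  assumes rank_0: "\<lbrakk>A \<in> Ob; rank A = 0\<rbrakk> \<Longrightarrow> e A = 0"
    and rank_Phi: "A \<in> Ob \<Longrightarrow> rank (\<Phi> A) = rank A"
    and Sc_comm: "r \<in> Sc \<Longrightarrow> r * x = x * r"
    and Sc_in: "\<lbrakk>r \<in> Sc; f \<in> H A B\<rbrakk> \<Longrightarrow> r * f \<in> H A B"
    and ex_elim: "\<lbrakk>\<alpha> \<in> H A B; \<rho> \<in> H B A; \<rho> * \<alpha> = e A; rank A = 1\<rbrakk> \<Longrightarrow>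
      \<exists>Y C i j p q v. bp Y C B i j p q \<and> v \<in> H Y A \<and> v * (p * \<alpha>) = e A \<and> p * \<alpha> * v = e Y \<and>
        rank B = Suc (rank C)"
    and ex_pivot: "\<lbrakk>Q \<in> Ob; rank Q > 0; g \<in> H (\<Phi> Q) Q; b \<in> H Q (\<Phi> Q); a \<in> H Q Q; a + g * b = e Q;
        \<eta> Q * a = b * g * \<eta> Q\<rbrakk> \<Longrightarrow>
      \<exists>V \<alpha> \<alpha>' \<beta> r w. V \<in> Ob \<and> rank V = 1 \<and> \<alpha> \<in> H V Q \<and> \<alpha>' \<in> H (\<Phi> V) (\<Phi> Q) \<and>
        \<alpha>' * \<eta> V = \<eta> Q * \<alpha> \<and> \<beta> \<in> H Q (\<Phi> V) \<and> \<beta> * \<alpha> = r * \<eta> V \<and> \<beta> * g * \<alpha>' = e (\<Phi> V) \<and>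
        r \<in> Sc \<and> w \<in> Sc \<and> w * (1 - r * r * \<tau>) = 1"
begin

text \<open>Gaussian elimination: once the component \<open>p * \<alpha>\<close> is invertible, the
  remaining part \<open>C\<close> of \<open>B\<close> is a complement of the image of
  \<open>\<alpha>\<close> as well. The given retraction \<open>\<rho>\<close> is kept, since later
  it is a morphism of factorizations and must stay one.\<close>

lemma complement_rank_1:
  assumes \<alpha>: "\<alpha> \<in> H A B" and \<rho>: "\<rho> \<in> H B A" and \<rho>\<alpha>: "\<rho> * \<alpha> = e A" and A: "rank A = 1"
  shows "\<exists>C s h. bp A C B \<alpha> s \<rho> h \<and> rank B = Suc (rank C)"
proof -
  obtain Y C i j p q v where b: "bp Y C B i j p q" and v: "v \<in> H Y A" "v * (p * \<alpha>) = e A" "p * \<alpha> * v = e Y"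
    and rk: "rank B = Suc (rank C)"
    using ex_elim[OF assms] by blast
  note m = bp_in[OF b] \<alpha> \<rho> v(1)
  have "p * (\<alpha> * (v * x)) = e Y * x" "v * (p * (\<alpha> * x)) = e A * x" for x
    using v(2,3) by (metis mult.assoc)+
  note E = bp_eq[OF b, THEN mult_eq_assoc] \<rho>\<alpha>[THEN mult_eq_assoc] this v(2) v(3)[unfolded mult.assoc]
  have "bp A C B \<alpha> (j - \<alpha> * (\<rho> * j)) \<rho> (q - q * (\<alpha> * (v * p)))"
  proof (rule bpI)
    show "j - \<alpha> * (\<rho> * j) \<in> H C B" "q - q * (\<alpha> * (v * p)) \<in> H B C" by (rule m diff_in mult_in)+
  qed (auto intro: m simp: algebra_simps E m[THEN unit_simps])
  then show ?thesis using rk by blast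
qed

text \<open>Two rank one steps: split off \<open>\<alpha> * i\<close>, then what is left of
  \<open>\<alpha>\<close> inside the complement \<open>C1\<close>. By \<open>sa\<close> and
  \<open>ra\<close> the other halves \<open>\<alpha> * j\<close> and \<open>q * \<rho>\<close> pass
  through \<open>C1\<close> unchanged, so the final splitting involves \<open>\<alpha>\<close> and
  \<open>\<rho>\<close> themselves.\<close>

lemma complement_rank_2:
  assumes b: "bp A1 A2 A i j p q" and rk: "rank A1 = 1" "rank A2 = 1"
    and \<alpha>: "\<alpha> \<in> H A B" and \<rho>: "\<rho> \<in> H B A" and \<rho>\<alpha>: "\<rho> * \<alpha> = e A"
  shows "\<exists>C s h. bp A C B \<alpha> s \<rho> h \<and> rank B = Suc (Suc (rank C))"
proof -
  note m0 = bp_in[OF b] \<alpha> \<rho>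
  note E0 = bp_eq[OF b, THEN mult_eq_assoc] \<rho>\<alpha>[THEN mult_eq_assoc]
  define \<alpha>1 \<rho>1 where d1: "\<alpha>1 = \<alpha> * i" "\<rho>1 = p * \<rho>"
  have m1: "\<alpha>1 \<in> H A1 B" "\<rho>1 \<in> H B A1" unfolding d1 by (auto intro: mult_in m0)
  have "\<rho>1 * \<alpha>1 = e A1" unfolding d1 by (simp add: mult.assoc E0 m0[THEN unit_simps])
  then obtain C1 s1 h1 where b1: "bp A1 C1 B \<alpha>1 s1 \<rho>1 h1" and r1: "rank B = Suc (rank C1)"
    using complement_rank_1 m1 rk by blast
  define \<alpha>2 \<rho>2 where d2: "\<alpha>2 = h1 * \<alpha> * j" "\<rho>2 = q * \<rho> * s1"
  note m1' = m0 bp_in[OF b1]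
  note E1 = bp_eq[OF b1, THEN mult_eq_assoc]
  have m2: "\<alpha>2 \<in> H A2 C1" "\<rho>2 \<in> H C1 A2" unfolding d2 by (auto intro: mult_in m1')
  have sa: "s1 * \<alpha>2 = \<alpha> * j"
    unfolding d2 by (simp add: mult.assoc E1) (simp add: algebra_simps d1 E0 m1'[THEN unit_simps])
  have ra: "\<rho>2 * h1 = q * \<rho>"
    unfolding d2 by (simp add: mult.assoc E1) (simp add: algebra_simps d1 E0 m1'[THEN unit_simps])
  have "\<rho>2 * \<alpha>2 = q * \<rho> * (s1 * \<alpha>2)" unfolding d2 by (simp add: mult.assoc)
  also have "\<dots> = e A2" unfolding sa by (simp add: mult.assoc E0 m0[THEN unit_simps])
  finally obtain C s2 h2 where b2: "bp A2 C C1 \<alpha>2 s2 \<rho>2 h2" and r2: "rank C1 = Suc (rank C)"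
    using complement_rank_1 m2 rk by blast
  note m = m1' bp_in[OF b2]
  note E2 = bp_eq[OF b2, THEN mult_eq_assoc]
  have ha: "h1 * \<alpha> = \<alpha>2 * q"
  proof -
    have "h1 * \<alpha> = h1 * \<alpha> * (i * p + j * q)" using b m by (simp add: bp_def mult.assoc e_right)
    also have "\<dots> = (h1 * \<alpha>1) * p + \<alpha>2 * q" unfolding d1 d2 by (simp add: algebra_simps)
    finally show ?thesis by (simp add: E1)
  qed
  have "bp A C B \<alpha> (s1 * s2) \<rho> (h2 * h1)"
  proof (rule bpI)
    show "s1 * s2 \<in> H C B" "h2 * h1 \<in> H B C" by (auto intro: mult_in m)
    show "h2 * h1 * (s1 * s2) = e C" by (simp add: mult.assoc E1 E2 m[THEN unit_simps])
    show "h2 * h1 * \<alpha> = 0" by (simp add: mult.assoc ha) (simp add: E2)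
    have "\<alpha> * \<rho> = \<alpha> * (i * p + j * q) * \<rho>" using b m by (simp add: bp_def mult.assoc e_left)
    also have "\<dots> = \<alpha>1 * \<rho>1 + \<alpha> * j * (q * \<rho>)" unfolding d1 by (simp add: algebra_simps)
    finally have 1: "\<alpha> * \<rho> = \<alpha>1 * \<rho>1 + \<alpha> * j * (q * \<rho>)" .
    have "s1 * s2 * (h2 * h1) = s1 * h1 - (s1 * \<alpha>2) * (\<rho>2 * h1)"
      by (simp add: algebra_simps E2 m[THEN unit_simps])
    then show "\<alpha> * \<rho> + s1 * s2 * (h2 * h1) = e B" unfolding 1 sa ra by (simp add: E1)
  qed (use m \<rho>\<alpha> in auto)
  then show ?thesis using r1 r2 by auto
qed

lemma G_summand:
  assumes P: "projective_object mfc mfe M" and rk: "rank (U M) > 0"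
  shows "\<exists>V L F s B h. V \<in> Ob \<and> M.bp (G V) L M F s B h \<and> rank (U L) < rank (U M)"
proof -
  have M: "M \<in> MO" using P by (simp add: projective_object_def)
  let ?Q = "U M"
  have Q: "?Q \<in> Ob" using U_in M by blast
  obtain m k where m: "m \<in> mh (G ?Q) M" "m * gi ?Q = e ?Q" and k: "k \<in> mh M (G ?Q)" "m * k = e ?Q"
    using projective_split[OF P] by blast
  obtain g where g: "g \<in> H (\<Phi> ?Q) ?Q" "D M = g * \<eta> ?Q" using D_fac[OF M] by blast
  \<comment> \<open>A morphism out of \<open>G W\<close> acts on the second summand through
    \<open>g\<close>. For the canonical \<open>m\<close> this gives \<open>g\<close> itself, so
    \<open>m\<close> is the row with entries 1 and \<open>g\<close>.\<close>
  have out: "F * gj W = g * f'"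
    if "W \<in> Ob" "F \<in> mh (G W) M" "F * gi W = f" "f \<in> H W ?Q" "f' \<in> H (\<Phi> W) (\<Phi> ?Q)" "f' * \<eta> W = \<eta> ?Q * f" for W F f f'
  proof (rule eta_right_cancel[OF _ _ that(1)])
    show "F * gj W \<in> H (\<Phi> W) ?Q" "g * f' \<in> H (\<Phi> W) ?Q"
      using that mh_in[OF that(2)] bp_in[OF G_bp[OF that(1)]] g by (auto intro: mult_in)
    show "F * gj W * \<eta> W = g * f' * \<eta> W"
      using mh_D[OF that(2)] G_eqs(1)[OF that(1)] that(3,6) g(2) by (metis mult.assoc)
  qed
  have mj: "m * gj ?Q = g"
    using out[OF Q m e_in[OF Q] e_in[OF Phi_in[OF Q]]] eta_in[OF Q] g by (simp add: e_left e_right)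
  \<comment> \<open>The components of the splitting: \<open>m * k = 1\<close> reads
    \<open>a + g * b = 1\<close>, and compatibility with the differentials reads
    \<open>\<eta> * a = b * g * \<eta>\<close>, that is, \<Phi> maps \<open>a\<close> to
    \<open>b * g\<close>.\<close>
  define a b where ab: "a = gp ?Q * k" "b = gq ?Q * k"
  note bG = bp_in[OF G_bp[OF Q]]
  have abm: "a \<in> H ?Q ?Q" "b \<in> H ?Q (\<Phi> ?Q)" unfolding ab using bG mh_in[OF k(1)] by (auto intro: mult_in)
  have "m * k = m * (gi ?Q * gp ?Q + gj ?Q * gq ?Q) * k" using G_bp[OF Q] mh_in[OF k(1)] by (simp add: bp_def mult.assoc e_left)
  also have "\<dots> = (m * gi ?Q) * a + (m * gj ?Q) * b" unfolding ab by (simp add: algebra_simps)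
  finally have "a + g * b = e ?Q" using m(2) mj k(2) abm by (simp add: e_left)
  moreover have "\<eta> ?Q * a = b * g * \<eta> ?Q"
    using G_eqs(4)[OF Q] mh_D[OF k(1)] g(2) unfolding ab by (metis mult.assoc)
  ultimately obtain V \<alpha> \<alpha>' \<beta> r w where V: "V \<in> Ob" "rank V = 1" and al: "\<alpha> \<in> H V ?Q" "\<alpha>' \<in> H (\<Phi> V) (\<Phi> ?Q)"
      "\<alpha>' * \<eta> V = \<eta> ?Q * \<alpha>" and be: "\<beta> \<in> H ?Q (\<Phi> V)" "\<beta> * \<alpha> = r * \<eta> V" "\<beta> * g * \<alpha>' = e (\<Phi> V)"
      and rw: "r \<in> Sc" "w \<in> Sc" "w * (1 - r * r * \<tau>) = 1"
    using ex_pivot[OF Q rk g(1) abm(2,1)] by blast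
  obtain F where F: "F \<in> mh (G V) M" "F * gi V = \<alpha>" using G_out_ex[OF V(1) M al(1)] by blast
  have Fj: "F * gj V = g * \<alpha>'" using out[OF V(1) F al] .
  obtain B where B: "B \<in> mh M (G V)" "gq V * B = \<beta>" using G_in_ex[OF V(1) M be(1)] by blast
  let ?d = "D (G V)" and ?E = "e (U (G V))"
  have GV: "G V \<in> MO" using G_MO V by blast
  note mG = bp_in[OF G_bp[OF V(1)]] mh_in[OF F(1)] mh_in[OF B(1)] D_in[OF GV]
  have Sm: "x \<in> Sc \<Longrightarrow> f \<in> mh K N \<Longrightarrow> x * f \<in> mh K N" for x f K N
    by (auto simp: mh_iff Sc_in mult.assoc) (metis Sc_comm mult.assoc)
  have dM: "?d \<in> mh (G V) (G V)" using GV D_in by (auto simp: mh_iff)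
  \<comment> \<open>Only the component in the second summand has to be compared. It is
    \<open>\<beta> * \<alpha> = r * \<eta> V\<close> on the first summand and 1 on the
    second.\<close>
  have BF: "B * F = ?E + r * ?d"
  proof (rule G_in_determined[OF V(1)])
    show "B * F \<in> mh (G V) (G V)" using B F M.mult_in by blast
    show "?E + r * ?d \<in> mh (G V) (G V)" using M.add_in M.e_in[OF GV] Sm dM rw by blast
    have "gq V * (B * F) = \<beta> * F" using B by (simp add: mult.assoc[symmetric])
    also have "\<dots> = \<beta> * F * (gi V * gp V + gj V * gq V)" using G_bp[OF V(1)] mG by (simp add: bp_def mult.assoc e_right)
    also have "\<dots> = \<beta> * (F * gi V) * gp V + \<beta> * (F * gj V) * gq V" by (simp add: algebra_simps)
    also have "\<dots> = r * \<eta> V * gp V + gq V"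
      unfolding F Fj using be(2,3) mG by (simp add: mult.assoc[symmetric] e_left)
    also have "\<dots> = gq V * (?E + r * ?d)"
      using mG G_eqs(4)[OF V(1)] by (simp add: distrib_left e_right) (metis Sc_comm[OF rw(1)] mult.assoc)
    finally show "gq V * (B * F) = gq V * (?E + r * ?d)" .
  qed
  define B' where "B' = w * (B - r * ?d * B)"
  have B'M: "B' \<in> mh M (G V)"
    unfolding B'_def mult.assoc by (rule Sm[OF rw(2) M.diff_in[OF B(1) Sm[OF rw(1) M.mult_in[OF dM B(1)]]]])
  have dr: "?d * (r * x) = r * (?d * x)" for x by (metis Sc_comm[OF rw(1)] mult.assoc)
  have "B' * F = w * (B * F - r * ?d * (B * F))" unfolding B'_def by (simp add: algebra_simps)
  also have "\<dots> = w * (?E - r * (r * (?d * ?d)))"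
    unfolding BF using mG by (simp add: algebra_simps dr e_right e_left)
  also have "\<dots> = w * (1 - r * r * \<tau>) * ?E" by (simp add: D_D[OF GV] algebra_simps)
  also have "\<dots> = ?E" by (simp add: rw)
  finally have B'F: "B' * F = ?E" .
  have "rank (\<Phi> V) = 1" using rank_Phi V by simp
  then obtain C s h where c: "bp (U (G V)) C ?Q F s B' h" and rC: "rank ?Q = Suc (Suc (rank C))"
    using complement_rank_2[OF G_bp[OF V(1)] V(2) _ mh_in[OF F(1)] mh_in[OF B'M] B'F] by blast
  then obtain L where L: "L \<in> MO" "U L = C" "D L = h * D M * s" "mfe (G V) F M h L"
    using cokernel_object[OF F(1)] by blast
  have hM: "h \<in> mh M L" using L by (simp add: mfe_def)
  note mc = bp_in[OF c] D_in[OF M] and Ec = bp_eq[OF c, THEN mult_eq_assoc]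
  \<comment> \<open>The complement was found in the underlying category only. Its section
    \<open>s\<close> respects the differentials because \<open>B'\<close> does:
    \<open>B' * D M * s = ?d * B' * s = 0\<close>.\<close>
  have "s * D L = (s * h) * (D M * s)" unfolding L by (simp add: mult.assoc)
  also have "\<dots> = D M * s - F * (B' * D M) * s"
    unfolding bp_eq(5)[OF c] by (simp add: algebra_simps mc[THEN unit_simps])
  also have "\<dots> = D M * s" unfolding mh_D[OF B'M] by (simp add: mult.assoc Ec)
  finally have "s \<in> mh L M" using L M mc by (auto simp: mh_iff)
  then have "M.bp (G V) L M F s B' h"
    using c F B'M hM L(2) unfolding bp_def M.bp_def by simp
  then show ?thesis using V L rC by (metis Suc_lessD lessI)
qed

text \<open>Morphisms out of \<open>G V\<close> exist and are determined by their restriction along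
  \<open>gi V\<close>. So the four maps of the biproduct extend, and the identities between them
  need checking only on first summands.\<close>

lemma G_additive:
  assumes b: "bp V W S i j p q"
  shows "\<exists>i' j' p' q'. M.bp (G V) (G W) (G S) i' j' p' q'"
proof -
  note o = bp_ob[OF b] and m = bp_in[OF b]
  have ex: "\<exists>u'\<in>mh (G K) (G K'). u' * gi K = gi K' * u" if "u \<in> H K K'" for u K K'
    using that H_ob[OF that] by (intro G_out_ex G_MO) (auto intro: mult_in bp_in[OF G_bp])
  obtain i' j' p' q' where u: "i' \<in> mh (G V) (G S)" "j' \<in> mh (G W) (G S)" "p' \<in> mh (G S) (G V)" "q' \<in> mh (G S) (G W)"
    and g: "i' * gi V = gi S * i" "j' * gi W = gi S * j" "p' * gi S = gi V * p" "q' * gi S = gi W * q"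
    using ex[OF m(1)] ex[OF m(2)] ex[OF m(3)] ex[OF m(4)] by blast
  have oG: "G V \<in> MO" "G W \<in> MO" "G S \<in> MO" using G_MO o by auto
  have mi: "gi V \<in> H V (U (G V))" "gi W \<in> H W (U (G W))" "gi S \<in> H S (U (G S))" using bp_in[OF G_bp] o by auto
  note E = g[THEN mult_eq_assoc] bp_eq[OF b, THEN mult_eq_assoc]
  have "p' * i' = e (U (G V))"
    by (rule G_out_determined[OF o(1) M.mult_in[OF u(3,1)] M.e_in[OF oG(1)]]) (simp add: mult.assoc E mi[THEN unit_simps])
  moreover have "q' * j' = e (U (G W))"
    by (rule G_out_determined[OF o(2) M.mult_in[OF u(4,2)] M.e_in[OF oG(2)]]) (simp add: mult.assoc E mi[THEN unit_simps])
  moreover have "q' * i' = 0"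
    by (rule G_out_determined[OF o(1) M.mult_in[OF u(4,1)] M.zero_in[OF oG(1,2)]]) (simp add: mult.assoc E)
  moreover have "i' * p' + j' * q' = e (U (G S))"
    by (rule G_out_determined[OF o(3) M.add_in[OF M.mult_in[OF u(1,3)] M.mult_in[OF u(2,4)]] M.e_in[OF oG(3)]])
      (simp add: algebra_simps E mi[THEN unit_simps])
  ultimately show ?thesis using M.bpI u by blast
qed

theorem projective_isomorphic_G:
  "projective_object mfc mfe M \<Longrightarrow> \<exists>V\<in>Ob. isomorphic_in mfc M (G V)"
proof (induction "rank (U M)" arbitrary: M rule: less_induct)
  case less
  have M: "M \<in> MO" using less.prems by (simp add: projective_object_def)
  let ?Q = "U M"
  have Q: "?Q \<in> Ob" using U_in M by blast
  show ?case
  proof (cases "rank ?Q = 0")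
    case True
    \<comment> \<open>Then \<open>\<eta>\<close> vanishes, hence so does
      \<open>\<tau> * e (\<Phi> ?Q)\<close>, and \<open>G ?Q\<close> is a zero object like
      \<open>M\<close>.\<close>
    have e0: "e ?Q = 0" using rank_0 True Q by blast
    note mG = bp_in[OF G_bp[OF Q]]
    have "\<eta> ?Q = 0" using e_right[OF eta_in[OF Q]] e0 by simp
    then have "\<tau> * e (\<Phi> ?Q) = 0" using eta_xi[OF Q] by simp
    then have "e (\<Phi> ?Q) = 0" by (rule tau_cancel)
    then have "gp ?Q = 0" "gq ?Q = 0" using e_left[OF mG(3)] e_left[OF mG(4)] e0 by auto
    then have "e (U (G ?Q)) = 0" using G_bp[OF Q] by (simp add: bp_def)
    then have "iso_in mfc M (G ?Q) 0"
      using e0 M G_MO[OF Q] M.zero_in by (auto simp: iso_in_def intro!: bexI[of _ 0])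
    then show ?thesis using Q by (auto simp: isomorphic_in_def)
  next
    case False
    then obtain V L F s B h where V: "V \<in> Ob" and b: "M.bp (G V) L M F s B h" and rk: "rank (U L) < rank ?Q"
      using G_summand[OF less.prems] by blast
    note mb = M.bp_in[OF b]
    have "projective_object mfc mfe L"
      by (rule retract_projective[OF less.prems mb(2,4) M.bp_eq(2)[OF b]])
    then obtain W k where W: "W \<in> Ob" and k: "iso_in mfc L (G W) k"
      using less.hyps[OF rk] by (auto simp: isomorphic_in_def)
    obtain k' where kk: "k \<in> mh L (G W)" "k' \<in> mh (G W) L" "k' * k = e (U L)" "k * k' = e (U (G W))"
      using k by (auto simp: iso_in_def)
    \<comment> \<open>The summand \<open>G V\<close> and the complement, isomorphic to
      \<open>G W\<close>, combine into a single \<open>G S\<close>.\<close>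
    obtain S i0 j0 p0 q0 where S: "bp V W S i0 j0 p0 q0" using ex_bp V W by blast
    obtain i j p q where c: "M.bp (G V) (G W) (G S) i j p q" using G_additive[OF S] by blast
    note m = mb M.bp_in[OF c] kk(1,2)
    note E = M.bp_eq[OF b, THEN mult_eq_assoc] M.bp_eq[OF c, THEN mult_eq_assoc] kk(3,4)[THEN mult_eq_assoc]
    have "iso_in mfc M (G S) (i * B + j * k * h)"
      unfolding iso_in_def mfc_simps
    proof (intro conjI bexI)
      show "(F * p + s * k' * q) * (i * B + j * k * h) = e (U M)"
        by (simp add: algebra_simps E m[THEN M.unit_simps])
      show "(i * B + j * k * h) * (F * p + s * k' * q) = e (U (G S))"
        by (simp add: algebra_simps E m[THEN M.unit_simps])
      show "i * B + j * k * h \<in> mh M (G S)" "F * p + s * k' * q \<in> mh (G S) M"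
        by (rule m M.add_in M.mult_in)+
    qed (use M G_MO bp_ob[OF S] in auto)
    then show ?thesis using bp_ob[OF S] by (auto simp: isomorphic_in_def)
  qed
qed

end

section \<open>Isomorphisms of exact categories\<close>

text \<open>The identity on objects and an additive bijection on hom-sets, under which
  \<open>E\<close> is the preimage of \<open>E'\<close>. For \<open>C\<close> only closure of the
  hom-sets is assumed; its unit, associativity and distributivity laws are pulled back from
  \<open>C'\<close>.\<close>

locale cat_iso =
  fixes C :: "('o, 'm::ab_group_add, 'y) cat_scheme" and C' :: "('o, 'n::ab_group_add, 'z) cat_scheme"
    and \<rho> :: "'o \<Rightarrow> 'o \<Rightarrow> 'm \<Rightarrow> 'n"
    and E :: "('o, 'm) conflations" and E' :: "('o, 'n) conflations"
  assumes ob_eq: "ob C' = ob C"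
    and bij: "\<lbrakk>A \<in> ob C; B \<in> ob C\<rbrakk> \<Longrightarrow> bij_betw (\<rho> A B) (hm C A B) (hm C' A B)"
    and add_closed: "\<lbrakk>A \<in> ob C; B \<in> ob C; f \<in> hm C A B; g \<in> hm C A B\<rbrakk> \<Longrightarrow> f + g \<in> hm C A B"
    and uminus_closed: "\<lbrakk>A \<in> ob C; B \<in> ob C; f \<in> hm C A B\<rbrakk> \<Longrightarrow> - f \<in> hm C A B"
    and zero_closed: "\<lbrakk>A \<in> ob C; B \<in> ob C\<rbrakk> \<Longrightarrow> 0 \<in> hm C A B"
    and cmp_closed: "\<lbrakk>A \<in> ob C; B \<in> ob C; D \<in> ob C; f \<in> hm C A B; g \<in> hm C B D\<rbrakk> \<Longrightarrow> cmp C A B D g f \<in> hm C A D"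
    and idn_closed: "A \<in> ob C \<Longrightarrow> idn C A \<in> hm C A A"
    and \<rho>_add: "\<lbrakk>A \<in> ob C; B \<in> ob C; f \<in> hm C A B; g \<in> hm C A B\<rbrakk> \<Longrightarrow> \<rho> A B (f + g) = \<rho> A B f + \<rho> A B g"
    and \<rho>_cmp: "\<lbrakk>A \<in> ob C; B \<in> ob C; D \<in> ob C; f \<in> hm C A B; g \<in> hm C B D\<rbrakk>
      \<Longrightarrow> \<rho> A D (cmp C A B D g f) = cmp C' A B D (\<rho> B D g) (\<rho> A B f)"
    and \<rho>_idn: "A \<in> ob C \<Longrightarrow> \<rho> A A (idn C A) = idn C' A"
    and E_iff: "E A f B g D \<longleftrightarrow> A \<in> ob C \<and> B \<in> ob C \<and> D \<in> ob C \<and> f \<in> hm C A B \<and> g \<in> hm C B D \<and>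
      E' A (\<rho> A B f) B (\<rho> B D g) D"
begin

lemma \<rho>_in: "\<lbrakk>A \<in> ob C; B \<in> ob C; f \<in> hm C A B\<rbrakk> \<Longrightarrow> \<rho> A B f \<in> hm C' A B"
  using bij by (meson bij_betwE)

lemma \<rho>_eq: "\<lbrakk>A \<in> ob C; B \<in> ob C; f \<in> hm C A B; g \<in> hm C A B\<rbrakk> \<Longrightarrow> \<rho> A B f = \<rho> A B g \<longleftrightarrow> f = g"
  using bij[of A B] by (auto simp: bij_betw_def inj_on_def)

lemma \<rho>_surj: "\<lbrakk>A \<in> ob C; B \<in> ob C; f' \<in> hm C' A B\<rbrakk> \<Longrightarrow> \<exists>f\<in>hm C A B. f' = \<rho> A B f"
  using bij[of A B] by (auto simp: bij_betw_def)

lemma \<rho>_0: assumes "A \<in> ob C" "B \<in> ob C" shows "\<rho> A B 0 = 0"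
  using \<rho>_add[OF assms zero_closed[OF assms] zero_closed[OF assms]] by simp

lemma \<rho>_eq_0: "\<lbrakk>A \<in> ob C; B \<in> ob C; f \<in> hm C A B\<rbrakk> \<Longrightarrow> \<rho> A B f = 0 \<longleftrightarrow> f = 0"
  using \<rho>_eq[of A B f 0] zero_closed \<rho>_0 by simp

lemma \<rho>_ball: "\<lbrakk>A \<in> ob C; B \<in> ob C\<rbrakk> \<Longrightarrow> (\<forall>h\<in>hm C' A B. P h) \<longleftrightarrow> (\<forall>h\<in>hm C A B. P (\<rho> A B h))"
  using \<rho>_surj \<rho>_in by metis

lemma \<rho>_bex: "\<lbrakk>A \<in> ob C; B \<in> ob C\<rbrakk> \<Longrightarrow> (\<exists>h\<in>hm C' A B. P h) \<longleftrightarrow> (\<exists>h\<in>hm C A B. P (\<rho> A B h))"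
  using \<rho>_surj \<rho>_in by metis

lemma \<rho>_ex1:
  assumes "A \<in> ob C" "B \<in> ob C"
  shows "(\<exists>!h. h \<in> hm C' A B \<and> P h) \<longleftrightarrow> (\<exists>!h. h \<in> hm C A B \<and> P (\<rho> A B h))"
proof
  assume "\<exists>!h. h \<in> hm C' A B \<and> P h"
  then obtain h where h: "h \<in> hm C' A B" "P h" "\<And>k. k \<in> hm C' A B \<Longrightarrow> P k \<Longrightarrow> k = h" by blast
  then obtain h0 where "h0 \<in> hm C A B" "h = \<rho> A B h0" using \<rho>_surj[OF assms] by blast
  then show "\<exists>!h. h \<in> hm C A B \<and> P (\<rho> A B h)"
    using h \<rho>_in[OF assms] \<rho>_eq[OF assms] by (intro ex1I[of _ h0]) blast+
next
  assume "\<exists>!h. h \<in> hm C A B \<and> P (\<rho> A B h)"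
  then obtain h where h: "h \<in> hm C A B" "P (\<rho> A B h)"
    "\<And>k. k \<in> hm C A B \<Longrightarrow> P (\<rho> A B k) \<Longrightarrow> k = h" by blast
  then show "\<exists>!h. h \<in> hm C' A B \<and> P h"
    using \<rho>_in[OF assms] \<rho>_surj[OF assms] by (intro ex1I[of _ "\<rho> A B h"]) blast+
qed

text \<open>Turns a statement about \<open>C'\<close> into the same statement about
  \<open>C\<close>: quantifiers move along the bijection, and \<rho> is pulled outwards through
  composites until injectivity removes it.\<close>

lemmas \<rho>_simps = ob_eq \<rho>_in \<rho>_ball \<rho>_bex \<rho>_ex1 \<rho>_cmp[symmetric] \<rho>_eq \<rho>_eq_0 \<rho>_idn[symmetric] \<rho>_add[symmetric]
  add_closed cmp_closed idn_closed zero_closed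

section \<open>Invariance of the categorical notions\<close>

lemma iso_in_iff:
  assumes "A \<in> ob C" "B \<in> ob C" "f \<in> hm C A B"
  shows "iso_in C' A B (\<rho> A B f) \<longleftrightarrow> iso_in C A B f"
  using assms unfolding iso_in_def by (simp add: \<rho>_simps cong: bex_cong)

lemma is_kernel_iff:
  assumes "A \<in> ob C" "B \<in> ob C" "D \<in> ob C" "f \<in> hm C A B" "g \<in> hm C B D"
  shows "is_kernel C' A (\<rho> A B f) B (\<rho> B D g) D \<longleftrightarrow> is_kernel C A f B g D"
  using assms unfolding is_kernel_def by (simp add: \<rho>_simps cong: ball_cong conj_cong)

lemma is_cokernel_iff:
  assumes "A \<in> ob C" "B \<in> ob C" "D \<in> ob C" "f \<in> hm C A B" "g \<in> hm C B D"
  shows "is_cokernel C' A (\<rho> A B f) B (\<rho> B D g) D \<longleftrightarrow> is_cokernel C A f B g D"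
  using assms unfolding is_cokernel_def by (simp add: \<rho>_simps cong: ball_cong conj_cong)

lemma is_pushout_iff:
  assumes "A \<in> ob C" "B \<in> ob C" "A' \<in> ob C" "B' \<in> ob C"
    and "f \<in> hm C A B" "a \<in> hm C A A'" "f' \<in> hm C A' B'" "b \<in> hm C B B'"
  shows "is_pushout C' A (\<rho> A B f) B (\<rho> A A' a) A' (\<rho> A' B' f') B' (\<rho> B B' b)
    \<longleftrightarrow> is_pushout C A f B a A' f' B' b"
  using assms unfolding is_pushout_def by (simp add: \<rho>_simps cong: ball_cong conj_cong)

lemma is_pullback_iff:
  assumes "B \<in> ob C" "D \<in> ob C" "B' \<in> ob C" "D' \<in> ob C"
    and "g \<in> hm C B D" "g' \<in> hm C B' D'" "b \<in> hm C B' B" "d \<in> hm C D' D"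
  shows "is_pullback C' B (\<rho> B D g) D B' (\<rho> B' D' g') D' (\<rho> B' B b) (\<rho> D' D d)
    \<longleftrightarrow> is_pullback C B g D B' g' D' b d"
  using assms unfolding is_pullback_def by (simp add: \<rho>_simps cong: ball_cong conj_cong)

lemma isomorphic_in_iff:
  assumes "A \<in> ob C" "B \<in> ob C"
  shows "isomorphic_in C' A B \<longleftrightarrow> isomorphic_in C A B"
  using assms iso_in_iff \<rho>_surj unfolding isomorphic_in_def by (metis iso_in_def)

lemma biproduct_iff:
  assumes "A \<in> ob C" "B \<in> ob C" "S \<in> ob C" "i \<in> hm C A S" "j \<in> hm C B S" "p \<in> hm C S A" "q \<in> hm C S B"
  shows "biproduct C' A B S (\<rho> A S i) (\<rho> B S j) (\<rho> S A p) (\<rho> S B q) \<longleftrightarrow> biproduct C A B S i j p q"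
  using assms unfolding biproduct_def by (simp add: \<rho>_simps)

lemma zero_object_iff: "zero_object C' Z \<longleftrightarrow> zero_object C Z"
  unfolding zero_object_def using \<rho>_ex1[of _ _ "\<lambda>_. True"] by (simp add: ob_eq cong: conj_cong ball_cong)

lemma additive:
  assumes "additive_category C'" shows "additive_category C"
proof -
  interpret C': additive_category C' by fact
  show ?thesis
  proof
    fix A B f assume *: "A \<in> ob C" "B \<in> ob C" "f \<in> hm C A B"
    show "cmp C A A B f (idn C A) = f"
      using * C'.cmp_idn[of A B "\<rho> A B f"] by (simp add: \<rho>_simps)
    show "cmp C A B B (idn C B) f = f"
      using * C'.idn_cmp[of A B "\<rho> A B f"] by (simp add: \<rho>_simps)
  next
    fix A B D K f g h
    assume *: "A \<in> ob C" "B \<in> ob C" "D \<in> ob C" "K \<in> ob C" "f \<in> hm C A B" "g \<in> hm C B D" "h \<in> hm C D K"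
    show "cmp C A D K h (cmp C A B D g f) = cmp C A B K (cmp C B D K h g) f"
      using * C'.cmp_assoc[of A B D K "\<rho> A B f" "\<rho> B D g" "\<rho> D K h"] by (simp add: \<rho>_simps)
  next
    fix A B D f g h
    assume *: "A \<in> ob C" "B \<in> ob C" "D \<in> ob C" "f \<in> hm C A B" "g \<in> hm C B D" "h \<in> hm C B D"
    show "cmp C A B D (g + h) f = cmp C A B D g f + cmp C A B D h f"
      using * C'.cmp_add_left[of A B D "\<rho> A B f" "\<rho> B D g" "\<rho> B D h"] by (simp add: \<rho>_simps)
  next
    fix A B D f g h
    assume *: "A \<in> ob C" "B \<in> ob C" "D \<in> ob C" "f \<in> hm C A B" "g \<in> hm C A B" "h \<in> hm C B D"
    show "cmp C A B D h (f + g) = cmp C A B D h f + cmp C A B D h g"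
      using * C'.cmp_add_right[of A B D "\<rho> A B f" "\<rho> A B g" "\<rho> B D h"] by (simp add: \<rho>_simps)
  next
    show "\<exists>Z. zero_object C Z" using C'.ex_zero_object by (simp add: zero_object_iff)
  next
    fix A B assume *: "A \<in> ob C" "B \<in> ob C"
    then obtain S i j p q where b: "biproduct C' A B S i j p q" using C'.ex_biproduct[of A B] unfolding ob_eq by blast
    then have S: "S \<in> ob C" by (simp add: biproduct_def ob_eq)
    obtain i0 j0 p0 q0 where "i0 \<in> hm C A S" "j0 \<in> hm C B S" "p0 \<in> hm C S A" "q0 \<in> hm C S B"
      "i = \<rho> A S i0" "j = \<rho> B S j0" "p = \<rho> S A p0" "q = \<rho> S B q0"
      using b \<rho>_surj * S unfolding biproduct_def by metis
    then show "\<exists>S i j p q. biproduct C A B S i j p q" using b biproduct_iff * S by metis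
  qed (use add_closed uminus_closed zero_closed cmp_closed idn_closed in auto)
qed

section \<open>Transport of exact structures, projectives and injectives\<close>

lemma inflation_in: "inflation E A B f \<Longrightarrow> A \<in> ob C \<and> B \<in> ob C \<and> f \<in> hm C A B"
  and deflation_in: "deflation E A B f \<Longrightarrow> A \<in> ob C \<and> B \<in> ob C \<and> f \<in> hm C A B"
  by (auto simp: inflation_def deflation_def E_iff)

context
  assumes exact': "exact_category C' E'"
begin

interpretation C': exact_category C' E' by (rule exact')

text \<open>The second half of a conflation over \<open>C'\<close> belongs to a hom-set because
  conflations are kernels there, so it comes from \<open>C\<close> by surjectivity of
  \<rho>.\<close>

lemma inflation_iff:
  assumes "A \<in> ob C" "B \<in> ob C" "f \<in> hm C A B"
  shows "inflation E' A B (\<rho> A B f) \<longleftrightarrow> inflation E A B f"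
proof
  assume "inflation E' A B (\<rho> A B f)"
  then obtain D g where g: "E' A (\<rho> A B f) B g D" by (auto simp: inflation_def)
  then have "D \<in> ob C" "g \<in> hm C' B D" using C'.conflation_kernel by (auto simp: is_kernel_def ob_eq)
  then show "inflation E A B f" using g assms \<rho>_surj unfolding inflation_def E_iff by metis
qed (auto simp: inflation_def E_iff)

lemma deflation_iff:
  assumes "A \<in> ob C" "B \<in> ob C" "f \<in> hm C A B"
  shows "deflation E' A B (\<rho> A B f) \<longleftrightarrow> deflation E A B f"
proof
  assume "deflation E' A B (\<rho> A B f)"
  then obtain D g where g: "E' D g A (\<rho> A B f) B" by (auto simp: deflation_def)
  then have "D \<in> ob C" "g \<in> hm C' D A" using C'.conflation_kernel by (auto simp: is_kernel_def ob_eq)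
  then show "deflation E A B f" using g assms \<rho>_surj unfolding deflation_def E_iff by metis
qed (auto simp: deflation_def E_iff)

lemma inflation'_obj: "inflation E' A B f \<Longrightarrow> A \<in> ob C \<and> B \<in> ob C \<and> f \<in> hm C' A B"
  unfolding inflation_def using C'.conflation_kernel ob_eq by (metis is_kernel_def)

lemma deflation'_obj: "deflation E' A B f \<Longrightarrow> A \<in> ob C \<and> B \<in> ob C \<and> f \<in> hm C' A B"
  unfolding deflation_def using C'.conflation_kernel ob_eq by (metis is_kernel_def)

lemma inflation'E:
  assumes "inflation E' A B f'"
  obtains f where "A \<in> ob C" "B \<in> ob C" "f \<in> hm C A B" "f' = \<rho> A B f" "inflation E A B f"
proof -
  have o: "A \<in> ob C" "B \<in> ob C" "f' \<in> hm C' A B" using inflation'_obj[OF assms] by auto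
  then obtain f where f: "f \<in> hm C A B" "f' = \<rho> A B f" using \<rho>_surj by blast
  show thesis using that[of f] f o inflation_iff[OF o(1,2) f(1)] assms by simp
qed

lemma deflation'E:
  assumes "deflation E' A B f'"
  obtains f where "A \<in> ob C" "B \<in> ob C" "f \<in> hm C A B" "f' = \<rho> A B f" "deflation E A B f"
proof -
  have o: "A \<in> ob C" "B \<in> ob C" "f' \<in> hm C' A B" using deflation'_obj[OF assms] by auto
  then obtain f where f: "f \<in> hm C A B" "f' = \<rho> A B f" using \<rho>_surj by blast
  show thesis using that[of f] f o deflation_iff[OF o(1,2) f(1)] assms by simp
qed

lemma exact: "exact_category C E"
proof -
  interpret additive_category C by (rule additive) unfold_locales
  show ?thesis
  proof
    fix A f B g D assume "E A f B g D"
    then show "is_kernel C A f B g D" "is_cokernel C A f B g D"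
      using C'.conflation_kernel C'.conflation_cokernel is_kernel_iff is_cokernel_iff by (metis E_iff)+
  next
    fix A f B g D A' a B' b D' d f' g'
    assume *: "E A f B g D" "iso_in C A A' a" "iso_in C B B' b" "iso_in C D D' d"
      "f' \<in> hm C A' B'" "g' \<in> hm C B' D'"
      "cmp C A B B' b f = cmp C A A' B' f' a" "cmp C B D D' d g = cmp C B B' D' g' b"
    have o: "A \<in> ob C" "B \<in> ob C" "D \<in> ob C" "A' \<in> ob C" "B' \<in> ob C" "D' \<in> ob C"
      "a \<in> hm C A A'" "b \<in> hm C B B'" "d \<in> hm C D D'" "f \<in> hm C A B" "g \<in> hm C B D"
      using * by (auto simp: iso_in_def E_iff)
    have "E' A' (\<rho> A' B' f') B' (\<rho> B' D' g') D'"
      by (rule C'.conflation_iso[where a = "\<rho> A A' a" and b = "\<rho> B B' b" and d = "\<rho> D D' d"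
        and f = "\<rho> A B f" and g = "\<rho> B D g"]) (use * o iso_in_iff in \<open>auto simp: \<rho>_simps E_iff\<close>)
    then show "E A' f' B' g' D'" using * o by (simp add: E_iff)
  next
    fix A assume A: "A \<in> ob C"
    show "inflation E A A (idn C A)" "deflation E A A (idn C A)"
      using A C'.inflation_idn[of A] C'.deflation_idn[of A] inflation_iff[of A A "idn C A"] deflation_iff[of A A "idn C A"]
      by (auto simp: \<rho>_simps)
  next
    fix A B f D g assume *: "inflation E A B f" "inflation E B D g"
    note o = *[THEN inflation_in]
    show "inflation E A D (cmp C A B D g f)"
      using o * C'.inflation_cmp[of A B "\<rho> A B f" D "\<rho> B D g"] inflation_iff by (simp add: \<rho>_simps)
  next
    fix A B f D g assume *: "deflation E A B f" "deflation E B D g"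
    note o = *[THEN deflation_in]
    show "deflation E A D (cmp C A B D g f)"
      using o * C'.deflation_cmp[of A B "\<rho> A B f" D "\<rho> B D g"] deflation_iff by (simp add: \<rho>_simps)
  next
    fix A B f A' a assume *: "inflation E A B f" "A' \<in> ob C" "a \<in> hm C A A'"
    note o = inflation_in[OF *(1)]
    obtain B' f' b where b: "is_pushout C' A (\<rho> A B f) B (\<rho> A A' a) A' f' B' b" "inflation E' A' B' f'"
      using C'.inflation_pushout[of A B "\<rho> A B f" A' "\<rho> A A' a"] o * inflation_iff \<rho>_in unfolding ob_eq by blast
    then have o': "B' \<in> ob C" "f' \<in> hm C' A' B'" "b \<in> hm C' B B'" by (auto simp: is_pushout_def ob_eq)
    then obtain f0 b0 where "f0 \<in> hm C A' B'" "b0 \<in> hm C B B'" "f' = \<rho> A' B' f0" "b = \<rho> B B' b0"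
      using \<rho>_surj o * by metis
    then show "\<exists>B' f' b. is_pushout C A f B a A' f' B' b \<and> inflation E A' B' f'"
      using b o o' * is_pushout_iff inflation_iff by metis
  next
    fix B D g D' d assume *: "deflation E B D g" "D' \<in> ob C" "d \<in> hm C D' D"
    note o = deflation_in[OF *(1)]
    obtain B' g' b where b: "is_pullback C' B (\<rho> B D g) D B' g' D' b (\<rho> D' D d)" "deflation E' B' D' g'"
      using C'.deflation_pullback[of B D "\<rho> B D g" D' "\<rho> D' D d"] o * deflation_iff \<rho>_in unfolding ob_eq by blast
    then have o': "B' \<in> ob C" "g' \<in> hm C' B' D'" "b \<in> hm C' B' B" by (auto simp: is_pullback_def ob_eq)
    then obtain g0 b0 where "g0 \<in> hm C B' D'" "b0 \<in> hm C B' B" "g' = \<rho> B' D' g0" "b = \<rho> B' B b0"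
      using \<rho>_surj o * by metis
    then show "\<exists>B' g' b. is_pullback C B g D B' g' D' b d \<and> deflation E B' D' g'"
      using b o o' * is_pullback_iff deflation_iff by metis
  qed
qed

lemma projective_iff: "projective_object C' E' P \<longleftrightarrow> projective_object C E P"
proof
  assume P: "projective_object C' E' P"
  then have "P \<in> ob C" by (simp add: projective_object_def ob_eq)
  moreover have "\<exists>k\<in>hm C P B. cmp C P B D g k = h" if "deflation E B D g" "h \<in> hm C P D" for B D g h
  proof -
    note o = deflation_in[OF that(1)]
    have "\<exists>k\<in>hm C' P B. cmp C' P B D (\<rho> B D g) k = \<rho> P D h"
      using P o that deflation_iff \<open>P \<in> ob C\<close> unfolding projective_object_def by (meson \<rho>_in)
    then show ?thesis using o that \<open>P \<in> ob C\<close> by (simp add: \<rho>_simps cong: bex_cong)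
  qed
  ultimately show "projective_object C E P" by (auto simp: projective_object_def)
next
  assume P: "projective_object C E P"
  then have "P \<in> ob C" by (simp add: projective_object_def)
  moreover have "\<exists>k\<in>hm C' P B. cmp C' P B D g k = h" if t: "deflation E' B D g" "h \<in> hm C' P D" for B D g h
  proof -
    obtain g0 where o: "B \<in> ob C" "D \<in> ob C" and g0: "g0 \<in> hm C B D" "g = \<rho> B D g0" "deflation E B D g0"
      using deflation'E[OF t(1)] by blast
    obtain h0 where h0: "h0 \<in> hm C P D" "h = \<rho> P D h0"
      using \<rho>_surj[OF \<open>P \<in> ob C\<close> o(2) t(2)] by blast
    note 0 = g0 h0
    have "\<exists>k\<in>hm C P B. cmp C P B D g0 k = h0"
      using P g0(3) h0(1) unfolding projective_object_def by blast
    then show ?thesis using o 0 \<open>P \<in> ob C\<close> by (simp add: \<rho>_simps cong: bex_cong)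
  qed
  ultimately show "projective_object C' E' P" by (auto simp: projective_object_def ob_eq)
qed

lemma injective_iff: "injective_object C' E' P \<longleftrightarrow> injective_object C E P"
proof
  assume P: "injective_object C' E' P"
  then have "P \<in> ob C" by (simp add: injective_object_def ob_eq)
  moreover have "\<exists>k\<in>hm C B P. cmp C A B P k f = h" if "inflation E A B f" "h \<in> hm C A P" for A B f h
  proof -
    note o = inflation_in[OF that(1)]
    have "\<exists>k\<in>hm C' B P. cmp C' A B P k (\<rho> A B f) = \<rho> A P h"
      using P o that inflation_iff \<open>P \<in> ob C\<close> unfolding injective_object_def by (meson \<rho>_in)
    then show ?thesis using o that \<open>P \<in> ob C\<close> by (simp add: \<rho>_simps cong: bex_cong)
  qed
  ultimately show "injective_object C E P" by (auto simp: injective_object_def)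
next
  assume P: "injective_object C E P"
  then have "P \<in> ob C" by (simp add: injective_object_def)
  moreover have "\<exists>k\<in>hm C' B P. cmp C' A B P k f = h" if t: "inflation E' A B f" "h \<in> hm C' A P" for A B f h
  proof -
    obtain f0 where o: "A \<in> ob C" "B \<in> ob C" and f0: "f0 \<in> hm C A B" "f = \<rho> A B f0" "inflation E A B f0"
      using inflation'E[OF t(1)] by blast
    obtain h0 where h0: "h0 \<in> hm C A P" "h = \<rho> A P h0"
      using \<rho>_surj[OF o(1) \<open>P \<in> ob C\<close> t(2)] by blast
    note 0 = f0 h0
    have "\<exists>k\<in>hm C B P. cmp C A B P k f0 = h0"
      using P f0(3) h0(1) unfolding injective_object_def by blast
    then show ?thesis using o 0 \<open>P \<in> ob C\<close> by (simp add: \<rho>_simps cong: bex_cong)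
  qed
  ultimately show "injective_object C' E' P" by (auto simp: injective_object_def ob_eq)
qed

end

lemma frobenius:
  assumes "frobenius_category C' E'" shows "frobenius_category C E"
proof -
  interpret C': frobenius_category C' E' by fact
  have ex: "exact_category C' E'" ..
  interpret exact_category C E by (rule exact[OF ex])
  show ?thesis
  proof
    fix D assume "D \<in> ob C"
    then obtain P g where g: "projective_object C' E' P" "deflation E' P D g"
      using C'.enough_projectives unfolding ob_eq by blast
    then show "\<exists>P g. projective_object C E P \<and> deflation E P D g"
      using deflation'E[OF ex g(2)] projective_iff[OF ex] by metis
  next
    fix A assume "A \<in> ob C"
    then obtain I f where f: "injective_object C' E' I" "inflation E' A I f"
      using C'.enough_injectives unfolding ob_eq by blast
    then show "\<exists>I f. injective_object C E I \<and> inflation E A I f"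
      using inflation'E[OF ex f(2)] injective_iff[OF ex] by metis
  qed (use C'.projective_iff_injective projective_iff[OF ex] injective_iff[OF ex] in metis)
qed

end

section \<open>The cocycle of an admissible automorphism\<close>

locale covering =
  fixes X :: "'x set" and Y :: "'y set" and le :: "'y \<Rightarrow> 'y \<Rightarrow> bool" and \<pi> :: "'y \<Rightarrow> 'x" and \<sigma> :: "'y \<Rightarrow> 'y"
  assumes cover: "covering_poset X Y le \<pi> \<sigma>"
begin

lemmas cover_parts =
  cover[unfolded covering_poset_def, THEN conjunct1]
  cover[unfolded covering_poset_def, THEN conjunct2, THEN conjunct1]
  cover[unfolded covering_poset_def, THEN conjunct2, THEN conjunct2, THEN conjunct1]
  cover[unfolded covering_poset_def, THEN conjunct2, THEN conjunct2, THEN conjunct2, THEN conjunct1]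
  cover[unfolded covering_poset_def, THEN conjunct2, THEN conjunct2, THEN conjunct2, THEN conjunct2, THEN conjunct1]
  cover[unfolded covering_poset_def, THEN conjunct2, THEN conjunct2, THEN conjunct2, THEN conjunct2, THEN conjunct2, THEN conjunct1]
  cover[unfolded covering_poset_def, THEN conjunct2, THEN conjunct2, THEN conjunct2, THEN conjunct2, THEN conjunct2, THEN conjunct2, THEN conjunct1]
  cover[unfolded covering_poset_def, THEN conjunct2, THEN conjunct2, THEN conjunct2, THEN conjunct2, THEN conjunct2, THEN conjunct2, THEN conjunct2]

lemma le_refl: "x \<in> Y \<Longrightarrow> le x x"
  using cover_parts(1) by blast

lemma le_trans: "\<lbrakk>x \<in> Y; y \<in> Y; z \<in> Y; le x y; le y z\<rbrakk> \<Longrightarrow> le x z"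
  using cover_parts(2) by blast

lemma bij_\<sigma>: "bij_betw \<sigma> Y Y"
  by (rule cover_parts(5))

lemma \<sigma>_in: "x \<in> Y \<Longrightarrow> \<sigma> x \<in> Y"
  using bij_\<sigma> by (rule bij_betw_apply)

lemma le_\<sigma>: "\<lbrakk>x \<in> Y; y \<in> Y\<rbrakk> \<Longrightarrow> le (\<sigma> x) (\<sigma> y) \<longleftrightarrow> le x y"
  using cover_parts(6) by blast

lemma \<pi>_\<sigma>: "x \<in> Y \<Longrightarrow> \<pi> (\<sigma> x) = \<pi> x"
  and less_\<sigma>: "x \<in> Y \<Longrightarrow> le x (\<sigma> x) \<and> \<not> le (\<sigma> x) x"
  and \<sigma>_least: "\<lbrakk>x \<in> Y; y \<in> Y; \<pi> y = \<pi> x; strict le x y\<rbrakk> \<Longrightarrow> le (\<sigma> x) y"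
  using cover_parts(7) unfolding strict_def fibre_def by blast+

lemma cofinal: "\<lbrakk>x \<in> Y; y \<in> Y\<rbrakk> \<Longrightarrow> \<exists>m. le x ((\<sigma> ^^ m) y)"
  using cover_parts(8) by blast

lemma \<pi>_in: "x \<in> Y \<Longrightarrow> \<pi> x \<in> X"
  and \<pi>_surj: "a \<in> X \<Longrightarrow> \<exists>y\<in>Y. \<pi> y = a"
  using cover_parts(3) by auto

lemma fibre_int: "a \<in> X \<Longrightarrow> \<exists>h::int \<Rightarrow> 'y. bij_betw h UNIV (fibre Y \<pi> a) \<and> (\<forall>m n. le (h m) (h n) \<longleftrightarrow> m \<le> n)"
  using cover_parts(4) by blast

lemma pow_in: "x \<in> Y \<Longrightarrow> (\<sigma> ^^ k) x \<in> Y"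
  by (induction k) (auto intro: \<sigma>_in)

lemma le_pow: "\<lbrakk>x \<in> Y; y \<in> Y\<rbrakk> \<Longrightarrow> le ((\<sigma> ^^ k) x) ((\<sigma> ^^ k) y) \<longleftrightarrow> le x y"
  by (induction k) (auto simp: le_\<sigma> pow_in)

lemma le_pow_self: "x \<in> Y \<Longrightarrow> le x ((\<sigma> ^^ k) x)"
  by (induction k) (auto simp: le_refl intro: le_trans[OF _ pow_in \<sigma>_in[OF pow_in]] less_\<sigma>[THEN conjunct1] pow_in)

text \<open>\<open>shift_le u v m\<close> stands for \<open>u \<le> \<sigma>\<^sup>m v\<close>.\<close>

definition shift_le :: "'y \<Rightarrow> 'y \<Rightarrow> int \<Rightarrow> bool" where
  "shift_le u v m \<longleftrightarrow> le ((\<sigma> ^^ nat (- m)) u) ((\<sigma> ^^ nat m) v)"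

text \<open>Since \<sigma> preserves and reflects the order, only the difference of the two
  exponents matters. A negative shift of \<open>v\<close> is expressed as a positive shift of
  \<open>u\<close>.\<close>

lemma shift_leI:
  assumes "u \<in> Y" "v \<in> Y"
  shows "shift_le u v (int b - int a) \<longleftrightarrow> le ((\<sigma> ^^ a) u) ((\<sigma> ^^ b) v)"
proof (cases "a \<le> b")
  case True
  then have "(\<sigma> ^^ b) v = (\<sigma> ^^ a) ((\<sigma> ^^ (b - a)) v)" by (metis funpow_add le_add_diff_inverse o_apply)
  moreover have "nat (int b - int a) = b - a" "nat (- (int b - int a)) = 0" using True by auto
  ultimately show ?thesis using assms by (simp add: shift_le_def le_pow pow_in)
next
  case False
  then have "(\<sigma> ^^ a) u = (\<sigma> ^^ b) ((\<sigma> ^^ (a - b)) u)" by (metis funpow_add le_add_diff_inverse nle_le o_apply)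
  moreover have "nat (int b - int a) = 0" "nat (- (int b - int a)) = a - b" using False by auto
  ultimately show ?thesis using assms by (simp add: shift_le_def le_pow pow_in)
qed

lemma shift_le_trans:
  assumes "u \<in> Y" "v \<in> Y" "w \<in> Y" "shift_le u v m" "shift_le v w n"
  shows "shift_le u w (m + n)"
proof -
  \<comment> \<open>Large enough to make \<open>m + a\<close> and \<open>m + n + a\<close>
    nonnegative, so that all three comparisons are between natural powers of \<sigma>.\<close>
  define a where "a = nat (- m) + nat (- n)"
  have 1: "m = int (nat (m + int a)) - int a" "m + n = int (nat (m + n + int a)) - int a"
    "n = int (nat (m + n + int a)) - int (nat (m + int a))"
    by (auto simp: a_def)
  have "le ((\<sigma> ^^ a) u) ((\<sigma> ^^ nat (m + int a)) v)"
    using assms(4) shift_leI[OF assms(1,2), of "nat (m + int a)" a] 1(1) by simp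
  moreover have "le ((\<sigma> ^^ nat (m + int a)) v) ((\<sigma> ^^ nat (m + n + int a)) w)"
    using assms(5) shift_leI[OF assms(2,3), of "nat (m + n + int a)" "nat (m + int a)"] 1(3) by simp
  ultimately have "le ((\<sigma> ^^ a) u) ((\<sigma> ^^ nat (m + n + int a)) w)"
    using le_trans pow_in assms(1-3) by blast
  then show ?thesis using shift_leI[OF assms(1,3), of "nat (m + n + int a)" a] 1(2) by simp
qed

lemma shift_le_self: assumes "u \<in> Y" shows "shift_le u u m \<longleftrightarrow> 0 \<le> m"
proof (cases "0 \<le> m")
  case True
  then show ?thesis using assms by (simp add: shift_le_def le_pow_self)
next
  case False
  then obtain k where k: "nat (- m) = Suc k" by (metis gr0_implies_Suc neg_0_less_iff_less not_le zero_less_nat_eq)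
  have "\<not> le ((\<sigma> ^^ Suc k) u) u"
  proof
    assume *: "le ((\<sigma> ^^ Suc k) u) u"
    have "le (\<sigma> u) ((\<sigma> ^^ k) (\<sigma> u))" using le_pow_self \<sigma>_in assms by blast
    then have "le (\<sigma> u) ((\<sigma> ^^ Suc k) u)" by (simp add: funpow_swap1)
    then have "le (\<sigma> u) u" using le_trans * pow_in[OF assms, of "Suc k"] \<sigma>_in assms by blast
    then show False using less_\<sigma> assms by blast
  qed
  then show ?thesis using False k by (simp add: shift_le_def)
qed

definition gap :: "'y \<Rightarrow> 'y \<Rightarrow> int" where
  "gap u v = (LEAST m. shift_le u v m)"

text \<open>Cofinality from \<open>u\<close> to \<open>v\<close> provides some shift, and from
  \<open>v\<close> to \<open>u\<close> a lower bound: a smaller one would put \<open>u\<close> below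
  a negative shift of itself. So a least shift exists, and all larger ones work by
  transitivity.\<close>

lemma gap_le: assumes "u \<in> Y" "v \<in> Y" shows "shift_le u v m \<longleftrightarrow> gap u v \<le> m"
proof -
  obtain a b where "le u ((\<sigma> ^^ a) v)" "le v ((\<sigma> ^^ b) u)" using cofinal assms by metis
  then have a: "shift_le u v (int a)" and b: "shift_le v u (int b)" by (auto simp: shift_le_def)
  have low: "- int b \<le> m" if "shift_le u v m" for m
    using shift_le_trans[OF assms assms(1) that b] shift_le_self[OF assms(1)] by simp
  \<comment> \<open>The minimum is taken in the naturals, after moving the lower bound
    \<open>- b\<close> to 0.\<close>
  define k where "k = (LEAST k. shift_le u v (int k - int b))"
  have k: "shift_le u v (int k - int b)"
    unfolding k_def by (rule LeastI[of _ "a + b"]) (simp add: a)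
  have least: "int k - int b \<le> m" if m: "shift_le u v m" for m
  proof -
    have "shift_le u v (int (nat (m + int b)) - int b)" using low[OF m] m by simp
    then have "k \<le> nat (m + int b)" unfolding k_def by (rule Least_le)
    then show ?thesis using low[OF m] by linarith
  qed
  have g: "gap u v = int k - int b" unfolding gap_def using k least by (rule Least_equality)
  show ?thesis
  proof
    assume "gap u v \<le> m"
    then have "shift_le v v (m - gap u v)" using shift_le_self assms by simp
    then have "shift_le u v (gap u v + (m - gap u v))"
      using shift_le_trans[OF assms assms(2)] k g by metis
    then show "shift_le u v m" by simp
  qed (use least g in auto)
qed

lemma gap_eqI:
  assumes "u \<in> Y" "v \<in> Y" "\<And>m. shift_le u v m \<longleftrightarrow> k \<le> m" shows "gap u v = k"
  using assms gap_le[OF assms(1,2)] by (metis eq_iff)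

lemma gap_pow_left: assumes "u \<in> Y" "v \<in> Y" shows "gap ((\<sigma> ^^ k) u) v = gap u v + int k"
proof (rule gap_eqI)
  fix m
  have "shift_le ((\<sigma> ^^ k) u) v m \<longleftrightarrow> shift_le u v (int (nat m) - int (nat (- m) + k))"
    unfolding shift_leI[OF assms] by (simp add: shift_le_def funpow_add)
  also have "int (nat m) - int (nat (- m) + k) = m - int k" by auto
  finally show "shift_le ((\<sigma> ^^ k) u) v m \<longleftrightarrow> gap u v + int k \<le> m" unfolding gap_le[OF assms] by linarith
qed (use assms pow_in in auto)

lemma gap_pow_right: assumes "u \<in> Y" "v \<in> Y" shows "gap u ((\<sigma> ^^ k) v) = gap u v - int k"
proof (rule gap_eqI)
  fix m
  have "shift_le u ((\<sigma> ^^ k) v) m \<longleftrightarrow> shift_le u v (int (nat m + k) - int (nat (- m)))"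
    unfolding shift_leI[OF assms] by (simp add: shift_le_def funpow_add)
  also have "int (nat m + k) - int (nat (- m)) = m + int k" by auto
  finally show "shift_le u ((\<sigma> ^^ k) v) m \<longleftrightarrow> gap u v - int k \<le> m" unfolding gap_le[OF assms] by linarith
qed (use assms pow_in in auto)

lemma int_iterate_le:
  assumes "u \<in> Y" "v \<in> Y" shows "le u (int_iterate Y \<sigma> m v) \<longleftrightarrow> shift_le u v m"
proof (cases "0 \<le> m")
  case False
  have inv: "inv_into Y \<sigma> y \<in> Y \<and> \<sigma> (inv_into Y \<sigma> y) = y" if "y \<in> Y" for y
    using bij_\<sigma> that by (metis bij_betw_imp_surj_on f_inv_into_f inv_into_into)
  have "(inv_into Y \<sigma> ^^ n) v \<in> Y \<and> (\<sigma> ^^ n) ((inv_into Y \<sigma> ^^ n) v) = v" for n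
    by (induction n) (auto simp: assms inv funpow_swap1[of \<sigma>])
  then have "le u ((inv_into Y \<sigma> ^^ n) v) \<longleftrightarrow> le ((\<sigma> ^^ n) u) v" for n
    using le_pow[OF assms(1), of "(inv_into Y \<sigma> ^^ n) v" n] by simp
  then show ?thesis using False by (simp add: int_iterate_def shift_le_def)
qed (simp add: int_iterate_def shift_le_def)

lemma section_cochain_gap:
  assumes "l x \<in> Y" "l y \<in> Y" shows "section_cochain Y le \<sigma> l x y = gap (l x) (l y)"
  using int_iterate_le[OF assms] by (simp add: section_cochain_def gap_def)

text \<open>On a fibre, a copy of the integers, \<sigma> is the successor map; hence the fibre is a
  single \<sigma>-orbit.\<close>

lemma same_fibre:
  assumes "u \<in> Y" "v \<in> Y" "\<pi> u = \<pi> v"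
  shows "\<exists>k. u = (\<sigma> ^^ k) v \<or> v = (\<sigma> ^^ k) u"
proof -
  obtain h :: "int \<Rightarrow> 'y" where h: "bij_betw h UNIV (fibre Y \<pi> (\<pi> v))" "\<And>m n. le (h m) (h n) \<longleftrightarrow> m \<le> n"
    using fibre_int[OF \<pi>_in[OF assms(2)]] by blast
  have hY: "h n \<in> Y" "\<pi> (h n) = \<pi> v" for n using bij_betwE[OF h(1)] by (auto simp: fibre_def)
  have surj: "\<exists>n. y = h n" if "y \<in> Y" "\<pi> y = \<pi> v" for y
    using h(1) that unfolding bij_betw_def fibre_def by auto
  have step: "\<sigma> (h n) = h (n + 1)" for n
  proof -
    obtain k where k: "\<sigma> (h n) = h k" using surj \<sigma>_in hY \<pi>_\<sigma> by metis
    have "n < k" using less_\<sigma>[OF hY(1)[of n]] h(2) unfolding k by (metis not_le)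
    moreover have "le (\<sigma> (h n)) (h (n + 1))"
      by (rule \<sigma>_least) (auto simp: hY strict_def h(2))
    then have "k \<le> n + 1" unfolding k h(2) .
    ultimately show ?thesis using k by (metis add1_zle_eq order_antisym)
  qed
  have pow: "(\<sigma> ^^ k) (h n) = h (n + int k)" for k n
    by (induction k) (auto simp: step algebra_simps)
  obtain m n where mn: "u = h m" "v = h n" using surj assms by metis
  show ?thesis
  proof (cases "n \<le> m")
    case True
    then have "u = (\<sigma> ^^ nat (m - n)) v" unfolding mn pow by simp
    then show ?thesis by blast
  next
    case False
    then have "v = (\<sigma> ^^ nat (n - m)) u" unfolding mn pow by simp
    then show ?thesis by blast
  qed
qed

text \<open>The structure cocycle evaluated on arbitrary lifts instead of a section. Moving a lift
  by \<sigma> changes two gaps by amounts that cancel.\<close>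

definition gap_cocycle :: "'y \<Rightarrow> 'y \<Rightarrow> 'y \<Rightarrow> int" where
  "gap_cocycle u v w = gap v w - gap u w + gap u v"

lemma gap_cocycle_fibre:
  assumes "u \<in> Y" "v \<in> Y" "w \<in> Y" "u' \<in> Y" "v' \<in> Y" "w' \<in> Y" "\<pi> u' = \<pi> u" "\<pi> v' = \<pi> v" "\<pi> w' = \<pi> w"
  shows "gap_cocycle u v w = gap_cocycle u' v' w'"
proof -
  have "gap_cocycle u v w = gap_cocycle u' v w"
    using same_fibre[OF assms(1,4)] assms by (auto simp: gap_cocycle_def gap_pow_left)
  also have "\<dots> = gap_cocycle u' v' w"
    using same_fibre[OF assms(2,5)] assms by (auto simp: gap_cocycle_def gap_pow_left gap_pow_right)
  also have "\<dots> = gap_cocycle u' v' w'"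
    using same_fibre[OF assms(3,6)] assms by (auto simp: gap_cocycle_def gap_pow_right)
  finally show ?thesis .
qed

end

lemma covering_cocycle:
  assumes "covering_poset_of X c Y le \<pi> \<sigma>" "u \<in> Y" "v \<in> Y" "w \<in> Y"
  shows "int (c (\<pi> u) (\<pi> v) (\<pi> w)) = covering.gap_cocycle le \<sigma> u v w"
proof -
  obtain l where l: "covering_poset X Y le \<pi> \<sigma>" "\<forall>x\<in>X. l x \<in> fibre Y \<pi> x"
    "\<forall>x\<in>X. \<forall>y\<in>X. \<forall>z\<in>X. int (c x y z) = structure_cocycle Y le \<sigma> l x y z"
    using assms(1) by (auto simp: covering_poset_of_def)
  interpret covering X Y le \<pi> \<sigma> by standard (rule l)
  have lY: "l x \<in> Y \<and> \<pi> (l x) = x" if "x \<in> X" for x using l(2) that by (auto simp: fibre_def)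
  note X = \<pi>_in[OF assms(2)] \<pi>_in[OF assms(3)] \<pi>_in[OF assms(4)]
  have "int (c (\<pi> u) (\<pi> v) (\<pi> w)) = gap_cocycle (l (\<pi> u)) (l (\<pi> v)) (l (\<pi> w))"
    using l(3) X lY by (simp add: structure_cocycle_def gap_cocycle_def section_cochain_gap)
  also have "\<dots> = gap_cocycle u v w" by (rule gap_cocycle_fibre) (use lY X assms in auto)
  finally show ?thesis .
qed

text \<open>The lift \<open>f\<close> moves a point by less than one turn even when applied twice.
  So the gaps from \<open>u\<close> to \<open>f u\<close> and to \<open>f (f u)\<close> are 0 and
  the gap from \<open>f (f u)\<close> back to \<open>u\<close> is at most 1. For basic morphisms
  this means: \<open>\<eta>\<close> is natural, the composite of two consecutive
  \<open>\<eta>\<close> is basic, and t on x factors through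
  \<open>\<phi> (\<phi> x)\<close>.\<close>

lemma admissible_cocycle:
  assumes cov: "covering_poset_of X c Y le \<pi> \<sigma>" and adm: "admissible_automorphism X c Y le \<pi> \<sigma> \<phi>"
  shows "\<lbrakk>x \<in> X; y \<in> X\<rbrakk> \<Longrightarrow> c x y (\<phi> y) = c x (\<phi> x) (\<phi> y)"
    and "x \<in> X \<Longrightarrow> c x (\<phi> x) (\<phi> (\<phi> x)) = 0"
    and "x \<in> X \<Longrightarrow> c x (\<phi> (\<phi> x)) x \<le> 1"
proof -
  interpret covering X Y le \<pi> \<sigma> using cov by (simp add: covering_poset_of_def covering_def)
  note cc = covering_cocycle[OF cov]
  obtain f where f: "bij_betw f Y Y" "\<And>x y. \<lbrakk>x \<in> Y; y \<in> Y; le x y\<rbrakk> \<Longrightarrow> le (f x) (f y)"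
    "\<And>x. x \<in> Y \<Longrightarrow> \<pi> (f x) = \<phi> (\<pi> x)" "\<And>x. x \<in> Y \<Longrightarrow> f (\<sigma> x) = \<sigma> (f x)"
    "\<And>x. x \<in> Y \<Longrightarrow> le x (f x) \<and> le (f x) (f (f x)) \<and> strict le (f (f x)) (\<sigma> x)"
    using adm unfolding admissible_automorphism_def by blast
  have c_aut: "c (\<phi> x) (\<phi> y) (\<phi> z) = c x y z" if "x \<in> X" "y \<in> X" "z \<in> X" for x y z
    using adm that by (simp add: admissible_automorphism_def cyclic_poset_automorphism_def)
  have fY: "f x \<in> Y" if "x \<in> Y" for x using f(1) that by (meson bij_betwE)
  have f_pow: "f ((\<sigma> ^^ k) x) = (\<sigma> ^^ k) (f x)" if "x \<in> Y" for k x
    using that by (induction k) (auto simp: f(4) pow_in)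
  have gap_zero: "gap u v = 0" if "u \<in> Y" "v \<in> Y" "le u v" "\<not> le (\<sigma> u) v" for u v
  proof -
    have "shift_le u v 0" "\<not> shift_le u v (- 1)" using that by (auto simp: shift_le_def)
    then show ?thesis using gap_le[OF that(1,2)] by force
  qed
  have not_le: "\<not> le (\<sigma> x) (f x)" "\<not> le (\<sigma> x) (f (f x))" if "x \<in> Y" for x
    using f(5)[OF that] le_trans[of "\<sigma> x" "f x" "f (f x)"] fY \<sigma>_in that unfolding strict_def by blast+
  have gap_f: "gap x (f x) = 0" "gap x (f (f x)) = 0" if "x \<in> Y" for x
    using gap_zero not_le[OF that] f(5)[OF that] le_trans[of x "f x" "f (f x)"] fY that by blast+
  have gap_f_le: "gap (f u) (f v) \<le> gap u v" if "u \<in> Y" "v \<in> Y" for u v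
  proof -
    have "shift_le u v (gap u v)" using gap_le[OF that] by simp
    then have "shift_le (f u) (f v) (gap u v)"
      using f(2) pow_in that unfolding shift_le_def f_pow[OF that(1), symmetric] f_pow[OF that(2), symmetric] by blast
    then show ?thesis using gap_le fY that by blast
  qed
  have gap_self: "gap u u = 0" if "u \<in> Y" for u
    using that by (intro gap_eqI) (auto simp: shift_le_self)
  \<comment> \<open>Monotonicity of \<open>f\<close> gives only one inequality. The sum
    \<open>gap u v + gap v u\<close> is a value of \<open>c\<close>, hence invariant under \<phi>,
    and this forces equality in both directions.\<close>
  have gap_ff: "gap (f u) (f v) = gap u v" if "u \<in> Y" "v \<in> Y" for u v
  proof -
    have "gap_cocycle u v u = gap_cocycle (f u) (f v) (f u)"
      using cc[of u v u] cc[of "f u" "f v" "f u"] that fY f(3) c_aut \<pi>_in by simp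
    then show ?thesis
      using gap_f_le[OF that] gap_f_le[OF that(2,1)] gap_self that fY by (simp add: gap_cocycle_def)
  qed
  {
    fix x assume "x \<in> X"
    then obtain u where u: "u \<in> Y" "\<pi> u = x" using \<pi>_surj by blast
    have "int (c x (\<phi> x) (\<phi> (\<phi> x))) = gap_cocycle u (f u) (f (f u))"
      using cc[of u "f u" "f (f u)"] u fY f(3) by simp
    then show "c x (\<phi> x) (\<phi> (\<phi> x)) = 0" using gap_f u fY by (simp add: gap_cocycle_def)
    have "shift_le (f (f u)) u 1" using f(5) u unfolding shift_le_def strict_def by simp
    then have "gap (f (f u)) u \<le> 1" using gap_le u fY by blast
    moreover have "int (c x (\<phi> (\<phi> x)) x) = gap_cocycle u (f (f u)) u"
      using cc[of u "f (f u)" u] u fY f(3) by simp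
    ultimately show "c x (\<phi> (\<phi> x)) x \<le> 1" using gap_f gap_self u fY by (simp add: gap_cocycle_def)
    fix y assume "y \<in> X"
    then obtain v where v: "v \<in> Y" "\<pi> v = y" using \<pi>_surj by blast
    have "int (c x y (\<phi> y)) = gap_cocycle u v (f v)" "int (c x (\<phi> x) (\<phi> y)) = gap_cocycle u (f u) (f v)"
      using cc[of u v "f v"] cc[of u "f u" "f v"] u v fY f(3) by simp_all
    then show "c x y (\<phi> y) = c x (\<phi> x) (\<phi> y)" using gap_f gap_ff u v by (simp add: gap_cocycle_def)
  }
qed

section \<open>Discrete valuation rings\<close>

text \<open>For nonzero \<open>a\<close>, Zorn gives an ideal \<open>M\<close> maximal among those
  that contain \<open>a\<close> but not 1. It is prime and nonzero, so it is the unique such ideal,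
  the one generated by \<open>t\<close>.\<close>

lemma dvr_nonunit:
  fixes t a :: "'r::idom"
  assumes dvr: "discrete_valuation_ring TYPE('r)" and t: "uniformizer t" and a: "\<not> a dvd 1"
  shows "t dvd a"
proof (cases "a = 0")
  case False
  define F where "F = {I::'r set. ring_ideal I \<and> a \<in> I \<and> 1 \<notin> I}"
  have "range ((*) a) \<in> F"
    using a unfolding F_def ring_ideal_def
    by (auto simp: dvd_def image_iff distrib_left[symmetric] mult.left_commute intro: exI[of _ 0] exI[of _ 1])
  moreover have "\<Union>K \<in> F" if K: "K \<noteq> {}" "subset.chain F K" for K
  proof -
    have sub: "K \<subseteq> F" and ch: "\<And>I J. I \<in> K \<Longrightarrow> J \<in> K \<Longrightarrow> I \<subseteq> J \<or> J \<subseteq> I"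
      using K(2) by (auto simp: subset_chain_def)
    have "x + y \<in> \<Union>K" if xy: "x \<in> \<Union>K" "y \<in> \<Union>K" for x y
    proof -
      obtain I J where "I \<in> K" "J \<in> K" "x \<in> I" "y \<in> J" using xy by blast
      then obtain L where L: "L \<in> K" "x \<in> L" "y \<in> L" using ch by blast
      then have "x + y \<in> L" using sub by (auto simp: F_def ring_ideal_def)
      then show ?thesis using L by blast
    qed
    moreover have "r * x \<in> \<Union>K" if "x \<in> \<Union>K" for r x
      using that sub by (auto simp: F_def ring_ideal_def)
    ultimately show ?thesis using K(1) sub by (auto simp: F_def ring_ideal_def subset_iff)
  qed
  ultimately obtain M where M: "M \<in> F" "\<And>J. J \<in> F \<Longrightarrow> M \<subseteq> J \<Longrightarrow> J = M"
    using subset_Zorn_nonempty[of F] by blast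
  have Mi: "ring_ideal M" "a \<in> M" "1 \<notin> M" using M(1) by (auto simp: F_def)
  note id = Mi(1)[unfolded ring_ideal_def]
  have "x \<in> M \<or> y \<in> M" if xy: "x * y \<in> M" for x y
  proof (rule ccontr)
    assume "\<not> (x \<in> M \<or> y \<in> M)"
    then have nx: "x \<notin> M" and ny: "y \<notin> M" by auto
    \<comment> \<open>The ideal generated by \<open>M\<close> and \<open>x\<close> contains 1 by
      maximality; multiplying that relation by \<open>y\<close> puts \<open>y\<close> into
      \<open>M\<close>.\<close>
    define J where "J = {m + r * x | m r. m \<in> M}"
    have "ring_ideal J"
      unfolding ring_ideal_def
    proof (intro conjI ballI allI)
      show "0 \<in> J" unfolding J_def using id by force
    next
      fix u v assume "u \<in> J" "v \<in> J"
      then obtain m r m' r' where "u = m + r * x" "v = m' + r' * x" "m \<in> M" "m' \<in> M" unfolding J_def by blast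
      then have "u + v = (m + m') + (r + r') * x" "m + m' \<in> M" using id by (auto simp: algebra_simps)
      then show "u + v \<in> J" unfolding J_def by blast
    next
      fix s u assume "u \<in> J"
      then obtain m r where "u = m + r * x" "m \<in> M" unfolding J_def by blast
      then have "s * u = s * m + (s * r) * x" "s * m \<in> M" using id by (auto simp: distrib_left mult.assoc)
      then show "s * u \<in> J" unfolding J_def by blast
    qed
    moreover have MJ: "M \<subseteq> J"
    proof
      fix m assume "m \<in> M"
      then have "m = m + 0 * x" "m \<in> M" by auto
      then show "m \<in> J" unfolding J_def by blast
    qed
    moreover have "x \<in> J"
    proof -
      have "x = 0 + 1 * x" "0 \<in> M" using id by auto
      then show ?thesis unfolding J_def by blast
    qed
    ultimately have "1 \<in> J" using M(2)[of J] Mi nx unfolding F_def by blast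
    then obtain m r where "1 = m + r * x" "m \<in> M" unfolding J_def by blast
    then have "y = y * m + r * (x * y)" by (metis distrib_left mult.assoc mult.commute mult_1)
    moreover have "y * m + r * (x * y) \<in> M" using id xy \<open>m \<in> M\<close> by blast
    ultimately show False using ny by simp
  qed
  then have "prime_ring_ideal M" "M \<noteq> {0}" using Mi False by (auto simp: prime_ring_ideal_def)
  moreover have "prime_ring_ideal (range ((*) t))" using t by (simp add: uniformizer_def)
  moreover have "range ((*) t) \<noteq> {0}"
    using t unfolding uniformizer_def by (metis mult.right_neutral rangeI singletonD)
  ultimately have "M = range ((*) t)" using dvr unfolding discrete_valuation_ring_def by blast
  then show ?thesis using Mi(2) by auto
qed simp

lemma uniformizer_nonunit: "uniformizer t \<Longrightarrow> \<not> t dvd 1"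
proof
  assume t: "uniformizer t" and "t dvd 1"
  then have "range ((*) t) = UNIV" by (metis UNIV_eq_I dvdE dvd_trans one_dvd rangeI)
  then show False using t by (simp add: uniformizer_def prime_ring_ideal_def)
qed

section \<open>Matrices as linear operators\<close>

text \<open>Linear endomorphisms of the space of all sequences form a ring. Matrices of all finite
  sizes embed in it, which turns composition in \<^const>\<open>PX\<close> into one associative product.\<close>

typedef (overloaded) 'r lin = "{f :: (nat \<Rightarrow> 'r::idom) \<Rightarrow> nat \<Rightarrow> 'r.
    (\<forall>u v. f (\<lambda>i. u i + v i) = (\<lambda>i. f u i + f v i)) \<and> (\<forall>r u. f (\<lambda>i. r * u i) = (\<lambda>i. r * f u i))}"
  morphisms app Lin
  by (rule exI[of _ "\<lambda>u. u"]) simp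

setup_lifting type_definition_lin

instantiation lin :: (idom) ring_1
begin

lift_definition zero_lin :: "'a lin" is "\<lambda>u i. 0" by simp
lift_definition one_lin :: "'a lin" is "\<lambda>u. u" by simp
lift_definition plus_lin :: "'a lin \<Rightarrow> 'a lin \<Rightarrow> 'a lin" is "\<lambda>f g u i. f u i + g u i"
  by (simp add: algebra_simps)
lift_definition minus_lin :: "'a lin \<Rightarrow> 'a lin \<Rightarrow> 'a lin" is "\<lambda>f g u i. f u i - g u i"
  by (simp add: algebra_simps)
lift_definition uminus_lin :: "'a lin \<Rightarrow> 'a lin" is "\<lambda>f u i. - f u i"
  by (simp add: algebra_simps)
lift_definition times_lin :: "'a lin \<Rightarrow> 'a lin \<Rightarrow> 'a lin" is "\<lambda>f g u. f (g u)"
  by simp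

instance
proof
  show "(0::'a lin) \<noteq> 1" by transfer (metis zero_neq_one)
  show "a * (b + c) = a * b + a * c" for a b c :: "'a lin" by transfer (simp add: fun_eq_iff)
qed (transfer; simp add: fun_eq_iff algebra_simps)+

end

lift_definition scal :: "'r::idom \<Rightarrow> 'r lin" is "\<lambda>r u i. r * u i"
  by (simp add: algebra_simps)

text \<open>The operator reads the first n coordinates, writes the first m and puts zeros elsewhere.
  Entries of \<open>M\<close> out of range have no effect.\<close>

lift_definition mat :: "nat \<Rightarrow> nat \<Rightarrow> (nat \<Rightarrow> nat \<Rightarrow> 'r::idom) \<Rightarrow> 'r lin" is
  "\<lambda>m n M u i. if i < m then \<Sum>j<n. M i j * u j else 0"
  by (auto simp: fun_eq_iff algebra_simps sum.distrib sum_distrib_left)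

lemma scal_comm: "scal r * x = x * scal r"
  by transfer simp

lemma scal_1: "scal 1 = 1"
  and scal_mult: "scal (r * s) = scal r * scal s"
  and scal_diff: "scal (r - s) = scal r - scal s"
  by (transfer; simp add: fun_eq_iff algebra_simps)+

lemma scal_cancel: "r \<noteq> 0 \<Longrightarrow> scal r * x = 0 \<Longrightarrow> x = 0"
  by transfer (simp add: fun_eq_iff)

lemma mat_eq: "mat m n M = mat m n N \<longleftrightarrow> (\<forall>i<m. \<forall>j<n. M i j = N i j)"
proof
  assume *: "mat m n M = mat m n N"
  show "\<forall>i<m. \<forall>j<n. M i j = N i j"
  proof (intro allI impI)
    fix i j assume ij: "i < m" "j < n"
    have "(\<Sum>k<n. L i k * (if k = j then 1 else 0)) = L i j" for L :: "nat \<Rightarrow> nat \<Rightarrow> 'a"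
      using ij by (simp add: if_distrib cong: if_cong)
    moreover have "app (mat m n M) (\<lambda>k. if k = j then 1 else 0) i = app (mat m n N) (\<lambda>k. if k = j then 1 else 0) i"
      using * by simp
    ultimately show "M i j = N i j" using ij by (simp add: mat.rep_eq)
  qed
next
  assume "\<forall>i<m. \<forall>j<n. M i j = N i j"
  then show "mat m n M = mat m n N" by transfer (auto simp: fun_eq_iff intro!: sum.cong)
qed

lemma mat_mult: "mat m n M * mat n k N = mat m k (\<lambda>i j. \<Sum>l<n. M i l * N l j)"
proof transfer
  fix m n k :: nat and M N :: "nat \<Rightarrow> nat \<Rightarrow> 'a"
  have "(\<Sum>j<n. M i j * (\<Sum>l<k. N j l * u l)) = (\<Sum>l<k. (\<Sum>j<n. M i j * N j l) * u l)" for u i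
    by (simp add: sum_distrib_left sum_distrib_right mult.assoc) (rule sum.swap)
  then show "(\<lambda>u. (\<lambda>u i. if i < m then \<Sum>j<n. M i j * u j else 0)
      ((\<lambda>u i. if i < n then \<Sum>j<k. N i j * u j else 0) u)) =
    (\<lambda>u i. if i < m then \<Sum>j<k. (\<Sum>l<n. M i l * N l j) * u j else 0)"
    by (simp add: fun_eq_iff)
qed

lemma mat_add: "mat m n M + mat m n N = mat m n (\<lambda>i j. M i j + N i j)"
  by transfer (auto simp: fun_eq_iff algebra_simps sum.distrib)

lemma mat_uminus: "- mat m n M = mat m n (\<lambda>i j. - M i j)"
  by transfer (auto simp: fun_eq_iff sum_negf)

lemma mat_0: "mat m n (\<lambda>i j. 0) = 0"
  by transfer (simp add: fun_eq_iff)

lemma mat_scal: "scal r * mat m n M = mat m n (\<lambda>i j. r * M i j)"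
  by transfer (auto simp: fun_eq_iff sum_distrib_left mult.assoc)

abbreviation diag :: "nat \<Rightarrow> (nat \<Rightarrow> 'r::idom) \<Rightarrow> 'r lin" where
  "diag n f \<equiv> mat n n (\<lambda>i j. if i = j then f i else 0)"

lemma diag_mult: "diag m f * mat m n M = mat m n (\<lambda>i j. f i * M i j)"
  "mat m n M * diag n f = mat m n (\<lambda>i j. M i j * f j)"
  by (auto simp: mat_mult mat_eq if_distrib if_distribR cong: if_cong)

lemma mat_eq_0: "mat m n M = 0 \<longleftrightarrow> (\<forall>i<m. \<forall>j<n. M i j = 0)"
  using mat_eq[of m n M "\<lambda>i j. 0"] by (simp add: mat_0)

text \<open>The identity of an object is this truncation, an idempotent different from the 1 of the
  ring.\<close>

definition unit_diag :: "nat \<Rightarrow> 'r::idom lin" where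
  "unit_diag n = diag n (\<lambda>_. 1)"

lemma unit_diag_mult: "unit_diag m * mat m n M = mat m n M" "mat m n M * unit_diag n = mat m n M"
  by (simp_all add: unit_diag_def diag_mult)

section \<open>Block inclusions and projections\<close>

definition inl :: "nat \<Rightarrow> nat \<Rightarrow> 'r::idom lin" where
  "inl m n = mat (m + n) m (\<lambda>i j. if i = j then 1 else 0)"
definition inr :: "nat \<Rightarrow> nat \<Rightarrow> 'r::idom lin" where
  "inr m n = mat (m + n) n (\<lambda>i j. if i = m + j then 1 else 0)"
definition prl :: "nat \<Rightarrow> nat \<Rightarrow> 'r::idom lin" where
  "prl m n = mat m (m + n) (\<lambda>i j. if i = j then 1 else 0)"
definition prr :: "nat \<Rightarrow> nat \<Rightarrow> 'r::idom lin" where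
  "prr m n = mat n (m + n) (\<lambda>i j. if j = m + i then 1 else 0)"

lemma prl_mat: "prl m n * mat (m + n) k M = mat m k M"
  by (auto simp: prl_def mat_mult mat_eq if_distrib if_distribR cong: if_cong)

lemma prr_mat: "prr m n * mat (m + n) k M = mat n k (\<lambda>i j. M (m + i) j)"
  by (auto simp: prr_def mat_mult mat_eq if_distrib if_distribR cong: if_cong)

lemma inl_mat: "inl m n * mat m k M = mat (m + n) k (\<lambda>i j. if i < m then M i j else 0)"
  by (auto simp: inl_def mat_mult mat_eq if_distrib if_distribR cong: if_cong)

lemma inr_mat: "inr m n * mat n k M = mat (m + n) k (\<lambda>i j. if i < m then 0 else M (i - m) j)"
proof -
  have "(\<Sum>l<n. (if i = m + l then 1 else 0) * M l j) = (if i < m then 0 else M (i - m) j)"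
    if i: "i < m + n" for i j
  proof (cases "i < m")
    case False
    then have "(\<Sum>l<n. (if i = m + l then 1 else 0) * M l j) = (\<Sum>l<n. if l = i - m then M l j else 0)"
      by (intro sum.cong) auto
    also have "\<dots> = M (i - m) j" using less_diff_conv2[of m i n] i False by simp
    finally show ?thesis using False by simp
  qed auto
  then show ?thesis by (simp add: inr_def mat_mult mat_eq)
qed

lemma mat_prl: "mat k m M * prl m n = mat k (m + n) (\<lambda>i j. if j < m then M i j else 0)"
  by (auto simp: prl_def mat_mult mat_eq if_distrib if_distribR cong: if_cong)

lemma mat_prr: "mat k n M * prr m n = mat k (m + n) (\<lambda>i j. if j < m then 0 else M i (j - m))"
proof -
  have "(\<Sum>l<n. M i l * (if j = m + l then 1 else 0)) = (if j < m then 0 else M i (j - m))"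
    if i: "j < m + n" for i j
  proof (cases "j < m")
    case False
    then have "(\<Sum>l<n. M i l * (if j = m + l then 1 else 0)) = (\<Sum>l<n. if l = j - m then M i l else 0)"
      by (intro sum.cong) auto
    also have "\<dots> = M i (j - m)" using less_diff_conv2[of m j n] i False by simp
    finally show ?thesis using False by simp
  qed auto
  then show ?thesis by (simp add: prr_def mat_mult mat_eq)
qed

lemma incl_proj:
  "prl m n * inl m n = unit_diag m" "prr m n * inr m n = unit_diag n"
  "prl m n * inr m n = 0" "prr m n * inl m n = 0"
  "inl m n * prl m n + inr m n * prr m n = unit_diag (m + n)"
proof -
  show "prl m n * inl m n = unit_diag m" by (simp add: inl_def prl_mat unit_diag_def)
  show "prr m n * inr m n = unit_diag n" by (simp add: inr_def prr_mat unit_diag_def)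
  show "prl m n * inr m n = 0" by (auto simp: inr_def prl_mat mat_eq_0)
  show "prr m n * inl m n = 0" by (auto simp: inl_def prr_mat mat_eq_0)
  show "inl m n * prl m n + inr m n * prr m n = unit_diag (m + n)"
    unfolding prl_def inl_mat prr_def inr_mat unit_diag_def mat_add mat_eq by auto
qed

text \<open>The weight \<open>b\<close> is a cochain with coboundary \<open>c\<close>: replacing \<open>r f\<^sub>x\<^sub>y\<close> by \<open>r t\<^bsup>b x y\<^esup>\<close> turns composition
  in \<open>\<P>(X)\<close> into multiplication of matrices over \<open>R\<close>, with divisibility conditions on the entries.\<close>

locale weighted =
  fixes t :: "'r::idom" and X :: "'x set" and b :: "'x \<Rightarrow> 'x \<Rightarrow> nat" and \<phi> :: "'x \<Rightarrow> 'x"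
  assumes t_0: "t \<noteq> 0" and t_nonunit: "\<not> t dvd 1" and nonunit: "\<not> a dvd 1 \<Longrightarrow> t dvd a"
    and b_refl: "x \<in> X \<Longrightarrow> b x x = 0"
    and b_tri: "\<lbrakk>x \<in> X; y \<in> X; z \<in> X\<rbrakk> \<Longrightarrow> b x z \<le> b x y + b y z"
    and \<phi>_bij: "bij_betw \<phi> X X"
    and b_\<phi>: "\<lbrakk>x \<in> X; y \<in> X\<rbrakk> \<Longrightarrow> b x y + b y (\<phi> y) = b x (\<phi> x) + b (\<phi> x) (\<phi> y)"
    and b_\<phi>\<phi>: "x \<in> X \<Longrightarrow> b x (\<phi> (\<phi> x)) = b x (\<phi> x) + b (\<phi> x) (\<phi> (\<phi> x))"
    and b_loop: "x \<in> X \<Longrightarrow> b x (\<phi> (\<phi> x)) + b (\<phi> (\<phi> x)) x \<le> 1"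
begin

definition Ob :: "'x list set" where "Ob = {xs. set xs \<subseteq> X}"

definition H :: "'x list \<Rightarrow> 'x list \<Rightarrow> 'r lin set" where
  "H A B = {f. A \<in> Ob \<and> B \<in> Ob \<and> (\<exists>M. f = mat (length B) (length A) M \<and>
     (\<forall>i<length B. \<forall>j<length A. t ^ b (A ! j) (B ! i) dvd M i j))}"

abbreviation e :: "'x list \<Rightarrow> 'r lin" where "e A \<equiv> unit_diag (length A)"

definition \<eta> :: "'x list \<Rightarrow> 'r lin" where
  "\<eta> A = diag (length A) (\<lambda>i. t ^ b (A ! i) (\<phi> (A ! i)))"

text \<open>The subtraction is not truncated for objects: \<open>b_\<phi>_le\<close> bounds the
  weight of \<open>\<eta>\<close> by 1, so the product with \<open>\<eta>\<close> is exactly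
  t.\<close>

definition \<xi> :: "'x list \<Rightarrow> 'r lin" where
  "\<xi> A = diag (length A) (\<lambda>i. t ^ (1 - b (A ! i) (\<phi> (A ! i))))"

lemma nth_in: "A \<in> Ob \<Longrightarrow> i < length A \<Longrightarrow> A ! i \<in> X"
  by (auto simp: Ob_def)

lemma \<phi>_in: "x \<in> X \<Longrightarrow> \<phi> x \<in> X"
  using \<phi>_bij by (rule bij_betw_apply)

lemma map_in: "A \<in> Ob \<Longrightarrow> map \<phi> A \<in> Ob"
  by (auto simp: Ob_def \<phi>_in)

lemma HI:
  assumes "A \<in> Ob" "B \<in> Ob" "length B = m" "length A = n"
    and "\<And>i j. i < m \<Longrightarrow> j < n \<Longrightarrow> t ^ b (A ! j) (B ! i) dvd M i j"
  shows "mat m n M \<in> H A B"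
  using assms by (auto simp: H_def)

lemma HE:
  assumes "f \<in> H A B"
  obtains M where "A \<in> Ob" "B \<in> Ob" "f = mat (length B) (length A) M"
    "\<And>i j. i < length B \<Longrightarrow> j < length A \<Longrightarrow> t ^ b (A ! j) (B ! i) dvd M i j"
  using assms by (auto simp: H_def)

lemma diag_in:
  assumes "A \<in> Ob" "B \<in> Ob" "length A = n" "length B = n"
    and "\<And>i. i < n \<Longrightarrow> t ^ b (A ! i) (B ! i) dvd f i"
  shows "diag n f \<in> H A B"
  by (rule HI) (use assms in auto)

sublocale hom_ring Ob H e
proof
  fix f g A B D assume "g \<in> H B D" "f \<in> H A B"
  then obtain M N where *: "A \<in> Ob" "B \<in> Ob" "D \<in> Ob" "f = mat (length B) (length A) M" "g = mat (length D) (length B) N"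
    "\<And>i j. i < length B \<Longrightarrow> j < length A \<Longrightarrow> t ^ b (A ! j) (B ! i) dvd M i j"
    "\<And>i j. i < length D \<Longrightarrow> j < length B \<Longrightarrow> t ^ b (B ! j) (D ! i) dvd N i j"
    by (metis HE)
  show "g * f \<in> H A D"
    unfolding *(4,5) mat_mult
  proof (rule HI[OF *(1,3) refl refl dvd_sum])
    fix i j l assume ij: "i < length D" "j < length A" "l \<in> {..<length B}"
    have "t ^ b (A ! j) (D ! i) dvd t ^ (b (B ! l) (D ! i) + b (A ! j) (B ! l))"
      using b_tri[of "A ! j" "B ! l" "D ! i"] ij * nth_in by (intro le_imp_power_dvd) auto
    also have "\<dots> dvd N i l * M l j"
      unfolding power_add using ij * by (intro mult_dvd_mono) auto
    finally show "t ^ b (A ! j) (D ! i) dvd N i l * M l j" .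
  qed
next
  fix A B assume "A \<in> Ob" "B \<in> Ob"
  then have "mat (length B) (length A) (\<lambda>i j. 0) \<in> H A B" by (intro HI) auto
  then show "0 \<in> H A B" by (simp add: mat_0)
next
  fix f g A B assume "f \<in> H A B" "g \<in> H A B"
  then show "f + g \<in> H A B" by (elim HE) (auto simp: mat_add intro!: HI)
next
  fix A assume A: "A \<in> Ob"
  show "e A \<in> H A A" unfolding unit_diag_def by (rule diag_in) (auto simp: A b_refl nth_in)
qed (auto elim!: HE simp: unit_diag_mult mat_uminus intro!: HI)

text \<open>The loop through \<open>\<phi> (\<phi> x)\<close> has weight at most 1, and by
  \<open>b_\<phi>\<phi>\<close> it passes through \<open>\<phi> x\<close> at no extra cost; the
  triangle inequality shortens it.\<close>

lemma b_\<phi>_le: "x \<in> X \<Longrightarrow> b x (\<phi> x) \<le> 1" "x \<in> X \<Longrightarrow> b (\<phi> x) x + b x (\<phi> x) \<le> 1"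
  using b_\<phi>\<phi>[of x] b_loop[of x] b_tri[of "\<phi> x" "\<phi> (\<phi> x)" x] by (auto simp: \<phi>_in)

lemma \<eta>_in: "A \<in> Ob \<Longrightarrow> \<eta> A \<in> H A (map \<phi> A)"
  unfolding \<eta>_def by (rule diag_in) (auto simp: map_in)

lemma \<xi>_in: "A \<in> Ob \<Longrightarrow> \<xi> A \<in> H (map \<phi> A) A"
  unfolding \<xi>_def
proof (rule diag_in)
  fix i assume "A \<in> Ob" "i < length A"
  then show "t ^ b (map \<phi> A ! i) (A ! i) dvd t ^ (1 - b (A ! i) (\<phi> (A ! i)))"
    using b_\<phi>_le(2)[of "A ! i"] nth_in by (intro le_imp_power_dvd) force
qed (auto simp: map_in)

lemma \<xi>_\<eta>: "A \<in> Ob \<Longrightarrow> \<xi> A * \<eta> A = scal t * e A" "A \<in> Ob \<Longrightarrow> \<eta> A * \<xi> A = scal t * e (map \<phi> A)"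
  using b_\<phi>_le(1) nth_in unfolding \<xi>_def \<eta>_def unit_diag_def mat_scal diag_mult(1) mat_eq length_map
  by (auto simp flip: power_add)

text \<open>By \<open>b_\<phi>\<phi>\<close> and \<open>b_loop\<close> the entry of
  \<open>\<xi>\<close> holds enough powers of t to split off an entry of the next
  \<open>\<eta>\<close> and still leave a morphism. The differential of \<open>G V\<close> factors
  through \<open>\<eta>\<close> for this reason.\<close>

lemma \<xi>_fac: assumes "A \<in> Ob" shows "\<exists>g\<in>H (map \<phi> (map \<phi> A)) A. \<xi> A = g * \<eta> (map \<phi> A)"
proof
  let ?g = "diag (length A) (\<lambda>i. t ^ (1 - b (A ! i) (\<phi> (\<phi> (A ! i)))))"
  show "?g \<in> H (map \<phi> (map \<phi> A)) A"
  proof (rule diag_in)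
    fix i assume "i < length A"
    then show "t ^ b (map \<phi> (map \<phi> A) ! i) (A ! i) dvd t ^ (1 - b (A ! i) (\<phi> (\<phi> (A ! i))))"
      using b_loop[of "A ! i"] nth_in assms by (intro le_imp_power_dvd) force
  qed (use map_in[OF map_in[OF assms]] assms in auto)
  show "\<xi> A = ?g * \<eta> (map \<phi> A)"
    unfolding \<xi>_def \<eta>_def length_map diag_mult(1) mat_eq
  proof (intro allI impI)
    fix i j assume i: "i < length A" "j < length A"
    let ?x = "A ! i"
    have "1 - b ?x (\<phi> ?x) = (1 - b ?x (\<phi> (\<phi> ?x))) + b (\<phi> ?x) (\<phi> (\<phi> ?x))"
      using b_\<phi>\<phi>[of ?x] b_loop[of ?x] nth_in[OF assms i(1)] by linarith
    then have "t ^ (1 - b ?x (\<phi> ?x)) = t ^ (1 - b ?x (\<phi> (\<phi> ?x))) * t ^ b (\<phi> ?x) (\<phi> (\<phi> ?x))"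
      by (metis power_add)
    then show "(if i = j then t ^ (1 - b ?x (\<phi> ?x)) else 0) = t ^ (1 - b ?x (\<phi> (\<phi> ?x))) *
      (if i = j then t ^ b (map \<phi> A ! i) (\<phi> (map \<phi> A ! i)) else 0)"
      using i by auto
  qed
qed

text \<open>The automorphism keeps the coefficient \<open>r i j\<close> and changes only the weight;
  \<open>b_\<phi>\<close> says that both ways around the naturality square have the same total
  weight.\<close>

lemma \<phi>_lift:
  assumes "A \<in> Ob" "B \<in> Ob" and "f' = mat (length B) (length A) M'" "f = mat (length B) (length A) M"
    and "\<And>i j. i < length B \<Longrightarrow> j < length A \<Longrightarrow>
      M' i j = t ^ b (\<phi> (A ! j)) (\<phi> (B ! i)) * r i j \<and> M i j = t ^ b (A ! j) (B ! i) * r i j"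
  shows "f' * \<eta> A = \<eta> B * f"
  unfolding \<eta>_def assms(3,4) diag_mult mat_eq
proof (intro allI impI)
  fix i j assume ij: "i < length B" "j < length A"
  have "t ^ (b (A ! j) (B ! i) + b (B ! i) (\<phi> (B ! i))) = t ^ (b (A ! j) (\<phi> (A ! j)) + b (\<phi> (A ! j)) (\<phi> (B ! i)))"
    using b_\<phi> nth_in ij assms by metis
  then show "M' i j * t ^ b (A ! j) (\<phi> (A ! j)) = t ^ b (B ! i) (\<phi> (B ! i)) * M i j"
    using assms(5)[OF ij] by (simp add: power_add ac_simps)
qed

lemma \<phi>_up: assumes "f \<in> H A B" shows "\<exists>f'\<in>H (map \<phi> A) (map \<phi> B). f' * \<eta> A = \<eta> B * f"
proof -
  obtain M where M: "A \<in> Ob" "B \<in> Ob" "f = mat (length B) (length A) M"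
    "\<And>i j. i < length B \<Longrightarrow> j < length A \<Longrightarrow> t ^ b (A ! j) (B ! i) dvd M i j" using assms by (rule HE) blast
  define r where "r i j = (SOME r. M i j = t ^ b (A ! j) (B ! i) * r)" for i j
  have r: "M i j = t ^ b (A ! j) (B ! i) * r i j" if "i < length B" "j < length A" for i j
    unfolding r_def using M(4)[OF that] unfolding dvd_def by (rule someI_ex)
  let ?f = "mat (length B) (length A) (\<lambda>i j. t ^ b (\<phi> (A ! j)) (\<phi> (B ! i)) * r i j)"
  have "?f \<in> H (map \<phi> A) (map \<phi> B)" by (rule HI) (auto simp: M map_in)
  moreover have "?f * \<eta> A = \<eta> B * f" by (rule \<phi>_lift[OF M(1,2) refl M(3), of _ r]) (auto simp: r)
  ultimately show ?thesis by blast
qed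

lemma \<phi>_down:
  assumes A: "A \<in> Ob" and B: "B \<in> Ob" and f': "f' \<in> H (map \<phi> A) (map \<phi> B)"
  shows "\<exists>f\<in>H A B. f' * \<eta> A = \<eta> B * f"
proof -
  obtain M where M: "f' = mat (length B) (length A) M"
    "\<And>i j. i < length B \<Longrightarrow> j < length A \<Longrightarrow> t ^ b (\<phi> (A ! j)) (\<phi> (B ! i)) dvd M i j"
    using f' by (rule HE) auto
  define r where "r i j = (SOME r. M i j = t ^ b (\<phi> (A ! j)) (\<phi> (B ! i)) * r)" for i j
  have r: "M i j = t ^ b (\<phi> (A ! j)) (\<phi> (B ! i)) * r i j" if "i < length B" "j < length A" for i j
    unfolding r_def using M(2)[OF that] unfolding dvd_def by (rule someI_ex)
  let ?f = "mat (length B) (length A) (\<lambda>i j. t ^ b (A ! j) (B ! i) * r i j)"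
  have "?f \<in> H A B" by (rule HI) (auto simp: A B)
  moreover have "f' * \<eta> A = \<eta> B * ?f" by (rule \<phi>_lift[OF A B M(1) refl, of r]) (auto simp: r)
  ultimately show ?thesis by blast
qed

lemma map_surj: "A \<in> Ob \<Longrightarrow> \<exists>B\<in>Ob. map \<phi> B = A"
proof
  let ?\<psi> = "inv_into X \<phi>"
  assume A: "A \<in> Ob"
  then have "x \<in> set A \<Longrightarrow> \<phi> (?\<psi> x) = x \<and> ?\<psi> x \<in> X" for x
    using \<phi>_bij unfolding Ob_def bij_betw_def by (metis f_inv_into_f inv_into_into mem_Collect_eq subsetD)
  then show "map \<phi> (map ?\<psi> A) = A" "map ?\<psi> A \<in> Ob" by (auto simp: Ob_def intro!: map_idI)
qed

section \<open>Direct sums of lists and elimination over the local ring\<close>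

lemma bp_append:
  assumes A: "A \<in> Ob" and B: "B \<in> Ob"
  shows "bp A B (A @ B) (inl (length A) (length B)) (inr (length A) (length B)) (prl (length A) (length B)) (prr (length A) (length B))"
proof -
  have AB: "A @ B \<in> Ob" using A B by (simp add: Ob_def)
  have "inl (length A) (length B) \<in> H A (A @ B)" unfolding inl_def
    by (rule HI) (auto simp: A AB b_refl nth_in nth_append)
  moreover have "inr (length A) (length B) \<in> H B (A @ B)" unfolding inr_def
    by (rule HI) (auto simp: B AB b_refl nth_in nth_append)
  moreover have "prl (length A) (length B) \<in> H (A @ B) A" unfolding prl_def
    by (rule HI) (auto simp: A AB b_refl nth_in nth_append)
  moreover have "prr (length A) (length B) \<in> H (A @ B) B" unfolding prr_def
    by (rule HI) (auto simp: B AB b_refl nth_in nth_append)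
  ultimately show ?thesis unfolding bp_def using incl_proj[of "length A" "length B"] by simp
qed

text \<open>Every nonunit is a multiple of t, so a sum of nonunits is one too and cannot be a
  unit.\<close>

lemma sum_unit:
  fixes f :: "nat \<Rightarrow> 'r"
  assumes "(\<Sum>l\<in>S. f l) dvd 1" shows "\<exists>l\<in>S. f l dvd 1"
proof (rule ccontr)
  assume "\<not> (\<exists>l\<in>S. f l dvd 1)"
  then have "t dvd (\<Sum>l\<in>S. f l)" using nonunit by (intro dvd_sum) blast
  then show False using assms t_nonunit dvd_trans by blast
qed

lemma one_minus_unit: "\<exists>w. w * (1 - a * t) = 1"
proof -
  have "\<not> t dvd 1 - a * t" using t_nonunit dvd_add[of t "1 - a * t" "a * t"] by auto
  then have "1 - a * t dvd 1" using nonunit by blast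
  then show ?thesis by (metis dvdE mult.commute)
qed

text \<open>Rearranges the sum of \<open>U\<close> and (\<open>Y\<close> and \<open>W\<close>) as
  the sum of \<open>Y\<close> and (\<open>U\<close> and \<open>W\<close>), which takes a summand out
  of the middle of a list.\<close>

lemma bp_middle:
  assumes 1: "bp U B' B i j p q" and 2: "bp Y W B' i2 j2 p2 q2" and 3: "bp U W C i3 j3 p3 q3"
  shows "bp Y C B (j * i2) (i * p3 + j * j2 * q3) (p2 * q) (i3 * p + j3 * q2 * q)"
proof -
  note m = bp_in[OF 1] bp_in[OF 2] bp_in[OF 3]
  note E = bp_eq[OF 1, THEN mult_eq_assoc] bp_eq[OF 2, THEN mult_eq_assoc] bp_eq[OF 3, THEN mult_eq_assoc]
  show ?thesis
  proof (rule bpI)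
    show "j * i2 \<in> H Y B" "i * p3 + j * j2 * q3 \<in> H C B" "p2 * q \<in> H B Y" "i3 * p + j3 * q2 * q \<in> H B C"
      by (rule m add_in mult_in)+
  qed (auto simp: algebra_simps E m[THEN unit_simps])
qed

text \<open>\<open>\<rho> * \<alpha> = 1\<close> is one equation between a sum of products of
  entries and 1, so by locality some product \<open>N 0 l * M l 0\<close> is a unit. Coordinate
  \<open>l\<close> becomes \<open>Y\<close>, and deleting it from the list gives
  \<open>C\<close>.\<close>

lemma elimination:
  assumes \<alpha>: "\<alpha> \<in> H A B" and \<rho>: "\<rho> \<in> H B A" and \<rho>\<alpha>: "\<rho> * \<alpha> = e A" and A: "length A = 1"
  shows "\<exists>Y C i j p q v. bp Y C B i j p q \<and> v \<in> H Y A \<and> v * (p * \<alpha>) = e A \<and> p * \<alpha> * v = e Y \<and>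
    length B = Suc (length C)"
proof -
  obtain M where M: "A \<in> Ob" "B \<in> Ob" "\<alpha> = mat (length B) 1 M"
    using \<alpha> by (rule HE) (simp add: A)
  obtain N where N: "\<rho> = mat 1 (length B) N" "\<And>j. j < length B \<Longrightarrow> t ^ b (B ! j) (A ! 0) dvd N 0 j"
    using \<rho> by (rule HE) (simp add: A)
  have "(\<Sum>l<length B. N 0 l * M l 0) = 1"
    using \<rho>\<alpha> unfolding M N mat_mult unit_diag_def A mat_eq by simp
  then obtain l where l: "l < length B" "N 0 l * M l 0 dvd 1"
    using sum_unit[of "\<lambda>l. N 0 l * M l 0" "{..<length B}"] by auto
  then obtain u where u: "N 0 l * M l 0 * u = 1" by (metis dvdE)
  define us ys where "us = take l B" and "ys = drop (Suc l) B"
  have B: "B = us @ [B ! l] @ ys" using l by (simp add: us_def ys_def id_take_nth_drop)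
  have o: "us \<in> Ob" "[B ! l] \<in> Ob" "ys \<in> Ob" "[B ! l] @ ys \<in> Ob"
    using M(2) l(1) unfolding Ob_def us_def ys_def by (auto dest!: in_set_takeD in_set_dropD)
  have lB: "length us = l" "length B = l + (1 + length ys)" using l by (auto simp: us_def ys_def)
  note b1 = bp_append[OF o(1,4), folded B]
  note b2 = bp_middle[OF b1 bp_append[OF o(2,3)] bp_append[OF o(1,3)]]
  let ?p = "prl (length [B ! l]) (length ys) * prr (length us) (length ([B ! l] @ ys))"
  \<comment> \<open>The inverse of \<open>M l 0\<close>. The factor \<open>N 0 l\<close> also
    provides the power of t that makes it a morphism.\<close>
  let ?v = "mat 1 1 (\<lambda>i j. N 0 l * u)"
  have p\<alpha>: "?p * \<alpha> = mat 1 1 (\<lambda>i j. M l j)"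
  proof -
    have "?p * \<alpha> = prl 1 (length ys) * (prr l (1 + length ys) * mat (l + (1 + length ys)) 1 M)"
      unfolding M(3) by (simp add: mult.assoc lB)
    also have "\<dots> = mat 1 1 (\<lambda>i j. M l j)"
      unfolding prr_mat prl_mat by (simp add: mat_eq)
    finally show ?thesis .
  qed
  have "?v \<in> H [B ! l] A"
    by (rule HI) (use M o A N(2)[OF l(1)] in auto)
  moreover have "?v * (?p * \<alpha>) = e A" "?p * \<alpha> * ?v = e [B ! l]"
    unfolding p\<alpha> mat_mult unit_diag_def A using u by (auto simp: mat_eq ac_simps)
  moreover have "length B = Suc (length (us @ ys))" by (simp add: lB)
  ultimately show ?thesis using b2 by blast
qed

text \<open>The second relation replaces the (0, 0) entry of \<open>a\<close> by that of
  \<open>bb * g\<close>. The first one then writes 1 as a sum of products of an entry of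
  \<open>g\<close> with the opposite entry of \<open>bb\<close>, and locality picks out a
  unit.\<close>

lemma pivot:
  assumes Q: "Q \<in> Ob" "length Q > 0" and g: "g \<in> H (map \<phi> Q) Q" and bb: "bb \<in> H Q (map \<phi> Q)" and a: "a \<in> H Q Q"
    and eq: "a + g * bb = e Q" "\<eta> Q * a = bb * g * \<eta> Q"
  shows "\<exists>V \<alpha> \<alpha>' \<beta> r w. V \<in> Ob \<and> length V = 1 \<and> \<alpha> \<in> H V Q \<and> \<alpha>' \<in> H (map \<phi> V) (map \<phi> Q) \<and>
        \<alpha>' * \<eta> V = \<eta> Q * \<alpha> \<and> \<beta> \<in> H Q (map \<phi> V) \<and> \<beta> * \<alpha> = r * \<eta> V \<and> \<beta> * g * \<alpha>' = e (map \<phi> V) \<and>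
        r \<in> range scal \<and> w \<in> range scal \<and> w * (1 - r * r * scal t) = 1"
proof -
  let ?n = "length Q"
  obtain Ma where Ma: "a = mat ?n ?n Ma" using a by (rule HE) blast
  obtain Mg where Mg: "g = mat ?n ?n Mg" using g by (rule HE) simp
  obtain Mb where Mb: "bb = mat ?n ?n Mb" "\<And>i j. i < ?n \<Longrightarrow> j < ?n \<Longrightarrow> t ^ b (Q ! j) (\<phi> (Q ! i)) dvd Mb i j"
    using bb by (rule HE) auto
  have "Ma 0 0 + (\<Sum>k<?n. Mg 0 k * Mb k 0) = 1"
    using eq(1) Q unfolding Ma Mg Mb mat_mult mat_add unit_diag_def mat_eq by auto
  \<comment> \<open>On the diagonal the weights of \<open>\<eta>\<close> on the two sides are equal
    and cancel.\<close>
  moreover have "Ma 0 0 = (\<Sum>k<?n. Mb 0 k * Mg k 0)"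
  proof -
    have "bb * g = mat ?n ?n (\<lambda>i j. \<Sum>k<?n. Mb i k * Mg k j)" unfolding Mb(1) Mg mat_mult ..
    then have ent: "\<forall>i<?n. \<forall>j<?n. t ^ b (Q ! i) (\<phi> (Q ! i)) * Ma i j =
        (\<Sum>k<?n. Mb i k * Mg k j) * t ^ b (Q ! j) (\<phi> (Q ! j))"
      using eq(2) unfolding Ma \<eta>_def by (simp add: diag_mult mat_eq)
    have "t ^ b (Q ! 0) (\<phi> (Q ! 0)) * Ma 0 0 = t ^ b (Q ! 0) (\<phi> (Q ! 0)) * (\<Sum>k<?n. Mb 0 k * Mg k 0)"
      using ent[rule_format, OF Q(2) Q(2)] by (simp only: mult.commute)
    then show ?thesis using t_0 by simp
  qed
  ultimately have "(\<Sum>k<?n. Mg 0 k * Mb k 0 + Mb 0 k * Mg k 0) = 1" by (simp add: sum.distrib add.commute)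
  then obtain k where k: "k < ?n" "Mg 0 k * Mb k 0 + Mb 0 k * Mg k 0 dvd 1"
    using sum_unit[of "\<lambda>k. Mg 0 k * Mb k 0 + Mb 0 k * Mg k 0" "{..<?n}"] by auto
  then have "Mg 0 k * Mb k 0 dvd 1 \<or> Mb 0 k * Mg k 0 dvd 1"
    using nonunit[of "Mg 0 k * Mb k 0"] nonunit[of "Mb 0 k * Mg k 0"] dvd_add dvd_trans t_nonunit by blast
  then obtain i j where ij: "i < ?n" "j < ?n" "Mb j i * Mg i j dvd 1"
    using k(1) Q(2) by (auto simp: mult.commute)
  then obtain u where u: "u * (Mb j i * Mg i j) = 1" by (metis dvdE mult.commute)
  let ?V = "[Q ! j]"
  have V: "?V \<in> Ob" using nth_in[OF Q(1) ij(2)] by (simp add: Ob_def)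
  \<comment> \<open>Inclusion of coordinate \<open>j\<close>; its weight is 0, so the same matrix
    serves as its image under \<phi>. Below, \<open>?\<beta>\<close> is a single entry of
    \<open>bb\<close> scaled by \<open>u\<close> to make \<open>?\<beta> * g * ?\<alpha>\<close> the
    identity.\<close>
  let ?\<alpha> = "mat ?n 1 (\<lambda>k l. if k = j then 1 else 0)"
  let ?\<beta> = "mat 1 ?n (\<lambda>k l. if l = i then u * Mb j i else 0)"
  have \<alpha>: "?\<alpha> \<in> H ?V Q" by (rule HI) (auto simp: V Q b_refl nth_in)
  have \<alpha>': "?\<alpha> \<in> H (map \<phi> ?V) (map \<phi> Q)"
    by (rule HI) (auto simp: V Q b_refl nth_in \<phi>_in map_in[of ?V, simplified] map_in)
  have nat: "?\<alpha> * \<eta> ?V = \<eta> Q * ?\<alpha>"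
    unfolding \<eta>_def by (simp add: diag_mult mat_eq diag_mult(2)[of _ 1, simplified])
  have \<beta>: "?\<beta> \<in> H Q (map \<phi> ?V)"
    by (rule HI) (use Mb(2) ij in \<open>auto simp: V Q map_in[of ?V, simplified]\<close>)
  have "?\<beta> * mat ?n ?n Mg = mat 1 ?n (\<lambda>k l. u * Mb j i * Mg i l)"
    using ij by (simp add: mat_mult mat_eq if_distrib if_distribR cong: if_cong)
  then have unit: "?\<beta> * g * ?\<alpha> = e (map \<phi> ?V)"
    using ij u unfolding Mg by (simp add: mat_mult mat_eq unit_diag_def if_distrib if_distribR ac_simps cong: if_cong)
  \<comment> \<open>Unless \<open>i = j\<close> the composite is 0. If \<open>i = j\<close>, the
    entry of \<open>bb\<close> is a morphism from \<open>Q ! j\<close> to its image under \<phi>,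
    hence a multiple of the entry of \<open>\<eta>\<close>.\<close>
  obtain r where r: "?\<beta> * ?\<alpha> = scal r * \<eta> ?V"
  proof (cases "i = j")
    case True
    then obtain s where "Mb j i = t ^ b (Q ! j) (\<phi> (Q ! j)) * s" using Mb(2) ij by (metis dvdE)
    then have "?\<beta> * ?\<alpha> = scal (u * s) * \<eta> ?V"
      using True ij by (simp add: mat_mult \<eta>_def mat_scal mat_eq if_distrib if_distribR ac_simps cong: if_cong)
    then show ?thesis by (rule that)
  next
    case False
    then have "?\<beta> * ?\<alpha> = scal 0 * \<eta> ?V"
      using ij by (simp add: mat_mult \<eta>_def mat_scal mat_eq if_distrib if_distribR cong: if_cong)
    then show ?thesis by (rule that)
  qed
  obtain w where "w * (1 - r * r * t) = 1" using one_minus_unit by blast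
  then have "scal w * (1 - scal r * scal r * scal t) = 1"
    by (metis scal_1 scal_diff scal_mult)
  then show ?thesis using V \<alpha> \<alpha>' nat \<beta> r unit
    by (intro exI[of _ ?V] exI[of _ ?\<alpha>] exI[of _ ?\<beta>] exI[of _ "scal r"] exI[of _ "scal w"])
      (simp del: list.map)
qed

end

locale cyclic = weighted t X b \<phi>
  for t :: "'r::idom" and X :: "'x set" and b :: "'x \<Rightarrow> 'x \<Rightarrow> nat" and \<phi> +
  fixes c :: "'x \<Rightarrow> 'x \<Rightarrow> 'x \<Rightarrow> nat"
  assumes c_b: "\<lbrakk>x \<in> X; y \<in> X; z \<in> X\<rbrakk> \<Longrightarrow> c x y z + b x z = b x y + b y z"
begin

abbreviation PXc where "PXc \<equiv> PX t X c"

section \<open>Representing \<P>(X) by operators\<close>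

lemma PX_simps:
  "ob PXc = Ob"
  "M \<in> hm PXc A B \<longleftrightarrow> (\<forall>i j. \<not> (i < length B \<and> j < length A) \<longrightarrow> M i j = 0)"
  "cmp PXc A B D N M = (\<lambda>i k. if i < length D \<and> k < length A
     then \<Sum>j<length B. N i j * M j k * t ^ c (A ! k) (B ! j) (D ! i) else 0)"
  "idn PXc A = (\<lambda>i j. if i < length A \<and> i = j then 1 else 0)"
  "smul PXc r M = (\<lambda>i j. r * M i j)"
  by (auto simp: PX_def additive_closure_def linearization_def Ob_def cong: if_cong)

definition rep :: "'x list \<Rightarrow> 'x list \<Rightarrow> 'r morph \<Rightarrow> 'r lin" where
  "rep A B M = mat (length B) (length A) (\<lambda>i j. M i j * t ^ b (A ! j) (B ! i))"

lemma rep_in: "\<lbrakk>A \<in> Ob; B \<in> Ob\<rbrakk> \<Longrightarrow> rep A B M \<in> H A B"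
  unfolding rep_def by (rule HI) auto

lemma rep_eq:
  assumes "M \<in> hm PXc A B" "N \<in> hm PXc A B" "rep A B M = rep A B N" shows "M = N"
proof -
  have "M i j = N i j" if "i < length B" "j < length A" for i j
    using assms(3) that t_0 by (simp add: rep_def mat_eq)
  then show ?thesis using assms(1,2) unfolding PX_simps by (metis ext)
qed

lemma rep_surj:
  assumes "f \<in> H A B" shows "\<exists>M\<in>hm PXc A B. rep A B M = f"
proof -
  obtain M where M: "f = mat (length B) (length A) M"
    "\<And>i j. i < length B \<Longrightarrow> j < length A \<Longrightarrow> t ^ b (A ! j) (B ! i) dvd M i j"
    using assms by (rule HE) blast
  define r where "r i j = (SOME r. M i j = t ^ b (A ! j) (B ! i) * r)" for i j
  have r: "M i j = t ^ b (A ! j) (B ! i) * r i j" if "i < length B" "j < length A" for i j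
    unfolding r_def using M(2)[OF that] unfolding dvd_def by (rule someI_ex)
  let ?M = "\<lambda>i j. if i < length B \<and> j < length A then r i j else 0"
  have "?M \<in> hm PXc A B" by (simp add: PX_simps)
  moreover have "rep A B ?M = f" unfolding rep_def M(1) mat_eq by (simp add: r mult.commute)
  ultimately show ?thesis by blast
qed

lemma rep_add: "rep A B (M + N) = rep A B M + rep A B N"
  by (simp add: rep_def mat_add mat_eq distrib_right)

lemma rep_smul: "rep A B (smul PXc r M) = scal r * rep A B M"
  by (simp add: rep_def PX_simps mat_scal mat_eq mult.assoc)

lemma rep_idn: "A \<in> Ob \<Longrightarrow> rep A A (idn PXc A) = e A"
  by (auto simp: rep_def PX_simps unit_diag_def mat_eq b_refl nth_in)

lemma rep_eta: "rep A (map \<phi> A) (eta A) = \<eta> A"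
  by (auto simp: rep_def eta_def \<eta>_def mat_eq)

lemma rep_0: "rep A B 0 = 0"
  by (simp add: rep_def mat_0)

lemma rep_cmp:
  assumes "A \<in> Ob" "B \<in> Ob" "D \<in> Ob"
  shows "rep A D (cmp PXc A B D N M) = rep B D N * rep A B M"
  unfolding rep_def mat_mult mat_eq
proof (intro allI impI)
  fix i k assume ik: "i < length D" "k < length A"
  have eq: "N i j * M j k * t ^ c (A ! k) (B ! j) (D ! i) * t ^ b (A ! k) (D ! i) =
    (N i j * t ^ b (B ! j) (D ! i)) * (M j k * t ^ b (A ! k) (B ! j))" if "j < length B" for j
  proof -
    have "t ^ c (A ! k) (B ! j) (D ! i) * t ^ b (A ! k) (D ! i) = t ^ b (A ! k) (B ! j) * t ^ b (B ! j) (D ! i)"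
      using c_b[of "A ! k" "B ! j" "D ! i"] nth_in assms ik that by (metis power_add)
    then show ?thesis by (simp add: mult.assoc mult.left_commute)
  qed
  show "cmp PXc A B D N M i k * t ^ b (A ! k) (D ! i) =
    (\<Sum>l<length B. N i l * t ^ b (B ! l) (D ! i) * (M l k * t ^ b (A ! k) (B ! l)))"
    using ik by (simp add: PX_simps sum_distrib_right) (rule sum.cong[OF refl], rule eq, simp)
qed

lemma PX_closed:
  "0 \<in> hm PXc A B" "idn PXc A \<in> hm PXc A A" "cmp PXc A B D N M \<in> hm PXc A D"
  "M \<in> hm PXc A B \<Longrightarrow> smul PXc r M \<in> hm PXc A B" "eta A \<in> hm PXc A (map \<phi> A)"
  "M \<in> hm PXc A B \<Longrightarrow> N \<in> hm PXc A B \<Longrightarrow> M + N \<in> hm PXc A B"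
  "M \<in> hm PXc A B \<Longrightarrow> - M \<in> hm PXc A B"
  by (auto simp: PX_simps eta_def)

lemma rep_eq_iff:
  "\<lbrakk>M \<in> hm PXc A B; N \<in> hm PXc A B\<rbrakk> \<Longrightarrow> M = N \<longleftrightarrow> rep A B M = rep A B N"
  using rep_eq by blast

lemma eta_cancel:
  assumes "A \<in> Ob" "f * \<eta> A = g * \<eta> A" "f \<in> H (map \<phi> A) B" "g \<in> H (map \<phi> A) B" shows "f = g"
proof -
  have "f * (\<eta> A * \<xi> A) = g * (\<eta> A * \<xi> A)" using assms(2) by (simp add: mult.assoc[symmetric])
  then have "scal t * f = scal t * g"
    using assms(1) e_right[OF assms(3)] e_right[OF assms(4)]
    by (simp add: \<xi>_\<eta> mult.assoc[symmetric] scal_comm[symmetric]) (simp add: mult.assoc)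
  then have "scal t * (f - g) = 0" by (simp add: right_diff_distrib)
  then show ?thesis using scal_cancel[OF t_0] by fastforce
qed

text \<open>Read through \<open>rep\<close>, the description of \<open>xi\<close> becomes
  \<open>k * \<eta> A = t\<close>. It is solved by \<open>\<xi> A\<close>, and cancelling
  \<open>\<eta>\<close> shows that the solution is unique.\<close>

lemma xi_rep:
  assumes A: "A \<in> Ob"
  shows "xi t X c \<phi> A \<in> hm PXc (map \<phi> A) A \<and> rep (map \<phi> A) A (xi t X c \<phi> A) = \<xi> A"
proof -
  let ?P = "\<lambda>k. k \<in> hm PXc (map \<phi> A) A \<and> cmp PXc A (map \<phi> A) A k (eta A) = smul PXc t (idn PXc A)"
  have P: "?P k \<longleftrightarrow> k \<in> hm PXc (map \<phi> A) A \<and> rep (map \<phi> A) A k = \<xi> A" for k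
  proof -
    have "cmp PXc A (map \<phi> A) A k (eta A) = smul PXc t (idn PXc A) \<longleftrightarrow>
      rep (map \<phi> A) A k * \<eta> A = scal t * e A"
      by (subst rep_eq_iff[where A = A and B = A]) (simp_all add: PX_closed rep_cmp A map_in rep_eta rep_smul rep_idn)
    also have "\<dots> \<longleftrightarrow> rep (map \<phi> A) A k = \<xi> A"
      using eta_cancel[OF A _ rep_in \<xi>_in] \<xi>_\<eta>(1)[OF A] A map_in by auto
    finally show ?thesis by simp
  qed
  obtain k where "k \<in> hm PXc (map \<phi> A) A" "rep (map \<phi> A) A k = \<xi> A" using rep_surj \<xi>_in A by blast
  then have "\<exists>!k. ?P k" unfolding P using rep_eq by (intro ex1I[of _ k]) auto
  then have "?P (xi t X c \<phi> A)" unfolding xi_def by (rule theI')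
  then show ?thesis unfolding P .
qed

section \<open>Matrix factorizations in operator form\<close>

definition dif :: "'x list \<times> 'r morph \<Rightarrow> 'r lin" where
  "dif M = rep (fst M) (fst M) (snd M)"

definition objs :: "('x list \<times> 'r morph) set" where
  "objs = {M. fst M \<in> Ob \<and> snd M \<in> hm PXc (fst M) (fst M) \<and> dif M * dif M = scal t * e (fst M) \<and>
     (\<exists>g\<in>H (map \<phi> (fst M)) (fst M). dif M = g * \<eta> (fst M))}"

lemma ob_MF_phi: "ob (MF_phi t X c \<phi>) = objs"
proof -
  have "(P, d) \<in> ob (MF_phi t X c \<phi>) \<longleftrightarrow> (P, d) \<in> objs" for P d
  proof (cases "P \<in> Ob \<and> d \<in> hm PXc P P")
    case True
    then have P: "P \<in> Ob" "d \<in> hm PXc P P" by auto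
    have 1: "cmp PXc P P P d d = smul PXc t (idn PXc P) \<longleftrightarrow> rep P P d * rep P P d = scal t * e P"
      by (subst rep_eq_iff[where A = P and B = P]) (simp_all add: PX_closed rep_cmp P rep_smul rep_idn)
    have 2: "d = cmp PXc P (map \<phi> P) P g (eta P) \<longleftrightarrow> rep P P d = rep (map \<phi> P) P g * \<eta> P" for g
      by (subst rep_eq_iff[OF P(2)]) (simp_all add: PX_closed rep_cmp P map_in rep_eta)
    have 3: "(\<exists>g\<in>hm PXc (map \<phi> P) P. rep P P d = rep (map \<phi> P) P g * \<eta> P) \<longleftrightarrow>
      (\<exists>g\<in>H (map \<phi> P) P. rep P P d = g * \<eta> P)"
      using rep_surj[of _ "map \<phi> P" P] rep_in[OF map_in[OF P(1)] P(1)] by metis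
    show ?thesis using P
      by (simp add: MF_phi_def MF_def objs_def dif_def 1 2 3 PX_simps(1))
  qed (auto simp: MF_phi_def MF_def objs_def PX_simps(1))
  then show ?thesis by auto
qed

definition iL where "iL V = inl (length V) (length V)"
definition iR where "iR V = inr (length V) (length V)"
definition pL where "pL V = prl (length V) (length V)"
definition pR where "pR V = prr (length V) (length V)"

lemma G_dif:
  assumes V: "V \<in> Ob"
  shows "dif (G_phi t X c \<phi> V) = iL V * \<xi> V * pR V + iR V * \<eta> V * pL V"
proof -
  let ?n = "length V"
  have x: "xi t X c \<phi> V i j * t ^ b (\<phi> (V ! j)) (V ! i) = (if i = j then t ^ (1 - b (V ! i) (\<phi> (V ! i))) else 0)"
    if "i < ?n" "j < ?n" for i j
    using xi_rep[OF V] that unfolding rep_def \<xi>_def by (simp add: mat_eq)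
  show ?thesis
    unfolding iL_def iR_def pL_def pR_def \<xi>_def \<eta>_def inl_mat inr_mat mat_prl mat_prr mat_add
      dif_def rep_def G_phi_def fst_conv snd_conv length_append length_map mat_eq
  proof (intro allI impI)
    fix i j assume ij: "i < ?n + ?n" "j < ?n + ?n"
    consider "i < ?n" "j < ?n" | "i < ?n" "\<not> j < ?n" | "\<not> i < ?n" "j < ?n" | "\<not> i < ?n" "\<not> j < ?n" by blast
    then show "block_matrix ?n ?n 0 (xi t X c \<phi> V) (eta V) 0 i j * t ^ b ((V @ map \<phi> V) ! j) ((V @ map \<phi> V) ! i) =
      (if j < ?n then 0
       else if i < ?n then if i = j - ?n then t ^ (1 - b (V ! i) (\<phi> (V ! i))) else 0 else 0) +
      (if j < ?n
       then if i < ?n then 0 else if i - ?n = j then t ^ b (V ! (i - ?n)) (\<phi> (V ! (i - ?n))) else 0 else 0)"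
    proof cases
      case 2
      then have "j - ?n < ?n" using ij by linarith
      then show ?thesis using 2 x[of i "j - ?n"] by (simp add: block_matrix_def nth_append)
    next
      case 3
      then have "i - ?n < ?n" using ij by linarith
      then show ?thesis using 3 by (auto simp: block_matrix_def nth_append eta_def)
    qed (auto simp: block_matrix_def)
  qed
qed

lemma G_objs: assumes V: "V \<in> Ob" shows "G_phi t X c \<phi> V \<in> objs"
proof -
  have m: "map \<phi> V \<in> Ob" "V @ map \<phi> V \<in> Ob" using map_in[OF V] V by (auto simp: Ob_def)
  note bV = bp_append[OF V m(1), unfolded length_map, folded iL_def iR_def pL_def pR_def]
  note mm = bp_in[OF bV] \<eta>_in[OF V] \<xi>_in[OF V] and E = bp_eq[OF bV, THEN mult_eq_assoc]
  have hm: "block_matrix (length V) (length V) 0 (xi t X c \<phi> V) (eta V) 0 \<in> hm PXc (V @ map \<phi> V) (V @ map \<phi> V)"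
    using xi_rep[OF V] unfolding PX_simps by (auto simp: block_matrix_def eta_def)
  let ?d = "iL V * \<xi> V * pR V + iR V * \<eta> V * pL V"
  have sc: "x * (scal t * y) = scal t * (x * y)" for x y :: "'r lin" by (metis mult.assoc scal_comm)
  have "\<xi> V * (\<eta> V * pL V) = scal t * (e V * pL V)" "\<eta> V * (\<xi> V * pR V) = scal t * (e (map \<phi> V) * pR V)"
    using \<xi>_\<eta>[OF V] by (metis mult.assoc)+
  then have x: "\<xi> V * (\<eta> V * pL V) = scal t * pL V" "\<eta> V * (\<xi> V * pR V) = scal t * pR V"
    using e_left[OF mm(3)] e_left[OF mm(4)] by auto
  have "?d * ?d = iL V * (\<xi> V * (\<eta> V * pL V)) + iR V * (\<eta> V * (\<xi> V * pR V))"
    by (simp add: algebra_simps E(1-4) mm[THEN unit_simps] del: length_map)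
  also have "\<dots> = scal t * (iL V * pL V + iR V * pR V)"
    unfolding x by (simp add: sc distrib_left)
  finally have "?d * ?d = scal t * (iL V * pL V + iR V * pR V)" .
  then have sq: "?d * ?d = scal t * e (V @ map \<phi> V)" using bV by (simp add: bp_def)
  \<comment> \<open>One block of the differential is \<open>\<eta> V\<close>, the other factors
    through \<open>\<eta> (map \<phi> V)\<close>. Naturality exchanges these with the projections,
    which leaves \<open>\<eta>\<close> of the whole sum on the right.\<close>
  obtain g where g: "g \<in> H (map \<phi> (map \<phi> V)) V" "\<xi> V = g * \<eta> (map \<phi> V)" using \<xi>_fac[OF V] by blast
  obtain pL' where pL': "pL' \<in> H (map \<phi> (V @ map \<phi> V)) (map \<phi> V)" "pL' * \<eta> (V @ map \<phi> V) = \<eta> V * pL V"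
    using \<phi>_up[OF mm(3)] by blast
  obtain pR' where pR': "pR' \<in> H (map \<phi> (V @ map \<phi> V)) (map \<phi> (map \<phi> V))"
      "pR' * \<eta> (V @ map \<phi> V) = \<eta> (map \<phi> V) * pR V"
    using \<phi>_up[OF mm(4)] by blast
  have "iL V * g * pR' + iR V * pL' \<in> H (map \<phi> (V @ map \<phi> V)) (V @ map \<phi> V)"
    by (rule mm g pL' pR' add_in mult_in)+
  moreover have "?d = (iL V * g * pR' + iR V * pL') * \<eta> (V @ map \<phi> V)"
    unfolding g(2) by (simp add: distrib_right mult.assoc pL'(2) pR'(2))
  ultimately show ?thesis
    using G_dif[OF V] sq m hm unfolding objs_def mem_Collect_eq by (simp add: G_phi_def) metis
qed

sublocale mf_pivot Ob H e "scal t" "map \<phi>" \<eta> \<xi> objs fst dif "G_phi t X c \<phi>" iL iR pL pR length "range scal"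
proof
  show "\<exists>Z\<in>Ob. e Z = 0"
    by (rule bexI[of _ "[]"]) (auto simp: unit_diag_def mat_eq_0 Ob_def)
next
  fix A B assume "A \<in> Ob" "B \<in> Ob"
  then show "\<exists>S i j p q. bp A B S i j p q" using bp_append by blast
next
  fix d A assume d: "d \<in> H A A" "d * d = scal t * e A" "\<exists>g\<in>H (map \<phi> A) A. d = g * \<eta> A"
  then obtain M where "M \<in> hm PXc A A" "rep A A M = d" using rep_surj by blast
  then show "\<exists>M\<in>objs. fst M = A \<and> dif M = d"
    using d H_ob[OF d(1)] by (intro bexI[of _ "(A, M)"]) (auto simp: objs_def dif_def)
next
  fix V assume V: "V \<in> Ob"
  show "bp V (map \<phi> V) (fst (G_phi t X c \<phi> V)) (iL V) (iR V) (pL V) (pR V)"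
    using bp_append[OF V map_in[OF V]] by (simp add: iL_def iR_def pL_def pR_def G_phi_def)
next
  fix M assume "M \<in> objs"
  then show "dif M \<in> H (fst M) (fst M)" by (simp add: objs_def dif_def rep_in)
next
  fix r :: "'r lin" and f A B assume "r \<in> range scal" "f \<in> H A B"
  then show "r * f \<in> H A B" by (auto elim!: HE simp: mat_scal intro!: HI)
next
  fix f A B assume "f \<in> H A B"
  then show "scal t * f \<in> H A B" by (auto elim!: HE simp: mat_scal intro!: HI)
next
  fix A assume "A \<in> Ob" "length A = 0"
  then show "e A = 0" by (simp add: unit_diag_def mat_eq_0)
next
  fix A B f' assume "A \<in> Ob" "B \<in> Ob" "f' \<in> H (map \<phi> A) (map \<phi> B)"
  then show "\<exists>f\<in>H A B. f' * \<eta> A = \<eta> B * f" by (rule \<phi>_down)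
next
  fix \<alpha> A B \<rho> assume "\<alpha> \<in> H A B" "\<rho> \<in> H B A" "\<rho> * \<alpha> = e A" "length A = 1"
  then show "\<exists>Y C i j p q v. bp Y C B i j p q \<and> v \<in> H Y A \<and> v * (p * \<alpha>) = e A \<and> p * \<alpha> * v = e Y \<and>
    length B = Suc (length C)" by (rule elimination)
next
  fix Q g bb a assume "Q \<in> Ob" "0 < length Q" "g \<in> H (map \<phi> Q) Q" "bb \<in> H Q (map \<phi> Q)" "a \<in> H Q Q"
    "a + g * bb = e Q" "\<eta> Q * a = bb * g * \<eta> Q"
  then show "\<exists>V \<alpha> \<alpha>' \<beta> r w. V \<in> Ob \<and> length V = 1 \<and> \<alpha> \<in> H V Q \<and> \<alpha>' \<in> H (map \<phi> V) (map \<phi> Q) \<and>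
        \<alpha>' * \<eta> V = \<eta> Q * \<alpha> \<and> \<beta> \<in> H Q (map \<phi> V) \<and> \<beta> * \<alpha> = r * \<eta> V \<and> \<beta> * g * \<alpha>' = e (map \<phi> V) \<and>
        r \<in> range scal \<and> w \<in> range scal \<and> w * (1 - r * r * scal t) = 1"
    by (rule pivot)
next
  fix V assume "V \<in> Ob"
  then show "G_phi t X c \<phi> V \<in> objs" by (rule G_objs)
next
  fix A :: "'x list"
  show "length (map \<phi> A) = length A" by simp
qed (auto simp: scal_comm scal_cancel[OF t_0] map_in map_surj \<eta>_in \<xi>_in \<xi>_\<eta> \<phi>_up G_dif objs_def simp del: length_map)

text \<open>Since \<open>rep\<close> is bijective on hom-sets and multiplicative, the equations for
  a splitting in \<P>(X) are exactly those of \<open>bp\<close>, and the equation for a morphism of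
  factorizations is that of \<open>mh\<close>.\<close>

lemma rep_iso: "cat_iso (MF_phi t X c \<phi>) mfc (\<lambda>M N. rep (fst M) (fst N)) (MF_phi_exact t X c \<phi>) mfe"
proof -
  have hm: "f \<in> hm (MF_phi t X c \<phi>) M N \<longleftrightarrow> f \<in> hm PXc (fst M) (fst N) \<and> rep (fst M) (fst N) f \<in> mh M N"
    if "M \<in> objs" "N \<in> objs" for M N f
  proof (cases "f \<in> hm PXc (fst M) (fst N)")
    case True
    have o: "fst M \<in> Ob" "fst N \<in> Ob" using that by (auto simp: objs_def)
    have "cmp PXc (fst M) (fst N) (fst N) (snd N) f = cmp PXc (fst M) (fst M) (fst N) f (snd M) \<longleftrightarrow>
      rep (fst M) (fst N) f * dif M = dif N * rep (fst M) (fst N) f"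
      by (subst rep_eq_iff[where A = "fst M" and B = "fst N"]) (auto simp: PX_closed rep_cmp o dif_def)
    then show ?thesis using True that rep_in[OF o]
      by (auto simp: MF_phi_def MF_def mh_iff split: prod.splits)
  qed (auto simp: MF_phi_def MF_def split: prod.splits)
  have simps: "cmp (MF_phi t X c \<phi>) M N L = cmp PXc (fst M) (fst N) (fst L)" "idn (MF_phi t X c \<phi>) M = idn PXc (fst M)" for M N L
    by (auto simp: MF_phi_def MF_def split: prod.splits)
  have o: "M \<in> objs \<Longrightarrow> fst M \<in> Ob" for M by (simp add: objs_def)
  note cl = M.add_in M.uminus_in M.zero_in M.mult_in M.e_in
  have rep_um: "rep A B (- f) = - rep A B f" for A B f
    using rep_add[of A B f "- f"] rep_0[of A B] by (simp add: eq_neg_iff_add_eq_0 add.commute)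
  have exact: "MF_phi_exact t X c \<phi> A f B g D \<longleftrightarrow> A \<in> objs \<and> B \<in> objs \<and> D \<in> objs \<and>
      f \<in> hm (MF_phi t X c \<phi>) A B \<and> g \<in> hm (MF_phi t X c \<phi>) B D \<and>
      mfe A (rep (fst A) (fst B) f) B (rep (fst B) (fst D) g) D" for A f B g D
  proof (cases "A \<in> objs \<and> B \<in> objs \<and> D \<in> objs \<and> f \<in> hm (MF_phi t X c \<phi>) A B \<and> g \<in> hm (MF_phi t X c \<phi>) B D")
    case True
    then have ooo: "A \<in> objs" "B \<in> objs" "D \<in> objs" by auto
    then have fg: "f \<in> hm PXc (fst A) (fst B)" "g \<in> hm PXc (fst B) (fst D)"
      and mh: "rep (fst A) (fst B) f \<in> mh A B" "rep (fst B) (fst D) g \<in> mh B D"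
      using True hm[OF ooo(1,2)] hm[OF ooo(2,3)] by blast+
    note oo = o[OF ooo(1)] o[OF ooo(2)] o[OF ooo(3)]
    let ?f = "rep (fst A) (fst B) f" and ?g = "rep (fst B) (fst D) g"
    have "split_exact PXc (fst A) f (fst B) g (fst D) \<longleftrightarrow>
      (\<exists>s r. bp (fst A) (fst D) (fst B) ?f s r ?g)"
    proof
      assume "split_exact PXc (fst A) f (fst B) g (fst D)"
      then obtain r s where rs: "cmp PXc (fst A) (fst B) (fst D) g f = 0"
        "cmp PXc (fst A) (fst B) (fst A) r f = idn PXc (fst A)"
        "cmp PXc (fst D) (fst B) (fst D) g s = idn PXc (fst D)"
        "cmp PXc (fst B) (fst A) (fst B) f r + cmp PXc (fst B) (fst D) (fst B) s g = idn PXc (fst B)"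
        unfolding split_exact_def by blast
      have "bp (fst A) (fst D) (fst B) ?f (rep (fst D) (fst B) s) (rep (fst B) (fst A) r) ?g"
        using rs[THEN arg_cong, of "rep (fst A) (fst D)"] rs[THEN arg_cong, of "rep (fst A) (fst A)"]
          rs[THEN arg_cong, of "rep (fst D) (fst D)"] rs[THEN arg_cong, of "rep (fst B) (fst B)"]
        by (intro bpI rep_in oo) (simp_all add: rep_cmp oo rep_idn rep_0 rep_add)
      then show "\<exists>s r. bp (fst A) (fst D) (fst B) ?f s r ?g" by blast
    next
      assume "\<exists>s r. bp (fst A) (fst D) (fst B) ?f s r ?g"
      then obtain s r where b: "bp (fst A) (fst D) (fst B) ?f s r ?g" by blast
      obtain r0 s0 where 0: "r0 \<in> hm PXc (fst B) (fst A)" "s0 \<in> hm PXc (fst D) (fst B)"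
        "rep (fst B) (fst A) r0 = r" "rep (fst D) (fst B) s0 = s"
        using rep_surj bp_in[OF b] by meson
      show "split_exact PXc (fst A) f (fst B) g (fst D)"
        unfolding split_exact_def
      proof (intro conjI bexI[OF _ 0(1)] bexI[OF _ 0(2)])
        show "cmp PXc (fst A) (fst B) (fst D) g f = 0"
          by (rule rep_eq[where A = "fst A" and B = "fst D"]) (use b in \<open>simp_all add: PX_closed rep_cmp oo rep_0 bp_def\<close>)
        show "cmp PXc (fst A) (fst B) (fst A) r0 f = idn PXc (fst A)"
          by (rule rep_eq[where A = "fst A" and B = "fst A"]) (use b in \<open>simp_all add: PX_closed rep_cmp oo rep_idn bp_def 0\<close>)
        show "cmp PXc (fst D) (fst B) (fst D) g s0 = idn PXc (fst D)"
          by (rule rep_eq[where A = "fst D" and B = "fst D"]) (use b in \<open>simp_all add: PX_closed rep_cmp oo rep_idn bp_def 0\<close>)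
        show "cmp PXc (fst B) (fst A) (fst B) f r0 + cmp PXc (fst B) (fst D) (fst B) s0 g = idn PXc (fst B)"
          by (rule rep_eq[where A = "fst B" and B = "fst B"]) (use b in \<open>simp_all add: PX_closed rep_cmp oo rep_idn rep_add bp_def 0\<close>)
      qed (use oo fg in \<open>simp_all add: PX_simps(1)\<close>)
    qed
    then show ?thesis using True mh unfolding MF_phi_exact_def mfe_def ob_MF_phi by simp
  qed (auto simp: MF_phi_exact_def ob_MF_phi)
  show ?thesis
  proof
    fix A B assume "A \<in> ob (MF_phi t X c \<phi>)" "B \<in> ob (MF_phi t X c \<phi>)"
    then have AB: "A \<in> objs" "B \<in> objs" by (auto simp: ob_MF_phi)
    show "bij_betw (rep (fst A) (fst B)) (hm (MF_phi t X c \<phi>) A B) (hm mfc A B)"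
      unfolding bij_betw_def
    proof
      show "inj_on (rep (fst A) (fst B)) (hm (MF_phi t X c \<phi>) A B)"
        using rep_eq hm[OF AB] by (auto intro!: inj_onI)
      show "rep (fst A) (fst B) ` hm (MF_phi t X c \<phi>) A B = hm mfc A B"
      proof (intro equalityI subsetI)
        fix f assume "f \<in> hm mfc A B"
        then have f: "f \<in> mh A B" by simp
        then obtain M where "M \<in> hm PXc (fst A) (fst B)" "rep (fst A) (fst B) M = f"
          using rep_surj mh_in by blast
        then show "f \<in> rep (fst A) (fst B) ` hm (MF_phi t X c \<phi>) A B" using hm[OF AB] f by blast
      qed (use hm[OF AB] in auto)
    qed
  next
    fix A B D f g assume *: "A \<in> ob (MF_phi t X c \<phi>)" "B \<in> ob (MF_phi t X c \<phi>)" "D \<in> ob (MF_phi t X c \<phi>)"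
      "f \<in> hm (MF_phi t X c \<phi>) A B" "g \<in> hm (MF_phi t X c \<phi>) B D"
    then have "rep (fst B) (fst D) g * rep (fst A) (fst B) f \<in> mh A D"
      by (intro M.mult_in[of _ B]) (simp_all add: ob_MF_phi hm)
    then show "cmp (MF_phi t X c \<phi>) A B D g f \<in> hm (MF_phi t X c \<phi>) A D"
      using * by (simp add: ob_MF_phi hm simps PX_closed rep_cmp o)
  qed (simp_all add: ob_MF_phi hm simps PX_closed rep_cmp rep_add rep_um rep_0 rep_idn o cl exact)
qed

theorem MF_phi_frobenius:
  "frobenius_category (MF_phi t X c \<phi>) (MF_phi_exact t X c \<phi>)"
  "V \<in> ob PXc \<Longrightarrow> projective_object (MF_phi t X c \<phi>) (MF_phi_exact t X c \<phi>) (G_phi t X c \<phi> V)"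
  "V \<in> ob PXc \<Longrightarrow> injective_object (MF_phi t X c \<phi>) (MF_phi_exact t X c \<phi>) (G_phi t X c \<phi> V)"
  "projective_object (MF_phi t X c \<phi>) (MF_phi_exact t X c \<phi>) M \<Longrightarrow>
    \<exists>V\<in>ob PXc. isomorphic_in (MF_phi t X c \<phi>) M (G_phi t X c \<phi> V)"
proof -
  interpret R: cat_iso "MF_phi t X c \<phi>" mfc "\<lambda>M N. rep (fst M) (fst N)" "MF_phi_exact t X c \<phi>" mfe
    by (rule rep_iso)
  note ex = mfe_exact
  show "frobenius_category (MF_phi t X c \<phi>) (MF_phi_exact t X c \<phi>)"
    by (rule R.frobenius[OF mfc_frobenius])
  show "projective_object (MF_phi t X c \<phi>) (MF_phi_exact t X c \<phi>) (G_phi t X c \<phi> V)" if "V \<in> ob PXc" for V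
    using G_projective that R.projective_iff[OF ex] by (simp add: PX_simps(1))
  show "injective_object (MF_phi t X c \<phi>) (MF_phi_exact t X c \<phi>) (G_phi t X c \<phi> V)" if "V \<in> ob PXc" for V
    using G_injective that R.injective_iff[OF ex] by (simp add: PX_simps(1))
  show "\<exists>V\<in>ob PXc. isomorphic_in (MF_phi t X c \<phi>) M (G_phi t X c \<phi> V)"
    if P: "projective_object (MF_phi t X c \<phi>) (MF_phi_exact t X c \<phi>) M" for M
  proof -
    have "M \<in> objs" using P by (simp add: projective_object_def ob_MF_phi)
    moreover obtain V where V: "V \<in> Ob" "isomorphic_in mfc M (G_phi t X c \<phi> V)"
      using projective_isomorphic_G P R.projective_iff[OF ex] by blast
    ultimately have "isomorphic_in (MF_phi t X c \<phi>) M (G_phi t X c \<phi> V)"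
      using R.isomorphic_in_iff[of M "G_phi t X c \<phi> V"] G_objs by (simp add: ob_MF_phi)
    then show ?thesis using V by (auto simp: PX_simps(1))
  qed
qed

end

theorem theorem1p4p6:
  fixes t :: "'r::idom"
    and X :: "'x set" and c :: "'x \<Rightarrow> 'x \<Rightarrow> 'x \<Rightarrow> nat"
    and Y :: "'y set" and le :: "'y \<Rightarrow> 'y \<Rightarrow> bool" and \<pi> :: "'y \<Rightarrow> 'x" and \<sigma> :: "'y \<Rightarrow> 'y"
    and \<phi> :: "'x \<Rightarrow> 'x"
  assumes "discrete_valuation_ring TYPE('r)" and "uniformizer t"
    and "cyclic_poset X c"
    and "covering_poset_of X c Y le \<pi> \<sigma>"
    and "admissible_automorphism X c Y le \<pi> \<sigma> \<phi>"
  shows "frobenius_category (MF_phi t X c \<phi>) (MF_phi_exact t X c \<phi>) \<and>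
    (\<forall>V \<in> ob (PX t X c).
       projective_object (MF_phi t X c \<phi>) (MF_phi_exact t X c \<phi>) (G_phi t X c \<phi> V) \<and>
       injective_object (MF_phi t X c \<phi>) (MF_phi_exact t X c \<phi>) (G_phi t X c \<phi> V)) \<and>
    (\<forall>M. projective_object (MF_phi t X c \<phi>) (MF_phi_exact t X c \<phi>) M \<and>
         injective_object (MF_phi t X c \<phi>) (MF_phi_exact t X c \<phi>) M \<longrightarrow>
       (\<exists>V \<in> ob (PX t X c). isomorphic_in (MF_phi t X c \<phi>) M (G_phi t X c \<phi> V)))"
proof -
  \<comment> \<open>Every \<open>c w\<close> with \<open>w \<in> X\<close> is a cochain with coboundary \<open>c\<close>; if \<open>X\<close> is empty, any \<open>w\<close> will do.\<close>
  define w where "w = (SOME w. w \<in> X)"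
  have w: "w \<in> X" if "x \<in> X" for x unfolding w_def using that by (rule someI)
  have coc: "c x y z + c w x z = c w y z + c w x y"
    if "w \<in> X" "x \<in> X" "y \<in> X" "z \<in> X" for w x y z
  proof -
    have "int (c x y z) - int (c w y z) + int (c w x z) - int (c w x y) = 0"
      using assms(3) that unfolding cyclic_poset_def by blast
    then show ?thesis by linarith
  qed
  have c0: "c x x y = 0" "c x y y = 0" if "x \<in> X" "y \<in> X" for x y
    using assms(3) that by (auto simp: cyclic_poset_def)
  have bij: "bij_betw \<phi> X X"
    using assms(5) by (simp add: admissible_automorphism_def cyclic_poset_automorphism_def)
  have \<phi>X: "\<phi> x \<in> X" if "x \<in> X" for x using bij that by (rule bij_betw_apply)
  note adm = admissible_cocycle[OF assms(4,5)]
  interpret cyclic t X "c w" \<phi> c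
  proof
    show "t \<noteq> 0" using assms(2) by (simp add: uniformizer_def)
    show "\<not> t dvd 1" by (rule uniformizer_nonunit[OF assms(2)])
    show "t dvd a" if "\<not> a dvd 1" for a by (rule dvr_nonunit[OF assms(1,2) that])
    show "c w x x = 0" if "x \<in> X" for x using c0 w that by blast
    show b: "c x y z + c w x z = c w x y + c w y z" if "x \<in> X" "y \<in> X" "z \<in> X" for x y z
      using coc[OF w that] that by simp
    \<comment> \<open>The difference of the two sides is a value of \<open>c\<close>, hence
      nonnegative.\<close>
    show "c w x z \<le> c w x y + c w y z" if "x \<in> X" "y \<in> X" "z \<in> X" for x y z
      using b[OF that] by linarith
    show "bij_betw \<phi> X X" by (rule bij)
    show "c w x y + c w y (\<phi> y) = c w x (\<phi> x) + c w (\<phi> x) (\<phi> y)" if "x \<in> X" "y \<in> X" for x y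
      using b[of x y "\<phi> y"] b[of x "\<phi> x" "\<phi> y"] adm(1)[OF that] that \<phi>X by simp
    show "c w x (\<phi> (\<phi> x)) = c w x (\<phi> x) + c w (\<phi> x) (\<phi> (\<phi> x))" if "x \<in> X" for x
      using b[of x "\<phi> x" "\<phi> (\<phi> x)"] adm(2)[OF that] that \<phi>X by simp
    \<comment> \<open>As \<open>c w x x = 0\<close>, the weight of the loop is
      \<open>c x (\<phi> (\<phi> x)) x\<close>.\<close>
    show "c w x (\<phi> (\<phi> x)) + c w (\<phi> (\<phi> x)) x \<le> 1" if "x \<in> X" for x
      using b[of x "\<phi> (\<phi> x)" x] adm(3)[OF that] c0 w that \<phi>X by (metis add.right_neutral)
  qed
  show ?thesis using MF_phi_frobenius by blast
qed

end
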